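(* Let $p>2$ be a prime and let $(a,b,c)$ be nonzero pairwise relatively prime integers with $a^p+b^p+c^p=0$ (with $p\mid c$ if $p\mid abc$). Let $W$ be the subgroup of $K^\times/K^{\times p}$ generated by the images of the group $E_p$ of $p$-units of $K$ and of the numbers $a+b\,\zeta^i$, $b+c\,\zeta^j$, $c+a\,\zeta^k$, for $i,j,k=1,\ldots,p-1$. Then $$\mathrm{rk}_p(W)\ \le\ \frac{p+1}{2}+\mathrm{rk}_p(C\ell)\ \le\ p .$$ If moreover $p$ is regular (i.e. if $C\ell$ is trivial), then $W=E_p/E_p^p$ (where $E_p/E_p^p$ is identified with its image $E_pK^{\times p}/K^{\times p}$ in $K^\times/K^{\times p}$).
   Context: $\zeta$ is a primitive $p$-th root of unity and $K=\mathbb{Q}(\zeta)$. $E_p$ is the group of $p$-units of $K$, i.e. the units of $\mathbb{Z}[\zeta][1/p]$. $C\ell$ is the $p$-class group of $K$ (the $p$-Sylow subgroup of the ideal class group). For an abelian group $A$, $\mathrm{rk}_p(A)$ is the $\mathbb{F}_p$-dimension of $A/A^p$. *)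

theory Defs
  imports
    "HOL-Algebra.Algebra"
    "HOL-Algebra.Algebraic_Closure_Type"
    "HOL-Number_Theory.Residues"
    "HOL-Library.Extended_Nat"
    "Jordan_Normal_Form.Missing_VectorSpace"
begin

section \<open>The \<open>p\<close>-rank of an abelian group\<close>

definition power_subgroup :: "nat \<Rightarrow> ('a, 'b) monoid_scheme \<Rightarrow> 'a set" where
  "power_subgroup n A = (\<lambda>x. x [^]\<^bsub>A\<^esub> n) ` carrier A"

text \<open>
  The quotient \<open>A/A\<^sup>p\<close> of a multiplicatively written abelian group as a vector space over
  \<open>\<int>/p\<close>, whose elements are the integers \<open>0, \<dots>, p - 1\<close>. Vector addition is the group
  operation and scalar multiplication is exponentiation; a module record also has
  multiplicative fields, which play no role in a vector space.
\<close>
definition mod_powers :: "nat \<Rightarrow> ('a, 'b) monoid_scheme \<Rightarrow> (int, 'a set) module" where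
  "mod_powers p A =
     (let Q = A Mod power_subgroup p A in
      \<lparr>carrier = carrier Q, monoid.mult = undefined, monoid.one = undefined,
       ring.zero = \<one>\<^bsub>Q\<^esub>, ring.add = monoid.mult Q, module.smult = (\<lambda>k x. x [^]\<^bsub>Q\<^esub> k)\<rparr>)"

text \<open>
  The library's \<open>dim\<close> is a natural number and is meaningful only in finite dimension, so the
  rank is extended by \<open>\<infinity>\<close>; a bound on the rank thus includes finiteness.
\<close>
definition rk :: "nat \<Rightarrow> ('a, 'b) monoid_scheme \<Rightarrow> enat" where
  "rk p A =
     (let F = residue_ring (int p); V = mod_powers p A in
      if vectorspace.fin_dim F V then enat (vectorspace.dim F V) else \<infinity>)"


section \<open>The ideal class group and its \<open>p\<close>-part\<close>

text \<open>Nonzero fractional ideals of a subring \<open>R\<close> of a field \<open>F\<close>.\<close>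
definition fractional_ideals :: "('a, 'b) ring_scheme \<Rightarrow> 'a set \<Rightarrow> 'a set set" where
  "fractional_ideals F R =
     {I. subgroup I (add_monoid F) \<and>
         (\<forall>r\<in>R. \<forall>x\<in>I. r \<otimes>\<^bsub>F\<^esub> x \<in> I) \<and>
         I \<noteq> {\<zero>\<^bsub>F\<^esub>} \<and>
         (\<exists>d\<in>R - {\<zero>\<^bsub>F\<^esub>}. \<forall>x\<in>I. d \<otimes>\<^bsub>F\<^esub> x \<in> R)}"

text \<open>For a Dedekind domain \<open>R\<close> with field of fractions \<open>F\<close> this is a group.\<close>
definition ideal_group :: "('a, 'b) ring_scheme \<Rightarrow> 'a set \<Rightarrow> 'a set monoid" where
  "ideal_group F R =
     \<lparr>carrier = fractional_ideals F R, monoid.mult = ideal_prod F, monoid.one = R\<rparr>"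

definition principal_ideals :: "('a, 'b) ring_scheme \<Rightarrow> 'a set \<Rightarrow> 'a set set" where
  "principal_ideals F R = {(\<lambda>r. r \<otimes>\<^bsub>F\<^esub> x) ` R | x. x \<in> carrier F - {\<zero>\<^bsub>F\<^esub>}}"

definition ideal_class_group :: "('a, 'b) ring_scheme \<Rightarrow> 'a set \<Rightarrow> 'a set set monoid" where
  "ideal_class_group F R = ideal_group F R Mod principal_ideals F R"

definition is_sylow_subgroup :: "nat \<Rightarrow> ('a, 'b) monoid_scheme \<Rightarrow> 'a set \<Rightarrow> bool" where
  "is_sylow_subgroup p G H \<longleftrightarrow> subgroup H G \<and> card H = p ^ multiplicity p (Coset.order G)"

text \<open>Only for finite abelian groups, where the Sylow subgroup is unique.\<close>
definition sylow_part :: "nat \<Rightarrow> ('a, 'b) monoid_scheme \<Rightarrow> ('a, 'b) monoid_scheme" where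
  "sylow_part p G = G\<lparr>carrier := (THE H. is_sylow_subgroup p G H)\<rparr>"


section \<open>Cyclotomic fields inside the complex numbers\<close>

definition is_primitive_root :: "nat \<Rightarrow> complex \<Rightarrow> bool" where
  "is_primitive_root n \<zeta> \<longleftrightarrow> n > 0 \<and> \<zeta> ^ n = 1 \<and> (\<forall>k. 0 < k \<and> k < n \<longrightarrow> \<zeta> ^ k \<noteq> 1)"

abbreviation complex_ring :: "complex ring" where
  "complex_ring \<equiv> ring_of_type_algebra"

text \<open>\<open>\<rat>(\<zeta>)\<close>\<close>
definition cyc_field :: "complex \<Rightarrow> complex ring" where
  "cyc_field \<zeta> = complex_ring\<lparr>carrier := generate_field complex_ring {\<zeta>}\<rparr>"

definition cyc_integers :: "complex \<Rightarrow> complex set" where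
  "cyc_integers \<zeta> = {x \<in> carrier (cyc_field \<zeta>). algebraic_int x}"

definition p_class_group :: "nat \<Rightarrow> complex \<Rightarrow> complex set set monoid" where
  "p_class_group p \<zeta> = sylow_part p (ideal_class_group (cyc_field \<zeta>) (cyc_integers \<zeta>))"

text \<open>The units of \<open>\<int>[\<zeta>][1/p]\<close>\<close>
definition p_units :: "nat \<Rightarrow> complex \<Rightarrow> complex set" where
  "p_units p \<zeta> =
     Units (complex_ring\<lparr>carrier := generate_ring complex_ring {\<zeta>, 1 / of_nat p}\<rparr>)"

text \<open>\<open>K\<^sup>\<times>/K\<^sup>\<times>\<^sup>p\<close> for \<open>K = \<rat>(\<zeta>)\<close>, and the image in it of an element of \<open>K\<^sup>\<times>\<close>\<close>
definition radical_group :: "nat \<Rightarrow> complex \<Rightarrow> complex set monoid" where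
  "radical_group p \<zeta> =
     units_of (cyc_field \<zeta>) Mod power_subgroup p (units_of (cyc_field \<zeta>))"

definition radical_class :: "nat \<Rightarrow> complex \<Rightarrow> complex \<Rightarrow> complex set" where
  "radical_class p \<zeta> x =
     power_subgroup p (units_of (cyc_field \<zeta>)) #>\<^bsub>units_of (cyc_field \<zeta>)\<^esub> x"

definition W_group :: "nat \<Rightarrow> complex \<Rightarrow> int \<Rightarrow> int \<Rightarrow> int \<Rightarrow> complex set monoid" where
  "W_group p \<zeta> a b c =
     (radical_group p \<zeta>)\<lparr>carrier := generate (radical_group p \<zeta>)
        (radical_class p \<zeta> ` (p_units p \<zeta>
            \<union> {of_int a + of_int b * \<zeta> ^ i | i. i \<in> {1..p - 1}}
            \<union> {of_int b + of_int c * \<zeta> ^ j | j. j \<in> {1..p - 1}}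
            \<union> {of_int c + of_int a * \<zeta> ^ k | k. k \<in> {1..p - 1}}))\<rparr>"

end

theory Submission
  imports
    "HOL-Analysis.Convex"
    "HOL-Analysis.Harmonic_Numbers"
    Defs
    "Jordan_Normal_Form.Char_Poly"
begin

text \<open>
  Let \<open>\<lambda> = 1 - \<zeta>\<close> and \<open>O = \<int>[\<zeta>]\<close>. If \<open>u\<^sup>p + v\<^sup>p + w\<^sup>p = 0\<close>, the factors of
  \<open>\<Prod>\<^sub>j (u + v \<zeta>\<^sup>j) = (-w)\<^sup>p\<close> are pairwise comaximal away from \<open>\<lambda>\<close>, so up to a power of \<open>\<lambda>\<close> each
  of them generates the \<open>p\<close>-th power of an ideal \<open>I\<close>. Hence \<open>W\<close> lies in the group of all \<open>x\<close> with
  \<open>(x) = \<lambda>\<^sup>k I\<^sup>p\<close>, modulo \<open>p\<close>-th powers. Mapping \<open>x\<close> to the class of \<open>I\<close> sends that group into the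
  \<open>p\<close>-torsion of the class group, with kernel the image of \<open>E\<^sub>p\<close>, which is generated by \<open>\<lambda>\<close> and the units
  of \<open>O\<close>. As all groups involved are finite, ranks can be read off from cardinalities, and two
  estimates remain.

  Units: at most \<open>p\<^bsup>(p-1)/2\<^esup>\<close> classes modulo \<open>p\<close>-th powers. Only this upper half of Dirichlet's theorem
  is needed. If \<open>S\<close> is a set of units that are independent modulo torsion and \<open>p\<close>-th powers, the products
  \<open>s\<^sub>0 s\<^sub>1\<^sup>p s\<^sub>2\<^bsup>p\<^sup>2\<^esup> \<cdots>\<close> with \<open>s\<^sub>i \<in> S\<close> are distinct, and for large \<open>S\<close> there are more of them than a box
  of logarithms has room for.

  Class group: fewer than \<open>p\<^bsup>(p+1)/2\<^esup>\<close> elements, so its \<open>p\<close>-rank is at most \<open>(p-1)/2\<close>. Every class contains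
  an integral ideal of norm at most \<open>M = e\<^bsup>5/4\<^esup> (p+1)/2 (p/6)\<^bsup>(p-1)/2\<^esup>\<close> by Blichfeldt's averaging argument,
  and Rankin's method counts these ideals. It succeeds because a prime ideal other than \<open>(\<lambda>)\<close> has norm
  congruent to 1 modulo \<open>p\<close>, which leaves few ideals of small norm.
\<close>

section \<open>Algebraic integers\<close>

text \<open>The second inequality is the demanding one: the class group must have
  \<open>p\<close>-rank at most \<open>(p - 1) / 2\<close> for every \<open>p\<close>, and only its
  size is used for this. The budget is \<open>p ^ (hf + 1)\<close> with
  \<open>hf = (p - 1) / 2\<close>. Rankin's count of the ideals of norm at most M costs a factor
  \<open>2 ^ hf\<close> and a power of p below the first on top of M, so M has to save an
  exponential factor over \<open>p ^ hf\<close>, the order of what plain pigeonhole in a box of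
  coordinates would give. Averaging over all pairs of points in a class saves \<open>6 ^ hf\<close>:
  a uniform coordinate has variance 1/12, a difference of two has twice that. Of this,
  \<open>2 ^ hf\<close> goes to the count and \<open>3 ^ hf\<close> pays for the remaining factors.
  All objects are sets of complex numbers, and conjugation is substitution in a polynomial. One fact
  supports both the independence of 1, ..., \<zeta>^(p-2), hence conjugation, and the integral
  closedness of Z[\<zeta>]: a polynomial of degree below p - 1 whose value at \<zeta> is p times an
  algebraic integer has all its coefficients divisible by p.\<close>

definition zspan :: "('i \<Rightarrow> complex) \<Rightarrow> 'i set \<Rightarrow> complex set" where
  "zspan v I = {\<Sum>i\<in>I. of_int (c i) * v i | c. True}"

lemma zspanI: "(\<Sum>i\<in>I. of_int (c i) * v i) \<in> zspan v I"
  by (auto simp: zspan_def)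

lemma zspan_0: "0 \<in> zspan v I"
  using zspanI[of "\<lambda>_. 0"] by simp

lemma zspan_add:
  assumes "x \<in> zspan v I" "y \<in> zspan v I"
  shows "x + y \<in> zspan v I"
proof -
  obtain c d where "x = (\<Sum>i\<in>I. of_int (c i) * v i)" "y = (\<Sum>i\<in>I. of_int (d i) * v i)"
    using assms by (auto simp: zspan_def)
  then have "x + y = (\<Sum>i\<in>I. of_int (c i + d i) * v i)"
    by (simp add: sum.distrib algebra_simps)
  then show ?thesis using zspanI[where c = "\<lambda>i. c i + d i"] by metis
qed

lemma zspan_smult:
  assumes "x \<in> zspan v I"
  shows "of_int k * x \<in> zspan v I"
proof -
  obtain c where "x = (\<Sum>i\<in>I. of_int (c i) * v i)"
    using assms by (auto simp: zspan_def)
  then have "of_int k * x = (\<Sum>i\<in>I. of_int (k * c i) * v i)"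
    by (simp add: sum_distrib_left mult.assoc)
  then show ?thesis using zspanI[where c = "\<lambda>i. k * c i"] by metis
qed

lemma zspan_sum:
  assumes "\<And>j. j \<in> J \<Longrightarrow> f j \<in> zspan v I"
  shows "(\<Sum>j\<in>J. f j) \<in> zspan v I"
  using assms by (induction J rule: infinite_finite_induct) (auto simp: zspan_0 zspan_add)

lemma zspan_base:
  assumes "finite I" "i \<in> I"
  shows "v i \<in> zspan v I"
proof -
  have "(\<Sum>j\<in>I. of_int (if j = i then 1 else 0) * v j) = v i"
    using assms by (subst sum.mono_neutral_right[of I "{i}"]) auto
  then show ?thesis using zspanI[where c = "\<lambda>j. if j = i then 1 else 0"] by metis
qed

lemma zspan_mult_closed:
  assumes "\<And>i. i \<in> I \<Longrightarrow> x * v i \<in> zspan v I" and "y \<in> zspan v I"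
  shows "x * y \<in> zspan v I"
proof -
  obtain c where "y = (\<Sum>i\<in>I. of_int (c i) * v i)"
    using assms by (auto simp: zspan_def)
  then have "x * y = (\<Sum>i\<in>I. of_int (c i) * (x * v i))"
    by (simp add: sum_distrib_left mult_ac)
  then show ?thesis using assms(1) by (simp add: zspan_sum zspan_smult)
qed

text \<open>The vector v is an eigenvector of an integer matrix, so x is a root of its
  characteristic polynomial, which is monic with integer coefficients.\<close>

lemma algebraic_int_if_int_matrix:
  fixes v :: "nat \<Rightarrow> complex" and A :: "nat \<Rightarrow> nat \<Rightarrow> int"
  assumes eq: "\<And>i. i < n \<Longrightarrow> x * v i = (\<Sum>j<n. of_int (A i j) * v j)"
    and nz: "k < n" "v k \<noteq> 0"
  shows "algebraic_int x"
proof -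
  define M where "M = mat n n (\<lambda>(i, j). A i j)"
  define MC :: "complex mat" where "MC = map_mat of_int M"
  have M: "M \<in> carrier_mat n n" and MC: "MC \<in> carrier_mat n n"
    by (auto simp: M_def MC_def)
  have "eigenvector MC (vec n v) x"
    unfolding eigenvector_def
  proof (intro conjI)
    show "vec n v \<in> carrier_vec (dim_row MC)" using MC by auto
    show "vec n v \<noteq> 0\<^sub>v (dim_row MC)"
      using nz MC by (metis carrier_matD(1) index_vec index_zero_vec(1))
    show "MC *\<^sub>v vec n v = x \<cdot>\<^sub>v vec n v"
      by (rule eq_vecI) (auto simp: MC_def M_def eq scalar_prod_def lessThan_atLeast0)
  qed
  then have "eigenvalue MC x" by (auto simp: eigenvalue_def)
  then have root: "poly (char_poly MC) x = 0"
    using eigenvalue_root_char_poly[OF MC] by simp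
  have "char_poly MC = map_poly of_int (char_poly M)"
    unfolding MC_def by (rule of_int_hom.char_poly_hom[OF M])
  moreover have "monic (char_poly M)" using degree_monic_char_poly[OF M] by simp
  ultimately show ?thesis
    using root by (auto simp: algebraic_int_altdef_ipoly)
qed

text \<open>The matrix criterion for an arbitrary finite index set, so that pairs of exponents can
  serve as indices.\<close>

lemma algebraic_int_if_stable:
  fixes v :: "'i \<Rightarrow> complex"
  assumes fin: "finite I" and stable: "\<And>i. i \<in> I \<Longrightarrow> x * v i \<in> zspan v I"
    and nz: "k \<in> I" "v k \<noteq> 0"
  shows "algebraic_int x"
proof -
  obtain h where h: "bij_betw h {..<card I} I"
    using ex_bij_betw_nat_finite[OF fin] by (metis atLeast0LessThan)
  have "\<exists>c. \<forall>i\<in>I. x * v i = (\<Sum>j\<in>I. of_int (c i j) * v j)"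
    using stable unfolding zspan_def by (intro bchoice) auto
  then obtain c where c: "\<And>i. i \<in> I \<Longrightarrow> x * v i = (\<Sum>j\<in>I. of_int (c i j) * v j)"
    by auto
  obtain k' where k': "k' < card I" "h k' = k"
    using h nz by (metis bij_betw_iff_bijections lessThan_iff)
  show ?thesis
  proof (rule algebraic_int_if_int_matrix[where v = "v \<circ> h" and A = "\<lambda>i j. c (h i) (h j)"])
    show "k' < card I" "(v \<circ> h) k' \<noteq> 0" using k' nz by auto
    fix i assume "i < card I"
    then have "h i \<in> I" using h by (auto simp: bij_betw_def)
    from c[OF this] show "x * (v \<circ> h) i = (\<Sum>j<card I. of_int (c (h i) (h j)) * (v \<circ> h) j)"
      by (subst (asm) sum.reindex_bij_betw[OF h, symmetric]) simp
  qed
qed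

lemma algebraic_int_power_span:
  fixes x :: complex
  assumes "algebraic_int x"
  obtains d where "d > 0" "x ^ d \<in> zspan (\<lambda>i. x ^ i) {..<d}"
proof -
  obtain q where q: "poly (map_poly of_int q) x = 0" "lead_coeff q = 1"
    using assms by (auto simp: algebraic_int_altdef_ipoly)
  define d where "d = Polynomial.degree q"
  have deg: "Polynomial.degree (map_poly of_int q :: complex poly) = d"
    by (simp add: d_def degree_map_poly)
  have "d > 0"
  proof (rule ccontr)
    assume "\<not> d > 0"
    then have "q = 1" using q(2)
      by (simp add: d_def) (metis degree_eq_zeroE lead_coeff_pCons(2) one_pCons poly_const_conv coeff_pCons_0)
    then show False using q(1) by simp
  qed
  have "0 = (\<Sum>i\<le>d. of_int (poly.coeff q i) * x ^ i)"
    using q(1) by (simp add: poly_altdef d_def coeff_map_poly)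
  also have "\<dots> = (\<Sum>i<d. of_int (poly.coeff q i) * x ^ i) + x ^ d"
    using q(2) by (simp add: lessThan_Suc_atMost[symmetric] d_def)
  finally have "x ^ d = of_int (-1) * (\<Sum>i<d. of_int (poly.coeff q i) * x ^ i)"
    by (simp add: add_eq_0_iff)
  then have "x ^ d \<in> zspan (\<lambda>i. x ^ i) {..<d}" by (metis zspan_smult zspanI)
  with \<open>d > 0\<close> show ?thesis using that by blast
qed

text \<open>The products \<open>x ^ i * y ^ j\<close> with i < d and j < e span a finitely generated
  group that is stable under multiplication by x and by y, hence by their sum and product.\<close>

lemma algebraic_int_add_mult:
  fixes x y :: complex
  assumes "algebraic_int x" "algebraic_int y"
  shows "algebraic_int (x + y)" "algebraic_int (x * y)"
proof -
  obtain d where d: "d > 0" "x ^ d \<in> zspan (\<lambda>i. x ^ i) {..<d}"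
    using algebraic_int_power_span[OF assms(1)] .
  obtain e where e: "e > 0" "y ^ e \<in> zspan (\<lambda>i. y ^ i) {..<e}"
    using algebraic_int_power_span[OF assms(2)] .
  define I where "I = {..<d} \<times> {..<e}"
  define v where "v = (\<lambda>(i, j). x ^ i * y ^ j)"
  have fin: "finite I" by (simp add: I_def)
  have x: "x * v ij \<in> zspan v I" if mem: "ij \<in> I" for ij
  proof -
    obtain i j where ij: "ij = (i, j)" "i < d" "j < e" using mem unfolding I_def by blast
    show ?thesis
    proof (cases "Suc i < d")
      case True
      then have "(Suc i, j) \<in> I" using ij by (simp add: I_def)
      from zspan_base[OF fin this, of v] show ?thesis by (simp add: v_def ij mult_ac)
    next
      case False
      then have "x * v ij = x ^ d * y ^ j" using ij
        by (metis Suc_lessI case_prod_conv mult.assoc power_Suc v_def)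
      also obtain c where "x ^ d = (\<Sum>k<d. of_int (c k) * x ^ k)"
        using d(2) by (auto simp: zspan_def)
      then have "x ^ d * y ^ j = (\<Sum>k<d. of_int (c k) * v (k, j))"
        by (simp add: sum_distrib_right v_def mult.assoc)
      finally show ?thesis
        using ij by (auto intro!: zspan_sum zspan_smult zspan_base fin simp: I_def)
    qed
  qed
  have y: "y * v ij \<in> zspan v I" if mem: "ij \<in> I" for ij
  proof -
    obtain i j where ij: "ij = (i, j)" "i < d" "j < e" using mem unfolding I_def by blast
    show ?thesis
    proof (cases "Suc j < e")
      case True
      then have "(i, Suc j) \<in> I" using ij by (simp add: I_def)
      from zspan_base[OF fin this, of v] show ?thesis by (simp add: v_def ij mult_ac)
    next
      case False
      then have "Suc j = e" using ij by simp
      then have "y * v ij = x ^ i * y ^ e" using ij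
        by (auto simp: v_def mult_ac)
      also obtain c where "y ^ e = (\<Sum>k<e. of_int (c k) * y ^ k)"
        using e(2) by (auto simp: zspan_def)
      then have "x ^ i * y ^ e = (\<Sum>k<e. of_int (c k) * v (i, k))"
        by (simp add: sum_distrib_left v_def mult_ac)
      finally show ?thesis
        using ij by (auto intro!: zspan_sum zspan_smult zspan_base fin simp: I_def)
    qed
  qed
  have nz: "(0, 0) \<in> I" "v (0, 0) \<noteq> 0" using d e by (auto simp: I_def v_def)
  show "algebraic_int (x + y)"
    using nz by (intro algebraic_int_if_stable[where v = v, OF fin]) (auto simp: distrib_right intro!: zspan_add x y)
  show "algebraic_int (x * y)"
    using nz by (intro algebraic_int_if_stable[where v = v, OF fin])
      (auto simp: mult.assoc intro!: zspan_mult_closed[OF x] y)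
qed

lemma algebraic_int_sum:
  fixes f :: "'i \<Rightarrow> complex"
  assumes "\<And>i. i \<in> I \<Longrightarrow> algebraic_int (f i)"
  shows "algebraic_int (\<Sum>i\<in>I. f i)"
  using assms by (induction I rule: infinite_finite_induct) (auto intro: algebraic_int_add_mult)

lemma algebraic_int_power:
  fixes x :: complex
  assumes "algebraic_int x"
  shows "algebraic_int (x ^ k)"
  using assms by (induction k) (auto intro: algebraic_int_add_mult)


section \<open>The ring of integers of a cyclotomic field\<close>

text \<open>Both sides are monic of degree n in x and agree at the n distinct powers of \<zeta>; a
  nonzero difference would have more roots than its degree allows.\<close>

lemma root_of_unity_factorization:
  assumes "is_primitive_root n \<zeta>"
  shows "x ^ n - 1 = (\<Prod>i<n. x - \<zeta> ^ i)"
proof -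
  define f :: "complex poly" where "f = Polynomial.monom 1 n + [:-1:]"
  define g where "g = (\<Prod>i<n. [:- (\<zeta> ^ i), 1:])"
  have n: "n > 0" "\<zeta> ^ n = 1" "\<And>k. 0 < k \<Longrightarrow> k < n \<Longrightarrow> \<zeta> ^ k \<noteq> 1"
    using assms by (auto simp: is_primitive_root_def)
  have nz: "\<zeta> \<noteq> 0" using n by (metis power_eq_0_iff zero_neq_one zero_power)
  have inj: "inj_on (\<lambda>i. \<zeta> ^ i) {..<n}"
  proof (rule linorder_inj_onI)
    fix i j assume ij: "i < j" "i \<in> {..<n}" "j \<in> {..<n}"
    then have "\<zeta> ^ j = \<zeta> ^ i * \<zeta> ^ (j - i)" by (simp flip: power_add)
    moreover have "\<zeta> ^ (j - i) \<noteq> 1" using ij by (intro n) auto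
    ultimately show "\<zeta> ^ i \<noteq> \<zeta> ^ j" using nz by auto
  qed auto
  have f1: "Polynomial.degree f = n" "lead_coeff f = 1"
    using n unfolding f_def by (simp_all add: degree_add_eq_left degree_monom_eq coeff_monom coeff_eq_0)
  have g1: "Polynomial.degree g = n" "lead_coeff g = 1"
    unfolding g_def by (subst degree_prod_eq_sum_degree; simp) (simp add: lead_coeff_prod)
  have "f = g"
  proof (rule ccontr)
    assume "f \<noteq> g"
    then have ne: "f - g \<noteq> 0" by simp
    have "poly.coeff (f - g) n = 0" using f1 g1 by simp
    moreover have "Polynomial.degree (f - g) \<le> n" using f1 g1 by (intro degree_diff_le) auto
    ultimately have deg: "Polynomial.degree (f - g) < n"
      using ne by (metis le_neq_implies_less leading_coeff_0_iff)
    have "(\<lambda>i. \<zeta> ^ i) ` {..<n} \<subseteq> {x. poly (f - g) x = 0}"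
    proof (rule image_subsetI)
      fix i assume "i \<in> {..<n}"
      moreover have "(\<zeta> ^ i) ^ n = 1" using n by (metis mult.commute power_mult power_one)
      ultimately show "\<zeta> ^ i \<in> {x. poly (f - g) x = 0}"
        by (auto simp: f_def g_def poly_monom poly_prod)
    qed
    then have "n \<le> card {x. poly (f - g) x = 0}"
      using card_mono[OF poly_roots_finite[OF ne]] card_image[OF inj] by (metis card_lessThan)
    also have "\<dots> \<le> Polynomial.degree (f - g)" using ne by (rule card_poly_roots_bound)
    finally show False using deg by simp
  qed
  then have "poly f x = poly g x" by simp
  then show ?thesis by (simp add: f_def g_def poly_monom poly_prod)
qed

abbreviation ev :: "int poly \<Rightarrow> complex \<Rightarrow> complex" where
  "ev f x \<equiv> poly (map_poly of_int f) x"

lemma ev_eq_sum: "Polynomial.degree f < m \<Longrightarrow> ev f x = (\<Sum>i<m. of_int (poly.coeff f i) * x ^ i)"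
proof -
  assume "Polynomial.degree f < m"
  then have "(\<Sum>i\<le>Polynomial.degree f. of_int (poly.coeff f i) * x ^ i)
      = (\<Sum>i<m. of_int (poly.coeff f i) * x ^ i)"
    by (intro sum.mono_neutral_left) (auto simp: coeff_eq_0)
  then show ?thesis by (simp add: poly_altdef coeff_map_poly)
qed

lemma ev_simps [simp]:
  "ev (f + g) x = ev f x + ev g x" "ev (f - g) x = ev f x - ev g x" "ev (- f) x = - ev f x"
  "ev (f * g) x = ev f x * ev g x" "ev 1 x = 1" "ev 0 x = 0" "ev [:a:] x = of_int a"
  "ev (Polynomial.monom 1 k) x = x ^ k" "ev (Polynomial.smult k f) x = of_int k * ev f x"
  by (simp_all add: hom_distribs poly_monom of_int_hom.map_poly_hom_monom)

lemma ev_pcompose: "ev (pcompose f g) x = ev f (ev g x)"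
  by (simp add: of_int_hom.map_poly_pcompose poly_pcompose)

lemma algebraic_int_ev:
  assumes "algebraic_int x"
  shows "algebraic_int (ev f x)"
  by (subst ev_eq_sum[OF lessI])
    (intro algebraic_int_sum algebraic_int_add_mult algebraic_int_power assms algebraic_int_of_int)

locale cyclotomic =
  fixes p :: nat and \<zeta> :: complex
  assumes prime_p: "Factorial_Ring.prime p" and p_gt_2: "p > 2"
    and prim: "is_primitive_root p \<zeta>"
begin

lemma p_odd: "odd p"
  using prime_p p_gt_2 prime_odd_nat by blast

lemma p_pos [simp]: "p > 0" "p \<noteq> 0" "Suc 0 \<le> p"
  using p_gt_2 by auto

lemma zeta_p [simp]: "\<zeta> ^ p = 1"
  using prim by (simp add: is_primitive_root_def)

lemma zeta_nz [simp]: "\<zeta> \<noteq> 0"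
  using zeta_p by (metis p_pos(2) power_0_left zero_neq_one)

lemma zeta_mod: "\<zeta> ^ (k mod p) = \<zeta> ^ k"
proof -
  have "\<zeta> ^ k = \<zeta> ^ (k div p * p + k mod p)" by simp
  also have "\<dots> = \<zeta> ^ (k mod p)" by (simp only: power_add power_mult mult.commute[of _ p]) simp
  finally show ?thesis by simp
qed

lemma zeta_eq_1_iff: "\<zeta> ^ k = 1 \<longleftrightarrow> p dvd k"
proof -
  have "\<zeta> ^ (k mod p) = 1 \<longleftrightarrow> k mod p = 0"
    using prim unfolding is_primitive_root_def
    by (metis gr0I mod_less_divisor power_0)
  then show ?thesis by (simp add: zeta_mod dvd_eq_mod_eq_0)
qed

lemma sum_zeta_power: "(\<Sum>j<p. \<zeta> ^ (k * j)) = (if p dvd k then of_nat p else 0)"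
proof (cases "p dvd k")
  case True
  then have "\<zeta> ^ (k * j) = 1" for j by (simp add: zeta_eq_1_iff)
  then show ?thesis using True by simp
next
  case False
  have "(\<zeta> ^ k - 1) * (\<Sum>j<p. (\<zeta> ^ k) ^ j) = (\<zeta> ^ k) ^ p - 1"
    by (simp add: power_diff_1_eq)
  also have "(\<zeta> ^ k) ^ p = 1" by (metis zeta_p mult.commute power_mult power_one)
  finally show ?thesis using False zeta_eq_1_iff by (simp add: power_mult)
qed

section \<open>The ring Z[\<zeta>] and the element 1 - \<zeta>\<close>

definition lam :: complex where "lam = 1 - \<zeta>"

text \<open>Z[\<zeta>], presented by polynomials so that conjugation can be defined as a
  substitution.\<close>

definition Oz :: "complex set" where "Oz = range (\<lambda>f. ev f \<zeta>)"

lemma Oz_ev [intro]: "ev f \<zeta> \<in> Oz"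
  by (auto simp: Oz_def)

lemma Oz_closed [intro]:
  "x \<in> Oz \<Longrightarrow> y \<in> Oz \<Longrightarrow> x + y \<in> Oz"
  "x \<in> Oz \<Longrightarrow> y \<in> Oz \<Longrightarrow> x - y \<in> Oz"
  "x \<in> Oz \<Longrightarrow> y \<in> Oz \<Longrightarrow> x * y \<in> Oz"
  "x \<in> Oz \<Longrightarrow> - x \<in> Oz"
  by (auto simp: Oz_def simp flip: ev_simps)

lemma Oz_simps [simp, intro]:
  "0 \<in> Oz" "1 \<in> Oz" "of_int (k :: int) \<in> Oz" "of_nat m \<in> Oz" "\<zeta> ^ i \<in> Oz" "\<zeta> \<in> Oz" "lam \<in> Oz"
proof -
  show *: "of_int k \<in> Oz" for k :: int by (subst ev_simps(7)[symmetric]) (rule Oz_ev)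
  show "0 \<in> Oz" "1 \<in> Oz" "of_nat m \<in> Oz" using *[of 0] *[of 1] *[of "int m"] by auto
  show **: "\<zeta> ^ i \<in> Oz" for i by (subst ev_simps(8)[symmetric]) (rule Oz_ev)
  show "\<zeta> \<in> Oz" using **[of 1] by simp
  with *[of 1] show "lam \<in> Oz" unfolding lam_def by (metis Oz_closed(2) of_int_1)
qed

lemma Oz_power [intro]: "x \<in> Oz \<Longrightarrow> x ^ k \<in> Oz"
  by (induction k) auto

lemma Oz_sum [intro]: "(\<And>i. i \<in> I \<Longrightarrow> f i \<in> Oz) \<Longrightarrow> (\<Sum>i\<in>I. f i) \<in> Oz"
  by (induction I rule: infinite_finite_induct) auto

lemma Oz_prod [intro]: "(\<And>i. i \<in> I \<Longrightarrow> f i \<in> Oz) \<Longrightarrow> (\<Prod>i\<in>I. f i) \<in> Oz"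
  by (induction I rule: infinite_finite_induct) auto

lemma algebraic_int_zeta: "algebraic_int (\<zeta> ^ k)"
proof (rule algebraic_int_power, rule algebraic_int.intros)
  show "lead_coeff (Polynomial.monom 1 p + [:-1:] :: complex poly) = 1"
    by (simp add: degree_add_eq_left degree_monom_eq coeff_monom coeff_eq_0)
  show "\<forall>i. poly.coeff (Polynomial.monom 1 p + [:-1:] :: complex poly) i \<in> \<int>"
    by (auto simp: coeff_monom coeff_pCons split: nat.splits)
qed (simp add: poly_monom)

lemma algebraic_int_Oz: "x \<in> Oz \<Longrightarrow> algebraic_int x"
  using algebraic_int_zeta[of 1] by (auto simp: Oz_def intro: algebraic_int_ev)

text \<open>Exponents are collected modulo p. The point is that the same coefficients c serve for
  every k, which later carries a relation at \<zeta> over to \<zeta>^k.\<close>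

lemma ev_zeta_power_classes:
  "\<exists>c. \<forall>k. ev f (\<zeta> ^ k) = (\<Sum>r<p. of_int (c r) * \<zeta> ^ (k * r))"
proof -
  define d where "d = Suc (Polynomial.degree f)"
  define c where "c = (\<lambda>r. \<Sum>j | j < d \<and> j mod p = r. poly.coeff f j)"
  have "ev f (\<zeta> ^ k) = (\<Sum>r<p. of_int (c r) * \<zeta> ^ (k * r))" for k
  proof -
    have "ev f (\<zeta> ^ k) = (\<Sum>j<d. of_int (poly.coeff f j) * (\<zeta> ^ k) ^ j)"
      by (rule ev_eq_sum) (simp add: d_def)
    also have "\<dots> = (\<Sum>j<d. of_int (poly.coeff f j) * \<zeta> ^ (k * (j mod p)))"
    proof (intro sum.cong refl)
      fix j
      have "(\<zeta> ^ k) ^ j = \<zeta> ^ (k * (j mod p))"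
        using zeta_mod[of "k * j"] zeta_mod[of "k * (j mod p)"]
        by (simp add: mod_mult_right_eq power_mult)
      then show "of_int (poly.coeff f j) * (\<zeta> ^ k) ^ j = of_int (poly.coeff f j) * \<zeta> ^ (k * (j mod p))"
        by simp
    qed
    also have "\<dots> = (\<Sum>r<p. \<Sum>j | j \<in> {..<d} \<and> j mod p = r. of_int (poly.coeff f j) * \<zeta> ^ (k * (j mod p)))"
      by (rule sum.group[symmetric]) auto
    also have "\<dots> = (\<Sum>r<p. of_int (c r) * \<zeta> ^ (k * r))"
      by (intro sum.cong refl) (simp add: c_def sum_distrib_right)
    finally show ?thesis .
  qed
  then show ?thesis by blast
qed

lemma Oz_coords:
  assumes "x \<in> Oz"
  obtains c where "x = (\<Sum>j<p - 1. of_int (c j) * \<zeta> ^ j)"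
proof -
  obtain f where "x = ev f \<zeta>" using assms by (auto simp: Oz_def)
  moreover obtain c where "\<forall>k. ev f (\<zeta> ^ k) = (\<Sum>r<p. of_int (c r) * \<zeta> ^ (k * r))"
    using ev_zeta_power_classes by blast
  from this[rule_format, of 1] have "ev f \<zeta> = (\<Sum>r<p. of_int (c r) * \<zeta> ^ r)" by simp
  ultimately have "x = (\<Sum>r<p. of_int (c r) * \<zeta> ^ r)" by simp
  \<comment> \<open>The power \<zeta>^(p-1) is eliminated by subtracting a multiple of 1 + \<zeta> +
    ... + \<zeta>^(p-1) = 0.\<close>
  also have "\<dots> = (\<Sum>r<p. of_int (c r) * \<zeta> ^ r) - of_int (c (p - 1)) * (\<Sum>r<p. \<zeta> ^ r)"
    using sum_zeta_power[of 1] p_gt_2 by simp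
  also have "\<dots> = (\<Sum>r<p. of_int (c r - c (p - 1)) * \<zeta> ^ r)"
    by (simp add: sum_distrib_left flip: sum_subtractf) (simp add: left_diff_distrib)
  also have "\<dots> = (\<Sum>r<p - 1. of_int (c r - c (p - 1)) * \<zeta> ^ r)"
  proof -
    have "{..<p} = insert (p - 1) {..<p - 1}" using p_gt_2 by auto
    then show ?thesis by simp
  qed
  finally show ?thesis by (rule that)
qed

section \<open>Divisibility by p and \<open>lam\<close>, and independence of the powers of
  \<zeta>\<close>

text \<open>The quotient may be any algebraic integer, inside Z[\<zeta>] or not. This generality is
  what later turns \<open>p_dvd_ev\<close> into a proof that Z[\<zeta>] is integrally
  closed.\<close>

definition pdvd :: "complex \<Rightarrow> complex \<Rightarrow> bool" where
  "pdvd x y \<longleftrightarrow> (\<exists>z. algebraic_int z \<and> y = x * z)"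

lemma pdvd_add: "pdvd x y \<Longrightarrow> pdvd x z \<Longrightarrow> pdvd x (y + z)"
  unfolding pdvd_def by (metis algebraic_int_add_mult(1) distrib_left)

lemma pdvd_mult: "pdvd x y \<Longrightarrow> algebraic_int z \<Longrightarrow> pdvd x (y * z)"
  unfolding pdvd_def by (metis algebraic_int_add_mult(2) mult.assoc)

lemma pdvd_trans: "pdvd x y \<Longrightarrow> pdvd y z \<Longrightarrow> pdvd x z"
  unfolding pdvd_def by (metis algebraic_int_add_mult(2) mult.assoc)

lemma pdvd_0: "pdvd x 0"
  unfolding pdvd_def by (intro exI[of _ 0]) auto

lemma pdvd_sum: "(\<And>i. i \<in> I \<Longrightarrow> pdvd x (f i)) \<Longrightarrow> pdvd x (\<Sum>i\<in>I. f i)"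
  by (induction I rule: infinite_finite_induct) (auto intro: pdvd_add pdvd_0)

lemma pdvd_power_mono: "algebraic_int x \<Longrightarrow> i \<le> j \<Longrightarrow> pdvd (x ^ i) (x ^ j)"
  unfolding pdvd_def by (metis algebraic_int_power le_add_diff_inverse power_add)

lemma algebraic_int_lam: "algebraic_int lam"
  using algebraic_int_Oz by simp

lemma lam_nz [simp]: "lam \<noteq> 0"
  using zeta_eq_1_iff[of 1] p_gt_2 by (auto simp: lam_def)

text \<open>Obtained by expanding \<open>(1 - \<lambda>)\<^sup>p = 1\<close>.\<close>
lemma lam_relation: "\<exists>s\<in>Oz. lam ^ (p - 1) = - of_nat p * (1 + lam * s)"
proof -
  have "(1 - lam) ^ p = 1" by (simp add: lam_def)
  moreover have "(1 - lam) ^ p = (\<Sum>k\<le>p. of_nat (p choose k) * (- lam) ^ k)"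
    using binomial_ring[of "- lam" 1 p] by simp
  moreover have "{..p} = insert 0 (insert 1 (insert p {2..<p}))" using p_gt_2 by auto
  ultimately have "of_nat p * (- lam) + (- lam) ^ p + (\<Sum>k\<in>{2..<p}. of_nat (p choose k) * (- lam) ^ k) = 0"
    using p_gt_2 by (simp add: algebra_simps)
  also have "(\<Sum>k\<in>{2..<p}. of_nat (p choose k) * (- lam) ^ k)
     = of_nat p * lam ^ 2 * (\<Sum>k\<in>{2..<p}. of_nat ((p choose k) div p) * (- lam) ^ (k - 2))"
    (is "_ = _ * _ * ?s")
    unfolding sum_distrib_left
  proof (intro sum.cong refl)
    fix k assume k: "k \<in> {2..<p}"
    then have "p dvd (p choose k)" using prime_p by (intro dvd_choose_prime) auto
    then have "of_nat (p choose k) = (of_nat p * of_nat ((p choose k) div p) :: complex)"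
      by (metis dvd_mult_div_cancel of_nat_mult)
    moreover have "(- lam) ^ k = lam ^ 2 * (- lam) ^ (k - 2)"
    proof -
      obtain j where "k = 2 + j" using k by (metis atLeastLessThan_iff le_add_diff_inverse)
      then show ?thesis by (simp add: power_add power2_eq_square)
    qed
    ultimately show "of_nat (p choose k) * (- lam) ^ k =
      of_nat p * lam ^ 2 * (of_nat ((p choose k) div p) * (- lam) ^ (k - 2))" by simp
  qed
  finally have eq: "of_nat p * (- lam) + (- lam) ^ p + of_nat p * lam ^ 2 * ?s = 0" .
  have "(- lam) ^ p = - (lam * lam ^ (p - 1))"
    using p_odd by (metis One_nat_def Suc_pred p_pos(1) power_Suc power_minus_odd)
  with eq have "lam * (lam ^ (p - 1) + of_nat p * (1 + lam * (- ?s))) = 0"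
    by (simp add: algebra_simps power2_eq_square)
  then have "lam ^ (p - 1) + of_nat p * (1 + lam * (- ?s)) = 0" by simp
  then have "lam ^ (p - 1) = - of_nat p * (1 + lam * (- ?s))"
    by (simp add: add_eq_0_iff2)
  moreover have "- ?s \<in> Oz" by (intro Oz_closed(4) Oz_sum Oz_closed(3) Oz_power) auto
  ultimately show ?thesis by blast
qed

lemma p_dvd_lam_power: "pdvd (of_nat p) (lam ^ (p - 1))"
proof -
  obtain s where s: "s \<in> Oz" "lam ^ (p - 1) = - of_nat p * (1 + lam * s)" using lam_relation by blast
  then have "lam ^ (p - 1) = of_nat p * (- (1 + lam * s))" by (simp add: algebra_simps)
  moreover have "algebraic_int (- (1 + lam * s))" using s by (intro algebraic_int_Oz) auto
  ultimately show ?thesis unfolding pdvd_def by blast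
qed

text \<open>The relation for \<open>lam ^ (p - 1)\<close> reads p = - lam^(p-1) - p lam s, and on
  the right each term has one more factor \<open>lam\<close> than is already known for p. Climbing
  one power at a time avoids inverting 1 + lam s.\<close>

lemma lam_power_dvd_p: "k \<le> p - 1 \<Longrightarrow> \<exists>t\<in>Oz. of_nat p = lam ^ k * t"
proof (induction k)
  case 0
  then show ?case by (intro bexI[of _ "of_nat p"]) auto
next
  case (Suc k)
  then obtain t where t: "t \<in> Oz" "of_nat p = lam ^ k * t" by auto
  obtain s where s: "s \<in> Oz" "lam ^ (p - 1) = - of_nat p * (1 + lam * s)" using lam_relation by blast
  have "lam ^ (p - 1) = lam ^ Suc k * lam ^ (p - 1 - Suc k)"
    using Suc.prems by (metis le_add_diff_inverse power_add)
  moreover have "of_nat p = - (lam ^ (p - 1)) - of_nat p * lam * s" unfolding s(2)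
    by (simp add: algebra_simps)
  ultimately have "of_nat p = lam ^ Suc k * (- (lam ^ (p - 1 - Suc k)) - t * s)"
    using t(2) by (simp add: algebra_simps)
  moreover have "- (lam ^ (p - 1 - Suc k)) - t * s \<in> Oz" using t s by auto
  ultimately show ?case by blast
qed

lemma p_dvd_int:
  assumes "pdvd (of_nat p) (of_int b)"
  shows "int p dvd b"
proof -
  obtain z :: complex where z: "algebraic_int z" "of_int b = of_nat p * z"
    using assms by (auto simp: pdvd_def)
  then have "z = of_int b / of_nat p" by simp
  then have "z \<in> \<rat>" by (simp add: Rats_divide)
  then have "z \<in> \<int>" using z rational_algebraic_int_is_int by blast
  then obtain k where "z = of_int k" by (auto elim: Ints_cases)
  then have "(of_int b :: complex) = of_int (int p * k)" using z by simp
  then show ?thesis using of_int_eq_iff by (metis dvd_triv_left)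
qed

text \<open>In the power \<open>b ^ (p - 1)\<close> the factor \<open>lam ^ (p - 1)\<close> is a
  multiple of p, so the prime p divides a power of b.\<close>

lemma lam_dvd_int:
  assumes "pdvd lam (of_int b)"
  shows "int p dvd b"
proof -
  obtain z where z: "algebraic_int z" "of_int b = lam * z"
    using assms by (auto simp: pdvd_def)
  have "of_int (b ^ (p - 1)) = lam ^ (p - 1) * z ^ (p - 1)" by (simp add: z power_mult_distrib)
  then have "pdvd (of_nat p) (of_int (b ^ (p - 1)))"
    using pdvd_mult[OF p_dvd_lam_power algebraic_int_power[OF z(1)]] by simp
  then have "int p dvd b ^ (p - 1)" by (rule p_dvd_int)
  then show ?thesis using prime_p by (meson prime_dvd_power prime_nat_int_transfer)
qed

text \<open>An Eisenstein argument. Modulo lam^(i+1) the terms after i vanish, those before i vanish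
  because p divides their coefficients, and the whole sum vanishes because i + 1 \<le> p - 1 makes p
  a multiple of lam^(i+1). What remains says that \<open>lam\<close> divides b i.\<close>

lemma p_dvd_coeffs_lam:
  assumes "pdvd (of_nat p) (\<Sum>i<p - 1. of_int (b i) * lam ^ i)"
  shows "i < p - 1 \<Longrightarrow> int p dvd b i"
proof (induction i rule: less_induct)
  case (less i)
  let ?L = "pdvd (lam ^ Suc i)"
  have "Suc i \<le> p - 1" using less by simp
  from lam_power_dvd_p[OF this] have pL: "?L (of_nat p)"
    unfolding pdvd_def using algebraic_int_Oz by blast
  have "{..<p - 1} = {..<i} \<union> {i} \<union> {Suc i..<p - 1}" using less by auto
  then have "(\<Sum>i<p - 1. of_int (b i) * lam ^ i)
      = (\<Sum>j\<in>{..<i} \<union> {i} \<union> {Suc i..<p - 1}. of_int (b j) * lam ^ j)" by simp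
  also have "\<dots> = (\<Sum>j<i. of_int (b j) * lam ^ j) + of_int (b i) * lam ^ i
      + (\<Sum>j\<in>{Suc i..<p - 1}. of_int (b j) * lam ^ j)"
    by (subst sum.union_disjoint, simp, simp, force)+ simp
  finally have "of_int (b i) * lam ^ i = (\<Sum>i<p - 1. of_int (b i) * lam ^ i)
      + ((\<Sum>j<i. of_int (b j) * lam ^ j) * (-1)
      + (\<Sum>j\<in>{Suc i..<p - 1}. of_int (b j) * lam ^ j) * (-1))" by simp
  moreover have "?L (\<Sum>i<p - 1. of_int (b i) * lam ^ i)" using pL assms pdvd_trans by blast
  moreover have "?L (\<Sum>j<i. of_int (b j) * lam ^ j)"
  proof (rule pdvd_sum)
    fix j assume "j \<in> {..<i}"
    with less have "int p dvd b j" by auto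
    then obtain m where "b j = int p * m" by blast
    then have "of_int (b j) * lam ^ j = of_nat p * (of_int m * lam ^ j)" by simp
    then show "?L (of_int (b j) * lam ^ j)"
      by (simp only:) (intro pdvd_mult pL algebraic_int_add_mult algebraic_int_power algebraic_int_lam algebraic_int_of_int)
  qed
  moreover have "?L (\<Sum>j\<in>{Suc i..<p - 1}. of_int (b j) * lam ^ j)"
  proof (rule pdvd_sum)
    fix j assume "j \<in> {Suc i..<p - 1}"
    then have "?L (lam ^ j)" by (intro pdvd_power_mono algebraic_int_lam) auto
    from pdvd_mult[OF this, of "of_int (b j)"] show "?L (of_int (b j) * lam ^ j)"
      by (simp add: mult.commute)
  qed
  ultimately have "?L (of_int (b i) * lam ^ i)"
    by (simp only:) (intro pdvd_add pdvd_mult algebraic_int_minus algebraic_int_1)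
  then obtain z where "algebraic_int z" "of_int (b i) * lam ^ i = lam ^ i * (lam * z)"
    unfolding pdvd_def by (auto simp: mult_ac)
  then have "pdvd lam (of_int (b i))" unfolding pdvd_def by auto
  then show ?case by (rule lam_dvd_int)
qed

text \<open>The substitution X -> 1 - X is an involution of integer polynomials that exchanges
  evaluation at \<zeta> with evaluation at \<open>lam\<close>, so the coefficients in powers of
  \<open>lam\<close> can be used.\<close>

lemma p_dvd_ev:
  assumes "Polynomial.degree f < p - 1" "pdvd (of_nat p) (ev f \<zeta>)"
  shows "\<exists>g. f = Polynomial.smult (int p) g"
proof -
  define h where "h = pcompose f [:1, -1:]"
  have deg: "Polynomial.degree h < p - 1" using assms by (simp add: h_def degree_pcompose)
  have "[:1, -1 :: int:] = 1 - Polynomial.monom 1 1"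
    by (simp add: monom_altdef one_pCons)
  then have "ev [:1, -1:] lam = \<zeta>"
    by (simp only: ev_simps) (simp add: lam_def)
  then have "ev h lam = ev f \<zeta>" by (simp add: h_def ev_pcompose del: map_poly_pCons)
  then have "pdvd (of_nat p) (\<Sum>i<p - 1. of_int (poly.coeff h i) * lam ^ i)"
    using assms(2) ev_eq_sum[OF deg, of lam] by simp
  from p_dvd_coeffs_lam[OF this] have "int p dvd poly.coeff h i" for i
    using deg by (metis coeff_eq_0 dvd_0_right linorder_not_less order.strict_trans2)
  then have "[:int p:] dvd h" by (simp add: const_poly_dvd_iff)
  then obtain g where "h = Polynomial.smult (int p) g" by (auto elim: dvdE)
  then have "pcompose h [:1, -1:] = Polynomial.smult (int p) (pcompose g [:1, -1:])"
    by (simp add: pcompose_smult)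
  moreover have "pcompose h [:1, -1:] = f"
    by (simp add: h_def flip: pcompose_assoc)
  ultimately show ?thesis by metis
qed

text \<open>Infinite descent: 0 is a multiple of p, so p can be divided out of all coefficients
  again and again. In effect this says that \<zeta> has degree p - 1.\<close>

lemma ev_zeta_eq_0:
  "Polynomial.degree f < p - 1 \<Longrightarrow> ev f \<zeta> = 0 \<Longrightarrow> f = 0"
proof (induction "\<Sum>i<p - 1. nat \<bar>poly.coeff f i\<bar>" arbitrary: f rule: less_induct)
  case less
  then obtain g where g: "f = Polynomial.smult (int p) g"
    using p_dvd_ev[OF less.prems(1)] pdvd_0 by metis
  show ?case
  proof (rule ccontr)
    assume "f \<noteq> 0"
    with g have g0: "g \<noteq> 0" by auto
    have dg: "Polynomial.degree g < p - 1" using less.prems g by simp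
    have "ev g \<zeta> = 0" using less.prems(2) g by simp
    moreover have "(\<Sum>i<p - 1. nat \<bar>poly.coeff g i\<bar>) < (\<Sum>i<p - 1. nat \<bar>poly.coeff f i\<bar>)"
    proof (rule sum_strict_mono_ex1)
      show "\<forall>i\<in>{..<p - 1}. nat \<bar>poly.coeff g i\<bar> \<le> nat \<bar>poly.coeff f i\<bar>"
        using g p_gt_2 by (auto simp: abs_mult nat_mult_distrib)
      show "\<exists>i\<in>{..<p - 1}. nat \<bar>poly.coeff g i\<bar> < nat \<bar>poly.coeff f i\<bar>"
        using g g0 dg p_gt_2
        by (intro bexI[of _ "Polynomial.degree g"]) (auto simp: abs_mult nat_mult_distrib)
    qed simp
    ultimately have "g = 0" using less.hyps dg by blast
    with g0 show False by simp
  qed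
qed

lemma sum_zeta_eq:
  assumes "(\<Sum>j<p - 1. of_int (c j) * \<zeta> ^ j) = (\<Sum>j<p - 1. of_int (d j) * \<zeta> ^ j)" "j < p - 1"
  shows "c j = d j"
proof -
  define f where "f = (\<Sum>j<p - 1. Polynomial.monom (c j - d j) j)"
  have cf: "poly.coeff f i = (if i < p - 1 then c i - d i else 0)" for i
    by (simp add: f_def coeff_sum coeff_monom)
  have "Polynomial.degree f < p - 1"
    using p_gt_2 by (intro degree_lessI) (auto simp: cf)
  moreover from this have "ev f \<zeta> = 0"
    using assms(1) by (subst ev_eq_sum) (auto simp: cf sum_subtractf algebra_simps)
  ultimately have "f = 0" by (rule ev_zeta_eq_0)
  with cf[of j] assms(2) show ?thesis by simp
qed

section \<open>Galois conjugation\<close>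

text \<open>The automorphism \<open>\<zeta> \<mapsto> \<zeta>\<^sup>k\<close>; meaningful only on \<open>\<int>[\<zeta>]\<close> and for \<open>k\<close> prime to \<open>p\<close>.\<close>
definition sig :: "nat \<Rightarrow> complex \<Rightarrow> complex" where
  "sig k x = ev (SOME f. ev f \<zeta> = x) (\<zeta> ^ k)"

text \<open>After collecting exponents modulo p, independence of the first p - 1 powers forces all p
  coefficients to be equal. Equal coefficients sum to zero at each \<zeta>^k with k prime to
  p.\<close>

lemma ev_conjugate_eq_0:
  assumes "\<not> p dvd k" "ev f \<zeta> = 0"
  shows "ev f (\<zeta> ^ k) = 0"
proof -
  obtain c where c: "\<And>k. ev f (\<zeta> ^ k) = (\<Sum>r<p. of_int (c r) * \<zeta> ^ (k * r))"
    using ev_zeta_power_classes by blast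
  have split: "{..<p} = insert (p - 1) {..<p - 1}" using p_gt_2 by auto
  have s1: "(\<Sum>r<p. \<zeta> ^ r) = 0" using sum_zeta_power[of 1] p_gt_2 by simp
  have "ev f \<zeta> = (\<Sum>r<p. of_int (c r) * \<zeta> ^ r)" using c[of 1] by simp
  also have "\<dots> = (\<Sum>r<p. of_int (c r) * \<zeta> ^ r) - of_int (c (p - 1)) * (\<Sum>r<p. \<zeta> ^ r)"
    by (simp add: s1)
  also have "\<dots> = (\<Sum>r<p. of_int (c r - c (p - 1)) * \<zeta> ^ r)"
    by (simp add: sum_distrib_left flip: sum_subtractf) (simp add: left_diff_distrib)
  also have "\<dots> = (\<Sum>r<p - 1. of_int (c r - c (p - 1)) * \<zeta> ^ r)"
    unfolding split by simp
  finally have "(\<Sum>r<p - 1. of_int (c r - c (p - 1)) * \<zeta> ^ r) = (\<Sum>r<p - 1. of_int 0 * \<zeta> ^ r)"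
    using assms(2) by simp
  from sum_zeta_eq[OF this] have eq: "c r = c (p - 1)" if "r < p - 1" for r
    using that by simp
  have "ev f (\<zeta> ^ k) = (\<Sum>r<p. of_int (c (p - 1)) * \<zeta> ^ (k * r))"
    unfolding c
  proof (intro sum.cong refl)
    fix r assume "r \<in> {..<p}"
    then have "c r = c (p - 1)" using eq[of r] by (cases "r = p - 1") auto
    then show "of_int (c r) * \<zeta> ^ (k * r) = of_int (c (p - 1)) * \<zeta> ^ (k * r)" by simp
  qed
  also have "\<dots> = 0"
    using sum_zeta_power[of k] assms(1) by (simp flip: sum_distrib_left)
  finally show ?thesis .
qed

lemma sig_ev:
  assumes "\<not> p dvd k"
  shows "sig k (ev f \<zeta>) = ev f (\<zeta> ^ k)"
proof -
  define g where "g = (SOME g. ev g \<zeta> = ev f \<zeta>)"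
  have "ev g \<zeta> = ev f \<zeta>" unfolding g_def by (rule someI[of _ f]) simp
  then have "ev (g - f) \<zeta> = 0" by (simp only: ev_simps) simp
  from ev_conjugate_eq_0[OF assms this] show ?thesis
    by (simp only: ev_simps sig_def flip: g_def) simp
qed

lemma sig_simps:
  assumes "\<not> p dvd k" "x \<in> Oz" "y \<in> Oz"
  shows "sig k (x + y) = sig k x + sig k y" "sig k (x - y) = sig k x - sig k y"
    "sig k (x * y) = sig k x * sig k y" "sig k x \<in> Oz"
proof -
  obtain f g where fg: "x = ev f \<zeta>" "y = ev g \<zeta>" using assms by (auto simp: Oz_def)
  show "sig k (x + y) = sig k x + sig k y" "sig k (x - y) = sig k x - sig k y"
    "sig k (x * y) = sig k x * sig k y"
    unfolding fg by (simp_all only: ev_simps[symmetric] sig_ev[OF assms(1)])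
  have "ev f (\<zeta> ^ k) = ev (pcompose f (Polynomial.monom 1 k)) \<zeta>"
    by (simp only: ev_pcompose ev_simps)
  then show "sig k x \<in> Oz" unfolding fg sig_ev[OF assms(1)] by (simp only: Oz_ev)
qed

lemma sig_of_int [simp]: "\<not> p dvd k \<Longrightarrow> sig k (of_int m) = of_int m"
  by (metis ev_simps(7) sig_ev)

lemma sig_0_1 [simp]: "\<not> p dvd k \<Longrightarrow> sig k 0 = 0" "\<not> p dvd k \<Longrightarrow> sig k 1 = 1"
  using sig_of_int[of k 0] sig_of_int[of k 1] by auto

lemma sig_zeta_power: "\<not> p dvd k \<Longrightarrow> sig k (\<zeta> ^ j) = \<zeta> ^ (k * j)"
  by (metis ev_simps(8) power_mult sig_ev)

lemma sig_sig:
  assumes "\<not> p dvd k" "\<not> p dvd l" "x \<in> Oz"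
  shows "sig l (sig k x) = sig (k * l) x"
proof -
  obtain f where f: "x = ev f \<zeta>" using assms by (auto simp: Oz_def)
  have kl: "\<not> p dvd k * l" using assms prime_p by (simp add: prime_dvd_mult_iff)
  have "sig l (sig k x) = sig l (ev (pcompose f (Polynomial.monom 1 k)) \<zeta>)"
    unfolding f sig_ev[OF assms(1)] by (simp only: ev_pcompose ev_simps)
  also have "\<dots> = ev f ((\<zeta> ^ l) ^ k)"
    unfolding sig_ev[OF assms(2)] by (simp only: ev_pcompose ev_simps)
  also have "\<dots> = sig (k * l) x"
    unfolding f sig_ev[OF kl] by (simp only: power_mult[symmetric] mult.commute)
  finally show ?thesis .
qed

lemma sig_mod: "sig (k mod p) x = sig k x"
  by (simp add: sig_def zeta_mod)

lemma sig_1 [simp]: "x \<in> Oz \<Longrightarrow> sig (Suc 0) x = x"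
  using sig_ev[of 1] p_gt_2 by (auto simp: Oz_def)

lemma not_dvd_range [simp]: "k \<in> {1..<p} \<Longrightarrow> \<not> p dvd k"
  by (auto dest: dvd_imp_le)

lemma not_dvd_mod_range: "\<not> p dvd k \<Longrightarrow> k mod p \<in> {1..<p}"
  by (simp add: dvd_eq_mod_eq_0 Suc_le_eq)

lemma ex_inverse_mod:
  assumes "\<not> p dvd k"
  obtains l where "\<not> p dvd l" "k * l mod p = 1"
proof -
  have "coprime k p" using assms prime_p by (metis coprime_commute prime_imp_coprime)
  then obtain l where "[k * l = 1] (mod p)" using cong_solve_coprime_nat by auto
  then have "k * l mod p = 1" using p_gt_2 by (simp add: cong_def)
  moreover from this have "\<not> p dvd l" by auto
  ultimately show ?thesis using that by blast
qed

lemma sig_eq_0_iff: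
  assumes "\<not> p dvd k" "x \<in> Oz"
  shows "sig k x = 0 \<longleftrightarrow> x = 0"
proof
  assume 0: "sig k x = 0"
  obtain l where l: "\<not> p dvd l" "k * l mod p = 1" using ex_inverse_mod[OF assms(1)] .
  have "x = sig (k * l mod p) x" using l assms by simp
  also have "\<dots> = sig l (sig k x)" using sig_sig[OF assms(1) l(1) assms(2)] by (simp add: sig_mod)
  finally show "x = 0" using 0 l by simp
qed (use assms in simp)

lemma bij_mult_mod:
  assumes "\<not> p dvd l"
  shows "bij_betw (\<lambda>k. k * l mod p) {1..<p} {1..<p}"
proof -
  have "inj_on (\<lambda>k. k * l mod p) {1..<p}"
  proof (rule inj_onI)
    fix j k assume jk: "j \<in> {1..<p}" "k \<in> {1..<p}" "j * l mod p = k * l mod p"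
    have "coprime l p" using assms prime_p by (metis coprime_commute prime_imp_coprime)
    with jk(3) have "[j = k] (mod p)" by (metis cong_def cong_mult_rcancel_nat)
    with jk show "j = k" by (simp add: cong_def)
  qed
  moreover have "(\<lambda>k. k * l mod p) ` {1..<p} \<subseteq> {1..<p}"
  proof (rule image_subsetI)
    fix k assume "k \<in> {1..<p}"
    then have "\<not> p dvd k * l" using assms prime_p not_dvd_range by (simp add: prime_dvd_mult_iff)
    then show "k * l mod p \<in> {1..<p}" by (rule not_dvd_mod_range)
  qed
  ultimately show ?thesis using endo_inj_surj[of "{1..<p}" "\<lambda>k. k * l mod p"]
    by (simp add: bij_betw_def)
qed

lemma sig_sum:
  assumes "\<not> p dvd k" "\<And>i. i \<in> I \<Longrightarrow> f i \<in> Oz"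
  shows "sig k (\<Sum>i\<in>I. f i) = (\<Sum>i\<in>I. sig k (f i))"
  using assms(2)
  by (induction I rule: infinite_finite_induct) (auto simp: assms(1) sig_simps Oz_sum)

lemma sig_prod:
  assumes "\<not> p dvd k" "\<And>i. i \<in> I \<Longrightarrow> f i \<in> Oz"
  shows "sig k (\<Prod>i\<in>I. f i) = (\<Prod>i\<in>I. sig k (f i))"
  using assms(2)
  by (induction I rule: infinite_finite_induct) (auto simp: assms(1) sig_simps Oz_prod)

lemma sig_coords:
  assumes "\<not> p dvd k"
  shows "sig k (\<Sum>j\<in>J. of_int (c j) * \<zeta> ^ j) = (\<Sum>j\<in>J. of_int (c j) * \<zeta> ^ (k * j))"
  using assms by (simp add: sig_sum sig_simps sig_zeta_power Oz_closed)

section \<open>Trace and norm\<close>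

definition Tr :: "complex \<Rightarrow> complex" where "Tr x = (\<Sum>k\<in>{1..<p}. sig k x)"

definition Nm :: "complex \<Rightarrow> complex" where "Nm x = (\<Prod>k\<in>{1..<p}. sig k x)"

lemma Tr_zeta_power: "Tr (\<zeta> ^ j) = (if p dvd j then of_nat p else 0) - 1"
proof -
  have "(\<Sum>k\<in>{1..<p}. sig k (\<zeta> ^ j)) = (\<Sum>k\<in>{1..<p}. \<zeta> ^ (j * k))"
    by (intro sum.cong refl) (simp add: sig_zeta_power mult.commute del: atLeastLessThan_iff)
  also have "\<dots> = (\<Sum>k<p. \<zeta> ^ (j * k)) - 1"
  proof -
    have "{..<p} = insert 0 {1..<p}" by (auto simp: Suc_le_eq)
    then show ?thesis by simp
  qed
  finally show ?thesis by (simp add: Tr_def sum_zeta_power)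
qed

lemma Tr_coords:
  "Tr ((\<Sum>i\<in>I. of_int (c i) * \<zeta> ^ i) * \<zeta> ^ j) = (\<Sum>i\<in>I. of_int (c i) * Tr (\<zeta> ^ (i + j)))"
proof -
  have "Tr ((\<Sum>i\<in>I. of_int (c i) * \<zeta> ^ i) * \<zeta> ^ j)
      = (\<Sum>k\<in>{1..<p}. \<Sum>i\<in>I. of_int (c i) * \<zeta> ^ (k * i) * \<zeta> ^ (k * j))"
    unfolding Tr_def
  proof (intro sum.cong refl)
    fix k assume "k \<in> {1..<p}"
    then have k: "\<not> p dvd k" by simp
    have "(\<Sum>i\<in>I. of_int (c i) * \<zeta> ^ i) \<in> Oz" by (auto intro: Oz_sum)
    then have "sig k ((\<Sum>i\<in>I. of_int (c i) * \<zeta> ^ i) * \<zeta> ^ j)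
      = sig k (\<Sum>i\<in>I. of_int (c i) * \<zeta> ^ i) * sig k (\<zeta> ^ j)"
      by (intro sig_simps k) auto
    then show "sig k ((\<Sum>i\<in>I. of_int (c i) * \<zeta> ^ i) * \<zeta> ^ j)
      = (\<Sum>i\<in>I. of_int (c i) * \<zeta> ^ (k * i) * \<zeta> ^ (k * j))"
      by (simp add: k sig_coords sig_zeta_power sum_distrib_right)
  qed
  also have "\<dots> = (\<Sum>i\<in>I. of_int (c i) * Tr (\<zeta> ^ (i + j)))"
    unfolding Tr_def sum_distrib_left
  proof (subst sum.swap, intro sum.cong refl)
    fix i k assume "k \<in> {1..<p}"
    then show "of_int (c i) * \<zeta> ^ (k * i) * \<zeta> ^ (k * j) = of_int (c i) * sig k (\<zeta> ^ (i + j))"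
      using sig_zeta_power[of k "i + j"] by (simp add: distrib_left power_add mult.assoc)
  qed
  finally show ?thesis .
qed

lemma dvd_shift_iff:
  assumes "j < p" "l < p"
  shows "p dvd j + (p - l) \<longleftrightarrow> l = j"
proof (cases "j < l")
  case True
  then have "0 < j + (p - l)" "j + (p - l) < p" using assms by auto
  then show ?thesis using True by (auto dest: dvd_imp_le)
next
  case False
  then have "j + (p - l) = (j - l) + p" using assms by simp
  then have "p dvd j + (p - l) \<longleftrightarrow> p dvd j - l" by (simp only: dvd_add_triv_right_iff)
  also have "\<dots> \<longleftrightarrow> j - l = 0" using assms by (auto dest: dvd_imp_le)
  finally show ?thesis using False by auto
qed

text \<open>The trace of a power of \<zeta> is p - 1 or -1 according to whether p divides the
  exponent. Among the exponents i + (p - j) only i = j is divisible by p, and among the exponents i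
  + 1 none is, so the second trace cancels all the -1.\<close>

lemma Tr_coeff:
  assumes "j < p - 1" and x_def: "x = (\<Sum>i<p - 1. of_int (c i) * \<zeta> ^ i)"
  shows "Tr (x * \<zeta> ^ (p - j)) - Tr (x * \<zeta> ^ 1) = of_nat p * of_int (c j)"
proof -
  have "Tr (x * \<zeta> ^ (p - j)) - Tr (x * \<zeta> ^ 1)
      = (\<Sum>i<p - 1. of_int (c i) * (Tr (\<zeta> ^ (i + (p - j))) - Tr (\<zeta> ^ (i + 1))))"
    unfolding x_def Tr_coords by (simp add: sum_subtractf right_diff_distrib)
  also have "\<dots> = (\<Sum>i<p - 1. if i = j then of_nat p * of_int (c j) else 0)"
  proof (intro sum.cong refl)
    fix i assume i: "i \<in> {..<p - 1}"
    have "\<not> p dvd i + 1" using i by (intro not_dvd_range) auto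
    moreover have "p dvd i + (p - j) \<longleftrightarrow> i = j"
      using dvd_shift_iff[of i j] i assms(1) by auto
    ultimately show "of_int (c i) * (Tr (\<zeta> ^ (i + (p - j))) - Tr (\<zeta> ^ (i + 1)))
        = (if i = j then of_nat p * of_int (c j) else 0)"
      unfolding Tr_zeta_power by simp
  qed
  also have "\<dots> = of_nat p * of_int (c j)" using assms(1) by simp
  finally show ?thesis .
qed

text \<open>The trace of a fixed element is (p - 1) x, and traces are integers; comparing
  coordinates leaves only the constant one.\<close>

lemma fixed_is_int:
  assumes "x \<in> Oz" "\<And>k. k \<in> {1..<p} \<Longrightarrow> sig k x = x"
  shows "x \<in> \<int>"
proof -
  obtain c where c: "x = (\<Sum>j<p - 1. of_int (c j) * \<zeta> ^ j)" using Oz_coords[OF assms(1)] .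
  have "Tr x = of_nat (p - 1) * x" unfolding Tr_def using assms(2) by simp
  also have "Tr x = Tr (x * \<zeta> ^ 0)" by simp
  also have "\<dots> = (\<Sum>i<p - 1. of_int (c i) * Tr (\<zeta> ^ (i + 0)))" unfolding c Tr_coords ..
  also have "\<dots> = of_int (\<Sum>i<p - 1. c i * ((if p dvd i then int p else 0) - 1))" (is "_ = of_int ?m")
    by (simp add: Tr_zeta_power) (intro sum.cong refl, simp)
  finally have m: "of_nat (p - 1) * x = of_int ?m" by simp
  have "of_nat (p - 1) * x = (\<Sum>j<p - 1. of_int (int (p - 1) * c j) * \<zeta> ^ j)"
    unfolding c sum_distrib_left by (simp add: mult.assoc)
  also have "of_nat (p - 1) * x = (\<Sum>j<p - 1. of_int (if j = 0 then ?m else 0) * \<zeta> ^ j)"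
  proof -
    have "(\<Sum>j<p - 1. of_int (if j = 0 then ?m else 0) * \<zeta> ^ j) = (\<Sum>j\<in>{0}. of_int ?m * \<zeta> ^ j)"
      using p_gt_2 by (intro sum.mono_neutral_cong_right) auto
    then show ?thesis using m by simp
  qed
  finally have eq: "(\<Sum>j<p - 1. of_int (if j = 0 then ?m else 0) * \<zeta> ^ j)
    = (\<Sum>j<p - 1. of_int (int (p - 1) * c j) * \<zeta> ^ j)" .
  have "c j = 0" if "j < p - 1" "j \<noteq> 0" for j
    using sum_zeta_eq[OF eq that(1)] that p_gt_2 by auto
  then have "x = (\<Sum>j\<in>{0}. of_int (c j) * \<zeta> ^ j)"
    unfolding c using p_gt_2 by (intro sum.mono_neutral_right) auto
  then show ?thesis by simp
qed

lemma Nm_in_Ints: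
  assumes "x \<in> Oz"
  shows "Nm x \<in> \<int>"
proof (rule fixed_is_int)
  have mem: "sig k x \<in> Oz" if "k \<in> {1..<p}" for k
    using that assms by (intro sig_simps) auto
  then show "Nm x \<in> Oz" by (auto simp: Nm_def intro: Oz_prod)
  fix l assume l: "l \<in> {1..<p}"
  have "sig l (Nm x) = (\<Prod>k\<in>{1..<p}. sig l (sig k x))"
    unfolding Nm_def using l mem by (intro sig_prod) auto
  also have "\<dots> = (\<Prod>k\<in>{1..<p}. sig (k * l mod p) x)"
    using l assms by (intro prod.cong refl) (subst sig_sig, auto simp: sig_mod dest: dvd_imp_le)
  also have "\<dots> = Nm x"
    unfolding Nm_def using l by (intro prod.reindex_bij_betw bij_mult_mod not_dvd_range)
  finally show "sig l (Nm x) = Nm x" .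
qed

lemma Nm_mult: "x \<in> Oz \<Longrightarrow> y \<in> Oz \<Longrightarrow> Nm (x * y) = Nm x * Nm y"
  unfolding Nm_def prod.distrib[symmetric]
  by (intro prod.cong refl) (auto intro!: sig_simps not_dvd_range)

lemma Nm_eq_0_iff: "x \<in> Oz \<Longrightarrow> Nm x = 0 \<longleftrightarrow> x = 0"
proof -
  assume x: "x \<in> Oz"
  have "Nm x = 0 \<longleftrightarrow> (\<exists>k\<in>{1..<p}. sig k x = 0)" by (simp add: Nm_def)
  also have "\<dots> \<longleftrightarrow> (\<exists>k\<in>{1..<p}. x = 0)" by (intro bex_cong refl sig_eq_0_iff x not_dvd_range)
  also have "\<dots> \<longleftrightarrow> x = 0" using p_gt_2 by auto
  finally show ?thesis .
qed

lemma Nm_multiple: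
  assumes "x \<in> Oz"
  shows "\<exists>y\<in>Oz. Nm x = x * y"
proof
  have "{1..<p} = insert 1 {2..<p}" using p_gt_2 by auto
  then show "Nm x = x * (\<Prod>k\<in>{2..<p}. sig k x)" using assms by (simp add: Nm_def)
  show "(\<Prod>k\<in>{2..<p}. sig k x) \<in> Oz"
    using assms by (intro Oz_prod sig_simps not_dvd_range) auto
qed

section \<open>The field of fractions and integral closedness\<close>

definition Kz :: "complex set" where "Kz = {x. \<exists>m::int. m \<noteq> 0 \<and> of_int m * x \<in> Oz}"

lemma Oz_Kz [intro]: "x \<in> Oz \<Longrightarrow> x \<in> Kz"
  unfolding Kz_def by (auto intro!: exI[of _ 1])

lemma Kz_closed [intro]:
  assumes "x \<in> Kz" "y \<in> Kz"
  shows "x + y \<in> Kz" "x - y \<in> Kz" "x * y \<in> Kz"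
proof -
  obtain m n :: int where mn: "m \<noteq> 0" "n \<noteq> 0" "of_int m * x \<in> Oz" "of_int n * y \<in> Oz"
    using assms unfolding Kz_def by blast
  then have "of_int n * (of_int m * x) \<in> Oz" "of_int m * (of_int n * y) \<in> Oz"
    "(of_int m * x) * (of_int n * y) \<in> Oz" by auto
  then have "of_int (m * n) * x \<in> Oz" "of_int (m * n) * y \<in> Oz" "of_int (m * n) * (x * y) \<in> Oz"
    by (simp_all add: mult_ac)
  moreover from this have "of_int (m * n) * (x + y) \<in> Oz" "of_int (m * n) * (x - y) \<in> Oz"
    by (auto simp: distrib_left right_diff_distrib)
  moreover have "m * n \<noteq> 0" using mn by simp
  ultimately show "x + y \<in> Kz" "x - y \<in> Kz" "x * y \<in> Kz" unfolding Kz_def by blast+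
qed

lemma Kz_inverse [intro]:
  assumes "x \<in> Kz"
  shows "inverse x \<in> Kz"
proof (cases "x = 0")
  case False
  obtain m :: int where m: "m \<noteq> 0" "of_int m * x \<in> Oz"
    using assms unfolding Kz_def by blast
  let ?y = "of_int m * x"
  obtain z where z: "z \<in> Oz" "Nm ?y = ?y * z" using Nm_multiple[OF m(2)] by blast
  obtain n where n: "Nm ?y = of_int n" using Nm_in_Ints[OF m(2)] by (auto elim: Ints_cases)
  have nz: "n \<noteq> 0" using n Nm_eq_0_iff[OF m(2)] False m by auto
  have "of_int n * inverse x = of_int m * z" using z n False m by (simp add: field_simps)
  moreover have "of_int m * z \<in> Oz" using z by auto
  ultimately show ?thesis unfolding Kz_def using nz by auto
qed (use assms in simp)

lemma Kz_divide [intro]: "x \<in> Kz \<Longrightarrow> y \<in> Kz \<Longrightarrow> x / y \<in> Kz"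
  by (simp add: divide_inverse Kz_closed Kz_inverse)

lemma Kz_minus [intro]: "x \<in> Kz \<Longrightarrow> - x \<in> Kz"
  using Kz_closed(2)[of 0 x] Oz_Kz[of 0] by simp

text \<open>As \<open>sig\<close> is meaningful only on Z[\<zeta>], the denominator is moved into
  the polynomial: h = m^d q(X/m) has integer coefficients, hence commutes with
  \<open>sig\<close>.\<close>

lemma algebraic_int_conjugate:
  assumes y: "y \<in> Oz" and m: "m \<noteq> 0" and int: "algebraic_int (y / of_int m)" and k: "\<not> p dvd k"
  shows "algebraic_int (sig k y / of_int m)"
proof -
  obtain q where q: "ev q (y / of_int m) = 0" "lead_coeff q = 1"
    using int by (auto simp: algebraic_int_altdef_ipoly)
  define d where "d = Polynomial.degree q"
  define h where "h = (\<Sum>i\<le>d. Polynomial.monom (poly.coeff q i * m ^ (d - i)) i)"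
  have ev_h: "ev h x = of_int m ^ d * ev q (x / of_int m)" for x
  proof -
    have "ev h x = (\<Sum>i\<le>d. of_int (poly.coeff q i * m ^ (d - i)) * x ^ i)"
      by (simp add: h_def hom_distribs poly_sum poly_monom)
    also have "\<dots> = (\<Sum>i\<le>d. of_int m ^ d * (of_int (poly.coeff q i) * (x / of_int m) ^ i))"
    proof (intro sum.cong refl)
      fix i assume "i \<in> {..d}"
      then have "of_int m ^ d = (of_int m ^ (d - i) * of_int m ^ i :: complex)"
        by (simp flip: power_add)
      then show "of_int (poly.coeff q i * m ^ (d - i)) * x ^ i
          = of_int m ^ d * (of_int (poly.coeff q i) * (x / of_int m) ^ i)"
        using m by (simp add: power_divide)
    qed
    also have "\<dots> = of_int m ^ d * ev q (x / of_int m)"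
      by (simp add: sum_distrib_left ev_eq_sum[OF lessI] d_def lessThan_Suc_atMost)
    finally show ?thesis .
  qed
  obtain f where f: "y = ev f \<zeta>" using y by (auto simp: Oz_def)
  have "ev h (sig k y) = sig k (ev h y)"
    unfolding f ev_pcompose[symmetric] sig_ev[OF k] by (simp only: ev_pcompose)
  also have "ev h y = 0" using ev_h q by simp
  finally have "ev q (sig k y / of_int m) = 0" using ev_h m k by simp
  then show ?thesis using q(2) by (auto simp: algebraic_int_altdef_ipoly)
qed

text \<open>Traces recover coordinates up to a factor p, so p x lies in Z[\<zeta>]. The remaining p
  is removed by \<open>p_dvd_ev\<close>.\<close>

lemma integrally_closed:
  assumes "x \<in> Kz" "algebraic_int x"
  shows "x \<in> Oz"
proof -
  obtain m :: int where m: "m \<noteq> 0" "of_int m * x \<in> Oz" using assms unfolding Kz_def by blast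
  define y where "y = of_int m * x"
  have y: "y \<in> Oz" "algebraic_int (y / of_int m)" using m assms by (auto simp: y_def)
  obtain c where c: "y = (\<Sum>j<p - 1. of_int (c j) * \<zeta> ^ j)" using Oz_coords[OF y(1)] .
  have tr: "pdvd (of_int m) (Tr (y * \<zeta> ^ i))" for i
    unfolding Tr_def
  proof (rule pdvd_sum)
    fix k assume "k \<in> {1..<p}"
    then have k: "\<not> p dvd k" by simp
    have "sig k (y * \<zeta> ^ i) = of_int m * (sig k y / of_int m * \<zeta> ^ (k * i))"
      using m y by (simp add: k sig_simps sig_zeta_power)
    moreover have "algebraic_int (sig k y / of_int m * \<zeta> ^ (k * i))"
      by (intro algebraic_int_add_mult algebraic_int_conjugate algebraic_int_zeta y m k)
    ultimately show "pdvd (of_int m) (sig k (y * \<zeta> ^ i))" unfolding pdvd_def by blast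
  qed
  have "m dvd int p * c j" if j: "j < p - 1" for j
  proof -
    have "of_nat p * of_int (c j) = Tr (y * \<zeta> ^ (p - j)) + Tr (y * \<zeta> ^ 1) * (- 1)"
      using Tr_coeff[OF j c] by simp
    moreover have "pdvd (of_int m) (Tr (y * \<zeta> ^ (p - j)) + Tr (y * \<zeta> ^ 1) * (- 1))"
      by (intro pdvd_add pdvd_mult tr algebraic_int_minus algebraic_int_1)
    ultimately have "pdvd (of_int m) (of_nat p * of_int (c j))" by simp
    then obtain z :: complex where z: "algebraic_int z" "of_nat p * of_int (c j) = of_int m * z"
      unfolding pdvd_def by blast
    then have "z = of_int (int p * c j) / of_int m" using m by (simp add: field_simps)
    then have "z \<in> \<rat>" by (metis Rats_divide Rats_of_int)
    then obtain k where "z = of_int k" using z rational_algebraic_int_is_int by (auto elim: Ints_cases)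
    then have "(of_int (int p * c j) :: complex) = of_int (m * k)" using z by simp
    then show ?thesis by (metis dvd_triv_left of_int_eq_iff)
  qed
  then obtain d where d: "\<And>j. j < p - 1 \<Longrightarrow> int p * c j = m * d j"
    unfolding dvd_def by metis
  define f where "f = (\<Sum>j<p - 1. Polynomial.monom (d j) j)"
  have cf: "poly.coeff f i = (if i < p - 1 then d i else 0)" for i
    by (simp add: f_def coeff_sum coeff_monom)
  have deg: "Polynomial.degree f < p - 1"
    using p_gt_2 by (intro degree_lessI) (auto simp: cf)
  have "of_int m * ev f \<zeta> = (\<Sum>j<p - 1. of_int (m * d j) * \<zeta> ^ j)"
    unfolding ev_eq_sum[OF deg] by (simp add: cf sum_distrib_left mult.assoc)
  also have "\<dots> = of_nat p * y" unfolding c using d by (simp add: sum_distrib_left mult.assoc flip: d)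
  finally have fx: "ev f \<zeta> = of_nat p * x" using m by (simp add: y_def)
  \<comment> \<open>Here the quotient is x itself, known so far only to be an algebraic
    integer.\<close>
  then have "pdvd (of_nat p) (ev f \<zeta>)" using assms(2) unfolding pdvd_def by blast
  then obtain g where "f = Polynomial.smult (int p) g" using p_dvd_ev[OF deg] by blast
  then have "ev f \<zeta> = of_nat p * ev g \<zeta>" by (simp only: ev_simps) simp
  with fx have "x = ev g \<zeta>" by simp
  then show ?thesis by (simp only: Oz_ev)
qed

section \<open>Absolute values of conjugates\<close>

lemma norm_zeta [simp]: "cmod (\<zeta> ^ k) = 1"
proof -
  have "cmod \<zeta> ^ p = 1 ^ p" by (simp flip: norm_power)
  then have "cmod \<zeta> = 1" by (rule power_eq_imp_eq_base) auto
  then show ?thesis by (simp add: norm_power)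
qed

lemma cnj_zeta_power:
  assumes "l \<le> p"
  shows "cnj (\<zeta> ^ (k * l)) = \<zeta> ^ (k * (p - l))"
proof -
  have "\<zeta> ^ (k * l) * \<zeta> ^ (k * (p - l)) = \<zeta> ^ (k * (l + (p - l)))"
    by (simp only: power_add distrib_left)
  also have "\<dots> = 1" using assms by (simp add: zeta_eq_1_iff)
  finally have 1: "\<zeta> ^ (k * l) * \<zeta> ^ (k * (p - l)) = 1" .
  have "\<zeta> ^ (k * l) * cnj (\<zeta> ^ (k * l)) = 1"
    using norm_zeta[of "k * l"] by (simp only: complex_norm_square[symmetric]) simp
  with 1 show ?thesis by (metis mult_left_cancel power_eq_0_iff zeta_nz)
qed

text \<open>Parseval's identity for the cyclic group of order p: summed over all residues k the two
  sides are equal, and the nonnegative term k = 0 is dropped.\<close>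

lemma sum_conjugates_square_le:
  "(\<Sum>k\<in>{1..<p}. (cmod (sig k (\<Sum>j<p - 1. of_int (c j) * \<zeta> ^ j)))\<^sup>2) \<le> real p * (\<Sum>j<p - 1. (of_int (c j))\<^sup>2)"
proof -
  let ?n = "p - 1"
  define s where "s k = (\<Sum>j<?n. of_int (c j) * \<zeta> ^ (k * j))" for k
  have "complex_of_real (\<Sum>k<p. (cmod (s k))\<^sup>2) = (\<Sum>k<p. s k * cnj (s k))"
    by (simp only: of_real_sum complex_norm_square)
  also have "\<dots> = (\<Sum>k<p. \<Sum>j<?n. \<Sum>l<?n. of_int (c j) * of_int (c l) * \<zeta> ^ (k * (j + (p - l))))"
  proof (intro sum.cong refl)
    fix k
    have "cnj (s k) = (\<Sum>l<?n. of_int (c l) * \<zeta> ^ (k * (p - l)))"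
      unfolding s_def cnj_sum by (intro sum.cong refl) (simp add: cnj_zeta_power flip: complex_cnj_power)
    then have "s k * cnj (s k) = (\<Sum>j<?n. of_int (c j) * \<zeta> ^ (k * j)) * (\<Sum>l<?n. of_int (c l) * \<zeta> ^ (k * (p - l)))"
      by (simp only: s_def)
    then show "s k * cnj (s k) = (\<Sum>j<?n. \<Sum>l<?n. of_int (c j) * of_int (c l) * \<zeta> ^ (k * (j + (p - l))))"
      unfolding sum_product by (simp only: distrib_left power_add mult_ac)
  qed
  also have "\<dots> = (\<Sum>j<?n. \<Sum>k<p. \<Sum>l<?n. of_int (c j) * of_int (c l) * \<zeta> ^ (k * (j + (p - l))))"
    by (rule sum.swap)
  also have "\<dots> = (\<Sum>j<?n. \<Sum>l<?n. \<Sum>k<p. of_int (c j) * of_int (c l) * \<zeta> ^ (k * (j + (p - l))))"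
    by (intro sum.cong refl sum.swap)
  also have "\<dots> = (\<Sum>j<?n. \<Sum>l<?n. if l = j then of_nat p * of_int ((c j)\<^sup>2) else 0)"
  proof (intro sum.cong refl)
    fix j l assume jl: "j \<in> {..<?n}" "l \<in> {..<?n}"
    have dvd: "p dvd j + (p - l) \<longleftrightarrow> l = j"
      using dvd_shift_iff[of j l] jl by auto
    have "(\<Sum>k<p. of_int (c j) * of_int (c l) * \<zeta> ^ (k * (j + (p - l))))
        = of_int (c j) * of_int (c l) * (\<Sum>k<p. \<zeta> ^ ((j + (p - l)) * k))"
      by (simp add: sum_distrib_left mult.commute)
    also have "\<dots> = (if l = j then of_nat p * of_int ((c j)\<^sup>2) else 0)"
      unfolding sum_zeta_power dvd by (simp add: power2_eq_square)
    finally show "(\<Sum>k<p. of_int (c j) * of_int (c l) * \<zeta> ^ (k * (j + (p - l))))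
        = (if l = j then of_nat p * of_int ((c j)\<^sup>2) else 0)" .
  qed
  also have "\<dots> = of_real (real p * (\<Sum>j<?n. (of_int (c j))\<^sup>2))"
    by (simp add: sum_distrib_left)
  finally have "(\<Sum>k<p. (cmod (s k))\<^sup>2) = real p * (\<Sum>j<?n. (of_int (c j))\<^sup>2)"
    using of_real_eq_iff by blast
  moreover have "(\<Sum>k\<in>{1..<p}. (cmod (s k))\<^sup>2) \<le> (\<Sum>k<p. (cmod (s k))\<^sup>2)"
    by (intro sum_mono2) auto
  moreover have "sig k (\<Sum>j<?n. of_int (c j) * \<zeta> ^ j) = s k" if "k \<in> {1..<p}" for k
    using sig_coords[OF not_dvd_range[OF that]] by (simp add: s_def)
  ultimately show ?thesis by simp
qed

end


section \<open>Indices of additive subgroups\<close>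

definition add_subgroup :: "complex set \<Rightarrow> bool" where
  "add_subgroup J \<longleftrightarrow> 0 \<in> J \<and> (\<forall>x\<in>J. \<forall>y\<in>J. x - y \<in> J)"

definition cosets :: "complex set \<Rightarrow> complex set \<Rightarrow> complex set set" where
  "cosets I J = (\<lambda>x. (+) x ` J) ` I"

definition index :: "complex set \<Rightarrow> complex set \<Rightarrow> nat" where
  "index I J = card (cosets I J)"

definition scale :: "complex \<Rightarrow> complex set \<Rightarrow> complex set" where
  "scale z I = (\<lambda>x. z * x) ` I"

lemma add_subgroup_0: "add_subgroup J \<Longrightarrow> 0 \<in> J"
  and add_subgroup_diff: "add_subgroup J \<Longrightarrow> x \<in> J \<Longrightarrow> y \<in> J \<Longrightarrow> x - y \<in> J"
  by (auto simp: add_subgroup_def)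

lemma add_subgroup_minus: "add_subgroup J \<Longrightarrow> x \<in> J \<Longrightarrow> - x \<in> J"
  using add_subgroup_diff[of J 0 x] add_subgroup_0 by simp

lemma add_subgroup_add: "add_subgroup J \<Longrightarrow> x \<in> J \<Longrightarrow> y \<in> J \<Longrightarrow> x + y \<in> J"
  using add_subgroup_diff[of J x "- y"] add_subgroup_minus by simp

lemma add_subgroup_sum: "add_subgroup J \<Longrightarrow> (\<And>i. i \<in> A \<Longrightarrow> f i \<in> J) \<Longrightarrow> (\<Sum>i\<in>A. f i) \<in> J"
  by (induction A rule: infinite_finite_induct) (auto intro: add_subgroup_add add_subgroup_0)

lemma coset_eq_iff:
  assumes "add_subgroup J"
  shows "(+) x ` J = (+) y ` J \<longleftrightarrow> x - y \<in> J"
proof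
  assume eq: "(+) x ` J = (+) y ` J"
  have "x \<in> (+) x ` J" using add_subgroup_0[OF assms] by force
  then obtain j where "j \<in> J" "x = y + j" unfolding eq by auto
  then show "x - y \<in> J" by simp
next
  assume xy: "x - y \<in> J"
  show "(+) x ` J = (+) y ` J"
  proof (intro equalityI subsetI)
    fix z assume "z \<in> (+) x ` J"
    then obtain j where "j \<in> J" "z = y + ((x - y) + j)" by auto
    then show "z \<in> (+) y ` J" using add_subgroup_add[OF assms xy] by blast
  next
    fix z assume "z \<in> (+) y ` J"
    then obtain j where "j \<in> J" "z = x + (j - (x - y))" by auto
    then show "z \<in> (+) x ` J" using add_subgroup_diff[OF assms _ xy] by blast
  qed
qed

text \<open>The tower law, stated as a bijection so that both the product formula and the transfer
  of finiteness follow from it. A coset of I is represented by a chosen element, which then shifts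
  the cosets of J in I.\<close>

lemma coset_product_bij:
  assumes "add_subgroup H" "add_subgroup I" "add_subgroup J" "J \<subseteq> I" "I \<subseteq> H"
  shows "\<exists>f. bij_betw f (cosets H I \<times> cosets I J) (cosets H J)"
proof -
  define r where "r c = (SOME x. x \<in> H \<and> c = (+) x ` I)" for c
  have r: "r c \<in> H \<and> c = (+) (r c) ` I" if "c \<in> cosets H I" for c
    unfolding r_def by (rule someI_ex) (use that in \<open>auto simp: cosets_def\<close>)
  define f where "f = (\<lambda>(c, d). (+) (r c) ` d)"
  have shift: "(+) a ` (+) b ` J = (+) (a + b) ` J" for a b
    by (simp add: image_image add.assoc)
  have "inj_on f (cosets H I \<times> cosets I J)"
  proof (rule inj_onI)
    fix u v assume u: "u \<in> cosets H I \<times> cosets I J" and v: "v \<in> cosets H I \<times> cosets I J" and eq: "f u = f v"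
    obtain c y where cy: "u = (c, (+) y ` J)" "c \<in> cosets H I" "y \<in> I" using u by (auto simp: cosets_def)
    obtain c' y' where cy': "v = (c', (+) y' ` J)" "c' \<in> cosets H I" "y' \<in> I" using v
      by (auto simp: cosets_def)
    have "(r c + y) - (r c' + y') \<in> J"
      using eq unfolding f_def cy cy' by (simp add: shift coset_eq_iff[OF assms(3)])
    then have *: "(r c - r c') + (y - y') \<in> J" by (simp add: algebra_simps)
    then have "(r c - r c') + (y - y') - (y - y') \<in> I"
      using assms cy(3) cy'(3) by (intro add_subgroup_diff) auto
    then have "r c - r c' \<in> I" by simp
    then have "c = c'" using r[OF cy(2)] r[OF cy'(2)] coset_eq_iff[OF assms(2)] by metis
    with * have "y - y' \<in> J" by simp
    then show "u = v" using cy cy' \<open>c = c'\<close> coset_eq_iff[OF assms(3)] by simp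
  qed
  moreover have "f ` (cosets H I \<times> cosets I J) = cosets H J"
  proof (intro equalityI subsetI)
    fix e assume "e \<in> f ` (cosets H I \<times> cosets I J)"
    then obtain c y where cy: "e = f (c, (+) y ` J)" "c \<in> cosets H I" "y \<in> I" by (auto simp: cosets_def)
    then have "e = (+) (r c + y) ` J" by (simp add: f_def shift)
    moreover have "r c + y \<in> H" using r[OF cy(2)] cy(3) assms by (intro add_subgroup_add) auto
    ultimately show "e \<in> cosets H J" by (auto simp: cosets_def)
  next
    fix e assume "e \<in> cosets H J"
    then obtain x where x: "x \<in> H" "e = (+) x ` J" by (auto simp: cosets_def)
    define c where "c = (+) x ` I"
    have c: "c \<in> cosets H I" using x by (auto simp: c_def cosets_def)
    then have "x - r c \<in> I" using r[OF c] coset_eq_iff[OF assms(2)] c_def by metis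
    moreover have "e = f (c, (+) (x - r c) ` J)" by (simp add: f_def shift x)
    ultimately show "e \<in> f ` (cosets H I \<times> cosets I J)" using c by (auto simp: cosets_def)
  qed
  ultimately show ?thesis unfolding bij_betw_def by blast
qed

lemma cosets_mult:
  assumes "add_subgroup H" "add_subgroup I" "add_subgroup J" "J \<subseteq> I" "I \<subseteq> H"
  shows index_mult: "index H J = index H I * index I J"
    and finite_cosets_iff: "finite (cosets H J) \<longleftrightarrow> finite (cosets H I \<times> cosets I J)"
  using coset_product_bij[OF assms] bij_betw_same_card bij_betw_finite
  unfolding index_def by (metis card_cartesian_product)+

lemma cosets_nonempty: "add_subgroup I \<Longrightarrow> cosets I J \<noteq> {}"
  using add_subgroup_0 by (auto simp: cosets_def)

lemma finite_cosets_subs: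
  assumes "add_subgroup H" "add_subgroup I" "add_subgroup J" "J \<subseteq> I" "I \<subseteq> H" "finite (cosets H J)"
  shows "finite (cosets H I)" "finite (cosets I J)"
  using finite_cosets_iff[OF assms(1-5)] assms(6) cosets_nonempty[OF assms(1), of I] cosets_nonempty[OF assms(2), of J]
  by (auto dest: finite_cartesian_productD1 finite_cartesian_productD2)

lemma index_pos: "add_subgroup I \<Longrightarrow> finite (cosets I J) \<Longrightarrow> 0 < index I J"
  using cosets_nonempty[of I J] by (simp add: index_def card_gt_0_iff)

lemma index_eq_1:
  assumes "add_subgroup I" "add_subgroup J" "J \<subseteq> I" "index I J = 1"
  shows "I = J"
proof (intro equalityI assms subsetI)
  fix x assume x: "x \<in> I"
  obtain c where "cosets I J = {c}" using assms(4) card_1_singletonE unfolding index_def by blast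
  moreover have "(+) x ` J \<in> cosets I J" "(+) 0 ` J \<in> cosets I J"
    unfolding cosets_def by (intro imageI x add_subgroup_0 assms)+
  ultimately have "(+) x ` J = (+) 0 ` J" by simp
  then show "x \<in> J" using coset_eq_iff[OF assms(2)] by (metis diff_zero)
qed

lemma index_less:
  assumes "add_subgroup H" "add_subgroup I" "add_subgroup J" "J \<subset> I" "I \<subseteq> H" "finite (cosets H J)"
  shows "index H I < index H J"
proof -
  have fin: "finite (cosets H I)" "finite (cosets I J)"
    using finite_cosets_subs[OF assms(1-3) _ assms(5,6)] assms(4) by auto
  then have "0 < index H I" "0 < index I J" using index_pos[OF assms(1) fin(1)] index_pos[OF assms(2) fin(2)]
    by auto
  moreover have "index I J \<noteq> 1" using index_eq_1[of I J] assms by auto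
  moreover have "index H J = index H I * index I J" using assms by (intro index_mult) auto
  ultimately show ?thesis by simp
qed

lemma cosets_image_bij:
  assumes "add_subgroup J" "J \<subseteq> I" "add_subgroup I" "inj_on f I" "\<And>x y. x \<in> I \<Longrightarrow> y \<in> I \<Longrightarrow> f (x + y) = f x + f y"
  shows "bij_betw ((`) f) (cosets I J) (cosets (f ` I) (f ` J))"
proof -
  have sub: "c \<subseteq> I" if "c \<in> cosets I J" for c
    using that assms by (auto simp: cosets_def intro: add_subgroup_add)
  have img: "f ` (+) x ` J = (+) (f x) ` f ` J" if "x \<in> I" for x
    unfolding image_image using assms(2,5) that by (intro image_cong refl) auto
  have "inj_on ((`) f) (cosets I J)"
    using sub assms(4) by (intro inj_onI) (metis inj_on_image_eq_iff)
  moreover have "(`) f ` cosets I J = cosets (f ` I) (f ` J)"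
  proof (intro equalityI subsetI)
    fix c assume "c \<in> (`) f ` cosets I J"
    then obtain x where "x \<in> I" "c = f ` (+) x ` J" unfolding cosets_def by blast
    then show "c \<in> cosets (f ` I) (f ` J)" unfolding cosets_def using img by blast
  next
    fix c assume "c \<in> cosets (f ` I) (f ` J)"
    then obtain x where "x \<in> I" "c = (+) (f x) ` f ` J" unfolding cosets_def by blast
    then show "c \<in> (`) f ` cosets I J" unfolding cosets_def using img by blast
  qed
  ultimately show ?thesis by (simp add: bij_betw_def)
qed

lemma add_subgroup_scale: "add_subgroup I \<Longrightarrow> add_subgroup (scale z I)"
  unfolding add_subgroup_def scale_def by (auto simp flip: right_diff_distrib)

lemma scale_scale: "scale y (scale z I) = scale (y * z) I"
  by (simp add: scale_def image_image mult.assoc)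

lemma scale_1 [simp]: "scale 1 I = I"
  by (simp add: scale_def)

lemma scale_mono: "I \<subseteq> J \<Longrightarrow> scale z I \<subseteq> scale z J"
  by (auto simp: scale_def)

lemma mem_scale_iff: "z \<noteq> 0 \<Longrightarrow> x \<in> scale z I \<longleftrightarrow> x / z \<in> I"
  unfolding scale_def image_iff by (auto intro!: bexI[of _ "x / z"])

lemma cosets_scale:
  assumes "add_subgroup J" "J \<subseteq> I" "add_subgroup I" "z \<noteq> 0"
  shows index_scale: "index (scale z I) (scale z J) = index I J"
    and finite_cosets_scale: "finite (cosets (scale z I) (scale z J)) \<longleftrightarrow> finite (cosets I J)"
  using cosets_image_bij[OF assms(1-3), of "\<lambda>x. z * x"] assms(4)
  by (auto simp: inj_on_def distrib_left index_def scale_def dest: bij_betw_same_card bij_betw_finite)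


section \<open>Ideals of the ring of integers\<close>

text \<open>The rules are those of \<open>ideal_prod\<close>, which makes the later identification
  of the two a rule-by-rule induction. Zero and negatives come from the factors being additive
  groups.\<close>

inductive_set iprod :: "complex set \<Rightarrow> complex set \<Rightarrow> complex set" for I J where
  iprod_mult: "x \<in> I \<Longrightarrow> y \<in> J \<Longrightarrow> x * y \<in> iprod I J"
| iprod_add: "x \<in> iprod I J \<Longrightarrow> y \<in> iprod I J \<Longrightarrow> x + y \<in> iprod I J"

lemma iprod_least:
  assumes "add_subgroup H" "\<And>x y. x \<in> I \<Longrightarrow> y \<in> J \<Longrightarrow> x * y \<in> H"
  shows "iprod I J \<subseteq> H"
proof
  fix z assume "z \<in> iprod I J"
  then show "z \<in> H" by induction (auto intro: assms add_subgroup_add)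
qed

lemma iprod_mono:
  assumes "I \<subseteq> I'" "J \<subseteq> J'"
  shows "iprod I J \<subseteq> iprod I' J'"
proof
  fix z assume "z \<in> iprod I J"
  then show "z \<in> iprod I' J'" by induction (use assms in \<open>auto intro: iprod.intros\<close>)
qed

lemma add_subgroup_iprod:
  assumes "add_subgroup I" "add_subgroup J"
  shows "add_subgroup (iprod I J)"
proof -
  have neg: "- z \<in> iprod I J" if "z \<in> iprod I J" for z
    using that
  proof induction
    case (iprod_mult x y)
    then have "(- x) * y \<in> iprod I J" using assms by (intro iprod.intros add_subgroup_minus)
    then show ?case by simp
  next
    case (iprod_add x y)
    then have "- x + - y \<in> iprod I J" by (intro iprod.intros)
    then show ?case by (simp add: algebra_simps)
  qed
  have "0 * 0 \<in> iprod I J" using assms by (intro iprod.intros add_subgroup_0)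
  moreover have "x - y \<in> iprod I J" if "x \<in> iprod I J" "y \<in> iprod I J" for x y
    using iprod_add[OF that(1) neg[OF that(2)]] by simp
  ultimately show ?thesis by (simp add: add_subgroup_def)
qed

lemma iprod_commute: "iprod I J = iprod J I"
proof -
  have "z \<in> iprod J I" if "z \<in> iprod I J" for z I J
    using that by induction (metis iprod.intros mult.commute)+
  then show ?thesis by blast
qed

lemma iprod_assoc:
  assumes "add_subgroup I" "add_subgroup J" "add_subgroup H"
  shows "iprod (iprod I J) H = iprod I (iprod J H)"
proof (rule equalityI)
  show "iprod (iprod I J) H \<subseteq> iprod I (iprod J H)"
  proof (rule iprod_least)
    fix x y assume "x \<in> iprod I J" "y \<in> H"
    then show "x * y \<in> iprod I (iprod J H)"
    proof (induction rule: iprod.induct)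
      case (iprod_mult a b)
      then have "a * (b * y) \<in> iprod I (iprod J H)" by (intro iprod.intros)
      then show ?case by (simp add: mult.assoc)
    qed (auto simp: distrib_right intro: iprod.intros)
  qed (intro add_subgroup_iprod assms)
  show "iprod I (iprod J H) \<subseteq> iprod (iprod I J) H"
  proof (rule iprod_least)
    fix x y assume "y \<in> iprod J H" "x \<in> I"
    then show "x * y \<in> iprod (iprod I J) H"
    proof (induction rule: iprod.induct)
      case (iprod_mult a b)
      then have "(x * a) * b \<in> iprod (iprod I J) H" by (intro iprod.intros)
      then show ?case by (simp add: mult.assoc)
    qed (auto simp: distrib_left intro: iprod.intros)
  qed (intro add_subgroup_iprod assms)
qed

lemma iprod_scale: "iprod (scale z I) J = scale z (iprod I J)"
proof (intro equalityI subsetI)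
  fix x assume "x \<in> iprod (scale z I) J"
  then show "x \<in> scale z (iprod I J)"
  proof induction
    case (iprod_mult x y)
    then show ?case by (auto simp: scale_def mult.assoc intro!: imageI iprod.intros)
  next
    case (iprod_add x y)
    then show ?case by (auto simp: scale_def iprod.intros simp flip: distrib_left)
  qed
next
  fix x assume "x \<in> scale z (iprod I J)"
  then obtain w where w: "w \<in> iprod I J" "x = z * w" by (auto simp: scale_def)
  from w(1) have "z * w \<in> iprod (scale z I) J"
  proof induction
    case (iprod_mult x y)
    then have "(z * x) * y \<in> iprod (scale z I) J" by (intro iprod.intros) (auto simp: scale_def)
    then show ?case by (simp add: mult.assoc)
  qed (auto simp: distrib_left intro: iprod.intros)
  then show "x \<in> iprod (scale z I) J" by (simp add: w)
qed

context cyclotomic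
begin

section \<open>Fractional ideals, and the norm of a principal ideal\<close>

definition frac_ideal :: "complex set \<Rightarrow> bool" where
  "frac_ideal I \<longleftrightarrow> add_subgroup I \<and> (\<forall>r\<in>Oz. \<forall>x\<in>I. r * x \<in> I) \<and> I \<noteq> {0} \<and>
     (\<exists>d\<in>Oz - {0}. \<forall>x\<in>I. d * x \<in> Oz)"

definition int_ideal :: "complex set \<Rightarrow> bool" where
  "int_ideal I \<longleftrightarrow> frac_ideal I \<and> I \<subseteq> Oz"

lemma frac_ideal_add_subgroup [intro]: "frac_ideal I \<Longrightarrow> add_subgroup I"
  and frac_ideal_mult: "frac_ideal I \<Longrightarrow> r \<in> Oz \<Longrightarrow> x \<in> I \<Longrightarrow> r * x \<in> I"
  by (auto simp: frac_ideal_def)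

lemma int_ideal_frac_ideal [intro]: "int_ideal I \<Longrightarrow> frac_ideal I"
  and int_ideal_sub: "int_ideal I \<Longrightarrow> I \<subseteq> Oz"
  by (auto simp: int_ideal_def)

lemma add_subgroup_Oz [simp, intro]: "add_subgroup Oz"
  by (auto simp: add_subgroup_def)

lemma iidI:
  assumes "add_subgroup I" "\<And>r x. r \<in> Oz \<Longrightarrow> x \<in> I \<Longrightarrow> r * x \<in> I" "I \<subseteq> Oz" "x \<in> I" "x \<noteq> 0"
  shows "int_ideal I"
  unfolding int_ideal_def frac_ideal_def using assms by (auto intro!: bexI[of _ 1])

lemma int_ideal_Oz [simp, intro]: "int_ideal Oz"
  by (rule iidI[of _ 1]) auto

lemma frac_ideal_nonzero:
  assumes "frac_ideal I"
  obtains x where "x \<in> I" "x \<noteq> 0"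
  using assms add_subgroup_0 unfolding frac_ideal_def by blast

lemma frac_ideal_sub_Kz:
  assumes "frac_ideal I"
  shows "I \<subseteq> Kz"
proof
  fix x assume x: "x \<in> I"
  obtain d where d: "d \<in> Oz" "d \<noteq> 0" "d * x \<in> Oz" using assms x unfolding frac_ideal_def by blast
  then have "d * x / d \<in> Kz" by (intro Kz_divide) auto
  then show "x \<in> Kz" using d by simp
qed

lemma Kz_denominator:
  assumes "x \<in> Kz"
  obtains d where "d \<in> Oz" "d \<noteq> 0" "d * x \<in> Oz"
proof -
  obtain m :: int where "m \<noteq> 0" "of_int m * x \<in> Oz" using assms unfolding Kz_def by blast
  then show ?thesis using that[of "of_int m"] by simp
qed

lemma frac_ideal_scale:
  assumes "frac_ideal I" "z \<in> Kz" "z \<noteq> 0"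
  shows "frac_ideal (scale z I)"
proof -
  obtain e where e: "e \<in> Oz" "e \<noteq> 0" "e * z \<in> Oz" using Kz_denominator assms(2) by metis
  obtain d where d: "d \<in> Oz" "d \<noteq> 0" "\<forall>x\<in>I. d * x \<in> Oz" using assms unfolding frac_ideal_def by blast
  obtain x where x: "x \<in> I" "x \<noteq> 0" using frac_ideal_nonzero assms(1) by blast
  have "e * d * (z * y) \<in> Oz" if "y \<in> I" for y
  proof -
    have "(e * z) * (d * y) \<in> Oz" using e d that by auto
    then show ?thesis by (simp add: mult_ac)
  qed
  then have "\<exists>d\<in>Oz - {0}. \<forall>x\<in>scale z I. d * x \<in> Oz"
    using e d by (intro bexI[of _ "e * d"]) (auto simp: scale_def)
  moreover have "z * x \<in> scale z I" "z * x \<noteq> 0" using x assms by (auto simp: scale_def)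
  then have "scale z I \<noteq> {0}" by blast
  moreover have "r * x \<in> scale z I" if "r \<in> Oz" "x \<in> scale z I" for r x
    using that frac_ideal_mult[OF assms(1)] by (auto simp: scale_def mult.left_commute)
  ultimately show ?thesis using assms(1) by (auto simp: frac_ideal_def add_subgroup_scale)
qed

lemma frac_ideal_int:
  assumes "frac_ideal I"
  obtains m :: int where "m > 0" "of_int m \<in> I"
proof -
  obtain d where d: "d \<in> Oz" "d \<noteq> 0" "\<forall>x\<in>I. d * x \<in> Oz" using assms unfolding frac_ideal_def by blast
  obtain x where x: "x \<in> I" "x \<noteq> 0" using frac_ideal_nonzero assms(1) by blast
  let ?y = "d * x"
  have y: "?y \<in> Oz" "?y \<noteq> 0" "?y \<in> I" using x d frac_ideal_mult[OF assms] by auto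
  obtain z where z: "z \<in> Oz" "Nm ?y = ?y * z" using Nm_multiple[OF y(1)] by blast
  obtain n where n: "Nm ?y = of_int n" using Nm_in_Ints[OF y(1)] by (auto elim: Ints_cases)
  have "n \<noteq> 0" using n Nm_eq_0_iff[OF y(1)] y(2) by auto
  have "of_int n \<in> I" using z n y frac_ideal_mult[OF assms, of z ?y] by (simp add: mult.commute)
  moreover from this have "of_int (- n) \<in> I" using add_subgroup_minus frac_ideal_add_subgroup[OF assms]
    by force
  ultimately have "of_int \<bar>n\<bar> \<in> I" by (cases "n \<ge> 0") auto
  then show ?thesis using \<open>n \<noteq> 0\<close> that[of "\<bar>n\<bar>"] by simp
qed

lemma cosets_nat_multiple:
  fixes m :: nat
  assumes m: "m > 0"
  shows index_nat_multiple: "index Oz (scale (of_nat m) Oz) = m ^ (p - 1)"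
    and finite_cosets_nat: "finite (cosets Oz (scale (of_nat m) Oz))"
proof -
  let ?D = "PiE {..<p - 1} (\<lambda>_. {..<m})"
  define g where "g c = (\<Sum>j<p - 1. of_int (int (c j)) * \<zeta> ^ j)" for c
  define f where "f c = (+) (g c) ` scale (of_nat m) Oz" for c
  have sub: "add_subgroup (scale (of_nat m) Oz)" by (intro add_subgroup_scale) auto
  have g_Oz: "g c \<in> Oz" for c unfolding g_def by (intro Oz_sum Oz_closed) auto
  have "inj_on f ?D"
  proof (rule inj_onI)
    fix c d assume cd: "c \<in> ?D" "d \<in> ?D" "f c = f d"
    then have "g c - g d \<in> scale (of_nat m) Oz" by (simp add: f_def coset_eq_iff[OF sub])
    then obtain y where y: "y \<in> Oz" "g c - g d = of_nat m * y" by (auto simp: scale_def)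
    obtain e where e: "y = (\<Sum>j<p - 1. of_int (e j) * \<zeta> ^ j)" using Oz_coords[OF y(1)] .
    have "(\<Sum>j<p - 1. of_int (int (c j) - int (d j)) * \<zeta> ^ j) = (\<Sum>j<p - 1. of_int (int m * e j) * \<zeta> ^ j)"
      using y(2) unfolding g_def e by (simp add: sum_subtractf left_diff_distrib sum_distrib_left mult.assoc)
    from sum_zeta_eq[OF this] have eq: "int (c j) - int (d j) = int m * e j" if "j < p - 1" for j using that .
    show "c = d"
    proof (rule PiE_ext[OF cd(1,2)])
      fix j assume j: "j \<in> {..<p - 1}"
      then have b: "c j < m" "d j < m" using cd by auto
      have "int m dvd int (c j) - int (d j)" using eq[of j] j by simp
      then have "int (c j) mod int m = int (d j) mod int m" by (simp add: mod_eq_dvd_iff)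
      then show "c j = d j" using b by simp
    qed
  qed
  moreover have "f ` ?D = cosets Oz (scale (of_nat m) Oz)"
  proof (intro equalityI subsetI)
    fix u assume "u \<in> cosets Oz (scale (of_nat m) Oz)"
    then obtain x where x: "x \<in> Oz" "u = (+) x ` scale (of_nat m) Oz" by (auto simp: cosets_def)
    obtain e where e: "x = (\<Sum>j<p - 1. of_int (e j) * \<zeta> ^ j)" using Oz_coords[OF x(1)] .
    define c where "c = (\<lambda>j\<in>{..<p - 1}. nat (e j mod int m))"
    have "c \<in> ?D" using m by (auto simp: c_def nat_less_iff)
    moreover have "x - g c \<in> scale (of_nat m) Oz"
    proof -
      have "x - g c = (\<Sum>j<p - 1. of_nat m * (of_int (e j div int m) * \<zeta> ^ j))"
        unfolding e g_def sum_subtractf[symmetric]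
      proof (intro sum.cong refl)
        fix j assume j: "j \<in> {..<p - 1}"
        have "e j - e j mod int m = int m * (e j div int m)" by (simp add: minus_mod_eq_mult_div)
        then have "of_int (e j) - of_int (e j mod int m) = (of_nat m * of_int (e j div int m) :: complex)"
          by (metis of_int_diff of_int_mult of_int_of_nat_eq)
        then show "of_int (e j) * \<zeta> ^ j - of_int (int (c j)) * \<zeta> ^ j = of_nat m * (of_int (e j div int m) * \<zeta> ^ j)"
          using j m by (simp add: c_def flip: left_diff_distrib mult.assoc)
      qed
      also have "\<dots> = of_nat m * (\<Sum>j<p - 1. of_int (e j div int m) * \<zeta> ^ j)" by (simp add: sum_distrib_left)
      finally show ?thesis unfolding scale_def by (auto intro!: Oz_sum)
    qed
    then have "u = f c" by (simp add: x f_def coset_eq_iff[OF sub])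
    ultimately show "u \<in> f ` ?D" by blast
  qed (auto simp: f_def cosets_def g_Oz)
  ultimately have bij: "bij_betw f ?D (cosets Oz (scale (of_nat m) Oz))" by (simp add: bij_betw_def)
  show "index Oz (scale (of_nat m) Oz) = m ^ (p - 1)"
    unfolding index_def bij_betw_same_card[OF bij, symmetric] by (simp add: card_PiE)
  show "finite (cosets Oz (scale (of_nat m) Oz))"
    using bij_betw_finite[OF bij] by (simp add: finite_PiE)
qed

lemma int_ideal_finite:
  assumes "int_ideal I"
  shows "finite (cosets Oz I)"
proof -
  obtain m :: int where m: "m > 0" "of_int m \<in> I" using frac_ideal_int assms by blast
  have "scale (of_nat (nat m)) Oz \<subseteq> I"
    using m frac_ideal_mult[of I _ "of_int m"] assms by (auto simp: scale_def mult.commute)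
  then show ?thesis using finite_cosets_nat[of "nat m"] m assms int_ideal_sub
    by (intro finite_cosets_subs(1)[of Oz I "scale (of_nat (nat m)) Oz"] add_subgroup_scale int_ideal_sub frac_ideal_add_subgroup int_ideal_frac_ideal add_subgroup_Oz) auto
qed

text \<open>No determinant is involved: conjugates of x generate ideals of the same index and the
  index is multiplicative on principal ideals, so the index of (x) to the power p - 1 is the index
  of the integer N(x), which is |N(x)|^(p-1).\<close>

lemma index_principal:
  assumes "x \<in> Oz" "x \<noteq> 0"
  shows "real (index Oz (scale x Oz)) = cmod (Nm x)"
proof -
  have scale_sub: "scale y Oz \<subseteq> Oz" if "y \<in> Oz" for y using that by (auto simp: scale_def)
  have mult: "index Oz (scale (x * y) Oz) = index Oz (scale x Oz) * index Oz (scale y Oz)"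
    if "x \<in> Oz" "x \<noteq> 0" "y \<in> Oz" for x y
  proof -
    have "index Oz (scale x (scale y Oz)) = index Oz (scale x Oz) * index (scale x Oz) (scale x (scale y Oz))"
      using that by (intro index_mult add_subgroup_scale scale_mono scale_sub) auto
    also have "index (scale x Oz) (scale x (scale y Oz)) = index Oz (scale y Oz)"
      using that by (intro index_scale add_subgroup_scale scale_sub) auto
    finally show ?thesis by (simp add: scale_scale)
  qed
  have conj: "index Oz (scale (sig k x) Oz) = index Oz (scale x Oz)" if k: "\<not> p dvd k" for k
  proof -
    have inj: "inj_on (sig k) Oz"
      using k sig_eq_0_iff[OF k] sig_simps(2)[OF k] by (intro inj_onI) (metis Oz_closed(2) right_minus_eq)
    obtain l where l: "\<not> p dvd l" "k * l mod p = 1" using ex_inverse_mod[OF k] .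
    have "y = sig k (sig l y)" if "y \<in> Oz" for y
      using sig_sig[OF l(1) k that] l(2) that sig_mod[of "l * k" y] by (simp add: mult.commute)
    then have surj: "sig k ` Oz = Oz" using sig_simps(4)[OF k] sig_simps(4)[OF l(1)]
      by (auto simp: image_iff) metis
    have img: "sig k ` scale x Oz = scale (sig k x) Oz"
    proof -
      have "sig k ` scale x Oz = (\<lambda>y. sig k x * sig k y) ` Oz"
        unfolding scale_def image_image using assms k by (intro image_cong refl sig_simps) auto
      also have "\<dots> = (\<lambda>y. sig k x * y) ` (sig k ` Oz)" by (simp add: image_image)
      finally show ?thesis by (simp add: surj scale_def)
    qed
    have "bij_betw ((`) (sig k)) (cosets Oz (scale x Oz)) (cosets (sig k ` Oz) (sig k ` scale x Oz))"
      using assms k inj by (intro cosets_image_bij add_subgroup_scale scale_sub sig_simps) auto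
    then show ?thesis unfolding index_def img surj by (simp add: bij_betw_same_card)
  qed
  have prod: "index Oz (scale (\<Prod>k\<in>A. sig k x) Oz) = index Oz (scale x Oz) ^ card A"
    if "A \<subseteq> {1..<p}" for A
  proof -
    have "finite A" using that finite_subset by blast
    then show ?thesis using that
    proof (induction A)
      case empty
      have "cosets Oz Oz = {(+) 0 ` Oz}"
      proof -
        have "cosets Oz Oz = (\<lambda>x. (+) 0 ` Oz) ` Oz"
          unfolding cosets_def
            by (rule image_cong[OF refl]) (simp only: coset_eq_iff[OF add_subgroup_Oz] diff_zero)
        then show ?thesis by auto
      qed
      then show ?case by (simp add: index_def)
    next
      case (insert k A)
      then have k: "\<not> p dvd k" using not_dvd_range by auto
      have "(\<Prod>k\<in>A. sig k x) \<in> Oz" using insert.prems assms not_dvd_range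
        by (intro Oz_prod sig_simps) auto
      then show ?case using insert k assms by (simp add: mult sig_eq_0_iff sig_simps conj)
    qed
  qed
  obtain n where n: "Nm x = of_int n" using Nm_in_Ints[OF assms(1)] by (auto elim: Ints_cases)
  have n0: "n \<noteq> 0" using n Nm_eq_0_iff[OF assms(1)] assms(2) by auto
  have "scale (of_int n) Oz = scale (of_nat (nat \<bar>n\<bar>)) Oz"
  proof (cases "n \<ge> 0")
    case False
    have "scale (of_int n) Oz = (\<lambda>x. of_int (- n) * x) ` uminus ` Oz" by (simp add: scale_def image_image)
    also have "uminus ` Oz = Oz" by (auto simp: image_iff) (metis Oz_closed(4) minus_minus)
    finally show ?thesis using False by (simp add: scale_def)
  qed simp
  then have "index Oz (scale (Nm x) Oz) = nat \<bar>n\<bar> ^ (p - 1)"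
  proof -
    have "0 < nat \<bar>n\<bar>" using n0 by simp
    from index_nat_multiple[OF this] show ?thesis
      unfolding n using \<open>scale (of_int n) Oz = scale (of_nat (nat \<bar>n\<bar>)) Oz\<close> by simp
  qed
  moreover have "index Oz (scale (Nm x) Oz) = index Oz (scale x Oz) ^ (p - 1)"
    using prod[of "{1..<p}"] by (simp add: Nm_def)
  ultimately have "index Oz (scale x Oz) = nat \<bar>n\<bar>"
    using p_gt_2 power_eq_imp_eq_base[of "index Oz (scale x Oz)" "p - 1" "nat \<bar>n\<bar>"] by simp
  then show ?thesis using n by simp
qed

declare frac_ideal_add_subgroup [simp] int_ideal_frac_ideal [simp]

lemma int_ideal_principal:
  assumes "x \<in> Oz" "x \<noteq> 0"
  shows "int_ideal (scale x Oz)"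
proof (rule iidI[of _ x])
  show "add_subgroup (scale x Oz)" by (intro add_subgroup_scale) auto
  show "scale x Oz \<subseteq> Oz" using assms by (auto simp: scale_def)
  have "x * 1 \<in> scale x Oz" unfolding scale_def by (intro imageI) auto
  then show "x \<in> scale x Oz" by simp
  fix r y assume "r \<in> Oz" "y \<in> scale x Oz"
  then obtain z where "z \<in> Oz" "r * y = x * (r * z)" by (auto simp: scale_def)
  then show "r * y \<in> scale x Oz" using \<open>r \<in> Oz\<close> by (auto simp: scale_def)
qed (rule assms)

lemma frac_ideal_iprod:
  assumes "frac_ideal I" "frac_ideal J"
  shows "frac_ideal (iprod I J)"
proof -
  obtain d where d: "d \<in> Oz" "d \<noteq> 0" "\<forall>x\<in>I. d * x \<in> Oz" using assms unfolding frac_ideal_def by blast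
  obtain e where e: "e \<in> Oz" "e \<noteq> 0" "\<forall>x\<in>J. e * x \<in> Oz" using assms unfolding frac_ideal_def by blast
  obtain x where x: "x \<in> I" "x \<noteq> 0" using frac_ideal_nonzero assms(1) by blast
  obtain y where y: "y \<in> J" "y \<noteq> 0" using frac_ideal_nonzero assms(2) by blast
  have de: "(d * e) * z \<in> Oz" if "z \<in> iprod I J" for z
    using that
  proof induction
    case (iprod_mult x y)
    then have "(d * x) * (e * y) \<in> Oz" using d e by auto
    then show ?case by (simp add: mult_ac)
  qed (auto simp: distrib_left)
  have cl: "r * z \<in> iprod I J" if r: "r \<in> Oz" and "z \<in> iprod I J" for r z
    using that(2)
  proof induction
    case (iprod_mult x y)
    then have "(r * x) * y \<in> iprod I J" using r assms(1) by (intro iprod.intros frac_ideal_mult)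
    then show ?case by (simp add: mult.assoc)
  qed (auto simp: distrib_left intro: iprod.intros)
  have "x * y \<in> iprod I J" "x * y \<noteq> 0" using x y by (auto intro: iprod.intros)
  then have "iprod I J \<noteq> {0}" by blast
  moreover have "\<exists>d\<in>Oz - {0}. \<forall>x\<in>iprod I J. d * x \<in> Oz"
    using d e de by (intro bexI[of _ "d * e"]) auto
  ultimately show ?thesis using cl add_subgroup_iprod assms unfolding frac_ideal_def by blast
qed

lemma iprod_Oz:
  assumes "frac_ideal I"
  shows "iprod I Oz = I" "iprod Oz I = I"
proof -
  show "iprod I Oz = I"
  proof (rule equalityI)
    show "iprod I Oz \<subseteq> I"
      using frac_ideal_mult[OF assms]
        by (intro iprod_least frac_ideal_add_subgroup assms) (metis mult.commute)
    show "I \<subseteq> iprod I Oz"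
      using iprod.iprod_mult[of _ I 1 Oz] by force
  qed
  then show "iprod Oz I = I" by (simp add: iprod_commute)
qed

lemma int_ideal_iprod: "int_ideal I \<Longrightarrow> int_ideal J \<Longrightarrow> int_ideal (iprod I J)"
  using frac_ideal_iprod[of I J] iprod_mono[of I Oz J Oz] iprod_Oz(1)[of Oz]
    by (auto simp: int_ideal_def simp del: int_ideal_frac_ideal)

lemma iprod_sub_left: "frac_ideal I \<Longrightarrow> int_ideal J \<Longrightarrow> iprod I J \<subseteq> I"
  using iprod_mono[of I I J Oz] iprod_Oz(1)[of I] by (simp add: int_ideal_def del: int_ideal_frac_ideal)

text \<open>An element stabilising an ideal is integral: two of the \<open>2\<^sup>N\<close> sums \<open>\<Sum>\<^bsub>i\<in>S\<^esub> \<omega>\<^sup>i\<close> agree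
  modulo the integers, and their difference is monic in \<open>\<omega>\<close> up to sign.\<close>
lemma stabilizer_integral:
  assumes I: "frac_ideal I" and w: "\<And>x. x \<in> I \<Longrightarrow> w * x \<in> I"
  shows "w \<in> Oz"
proof -
  obtain d where d: "d \<in> Oz" "d \<noteq> 0" "\<forall>x\<in>I. d * x \<in> Oz" using I unfolding frac_ideal_def by blast
  obtain a where a: "a \<in> I" "a \<noteq> 0" using frac_ideal_nonzero I by blast
  \<comment> \<open>A common denominator for all powers of w at once, since every w^k a lies in
    I.\<close>
  define e where "e = d * a"
  have "w ^ k * a \<in> I" for k by (induction k) (auto simp: a mult.assoc intro: w)
  then have pw: "e * w ^ k \<in> Oz" for k using d by (metis e_def mult.assoc mult.commute)
  have e: "e \<in> Oz" "e \<noteq> 0" using pw[of 0] d a by (auto simp: e_def)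
  have ide: "int_ideal (scale e Oz)"
    using e by (rule int_ideal_principal)
  define N where "N = index Oz (scale e Oz)"
  \<comment> \<open>The exponents start at 1 so that the difference of two distinct subset sums is a
    polynomial of positive degree.\<close>
  define f where "f S = (+) (\<Sum>i\<in>S. e * w ^ i) ` scale e Oz" for S :: "nat set"
  have "\<not> inj_on f (Pow {1..N})"
  proof
    assume inj: "inj_on f (Pow {1..N})"
    have "f ` Pow {1..N} \<subseteq> cosets Oz (scale e Oz)"
      unfolding f_def cosets_def by (intro image_subsetI imageI Oz_sum pw)
    then have "card (f ` Pow {1..N}) \<le> N"
      unfolding N_def index_def by (intro card_mono int_ideal_finite ide)
    then have "2 ^ N \<le> N" using card_image[OF inj] by (simp add: card_Pow)
    then show False using less_exp[of N] by simp
  qed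
  then obtain S T where ST: "S \<subseteq> {1..N}" "T \<subseteq> {1..N}" "S \<noteq> T" "f S = f T" by (auto simp: inj_on_def)
  have fin: "finite S" "finite T" using ST finite_subset by blast+
  define D where "D = (S - T) \<union> (T - S)"
  have "finite D" "D \<noteq> {}" using ST fin by (auto simp: D_def)
  define k where "k = Max D"
  have k: "k \<in> D" "\<And>i. i \<in> D \<Longrightarrow> i \<le> k" using \<open>finite D\<close> \<open>D \<noteq> {}\<close> by (auto simp: k_def)
  have "algebraic_int w"
  proof -
    \<comment> \<open>Stated for arbitrary S and T so that the set containing the largest exponent
      of the symmetric difference can be put first, which makes the leading coefficient 1 and not
      -1.\<close>
    have *: "algebraic_int w" if ST: "S \<subseteq> {1..N}" "T \<subseteq> {1..N}" "f S = f T" "k \<in> S - T"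
      "\<And>i. i \<in> (S - T) \<union> (T - S) \<Longrightarrow> i \<le> k" for S T
    proof -
      have fin: "finite S" "finite T" using ST finite_subset by blast+
      have "(\<Sum>i\<in>S. e * w ^ i) - (\<Sum>i\<in>T. e * w ^ i) \<in> scale e Oz"
        using ST(3) unfolding f_def using coset_eq_iff[OF add_subgroup_scale[OF add_subgroup_Oz]] by blast
      then obtain y where y: "y \<in> Oz" "(\<Sum>i\<in>S. e * w ^ i) - (\<Sum>i\<in>T. e * w ^ i) = e * y"
        by (auto simp: scale_def)
      then have yw: "(\<Sum>i\<in>S. w ^ i) - (\<Sum>i\<in>T. w ^ i) = y"
        using e by (simp flip: sum_distrib_left right_diff_distrib)
      define q :: "complex poly" where "q = (\<Sum>i\<in>S. Polynomial.monom 1 i) - (\<Sum>i\<in>T. Polynomial.monom 1 i)"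
      have cq: "poly.coeff q i = (if i \<in> S then 1 else 0) - (if i \<in> T then 1 else 0)" for i
        using fin by (simp add: q_def coeff_sum coeff_monom)
      have deg: "Polynomial.degree q = k"
      proof (rule antisym)
        show "Polynomial.degree q \<le> k"
        proof (rule degree_le, intro allI impI)
          fix i assume "k < i"
          then have "i \<notin> (S - T) \<union> (T - S)" using ST(5)[of i] by force
          then show "poly.coeff q i = 0" by (auto simp: cq)
        qed
        show "k \<le> Polynomial.degree q" using ST(4) by (intro le_degree) (auto simp: cq)
      qed
      show ?thesis
      proof (rule algebraic_int_root[of y q])
        show "algebraic_int y" using y by (intro algebraic_int_Oz)
        show "poly q w = y" using yw by (simp add: q_def poly_sum poly_monom)
        show "\<forall>i. poly.coeff q i \<in> \<int>" by (auto simp: cq)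
        show "lead_coeff q = 1" using ST(4) by (simp add: deg cq)
        show "0 < Polynomial.degree q" using ST(1,4) by (auto simp: deg)
      qed
    qed
    show ?thesis
    proof (cases "k \<in> S")
      case True
      then show ?thesis using k ST unfolding D_def by (intro *[of S T]) auto
    next
      case False
      then show ?thesis using k ST unfolding D_def by (intro *[of T S]) auto
    qed
  qed
  moreover have "w \<in> Kz"
  proof -
    have "(e * w ^ 1) / e \<in> Kz" using e pw by (intro Kz_divide Oz_Kz)
    then show ?thesis using e by simp
  qed
  ultimately show ?thesis by (intro integrally_closed)
qed

section \<open>Maximal ideals\<close>

definition max_ideal :: "complex set \<Rightarrow> bool" where
  "max_ideal P \<longleftrightarrow> int_ideal P \<and> P \<noteq> Oz \<and> (\<forall>J. int_ideal J \<and> P \<subseteq> J \<longrightarrow> J = P \<or> J = Oz)"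

lemma max_ideal_cases: "max_ideal P \<Longrightarrow> int_ideal J \<Longrightarrow> P \<subseteq> J \<Longrightarrow> J = P \<or> J = Oz"
  by (simp add: max_ideal_def)

lemma int_ideal_eq_Oz: "int_ideal I \<Longrightarrow> 1 \<in> I \<Longrightarrow> I = Oz"
  using frac_ideal_mult[of I _ 1] int_ideal_sub[of I]
    by (auto simp: int_ideal_def simp del: int_ideal_frac_ideal)

lemma index_int_ideal_less: "int_ideal I \<Longrightarrow> int_ideal J \<Longrightarrow> J \<subset> I \<Longrightarrow> index Oz I < index Oz J"
  by (intro index_less int_ideal_finite int_ideal_sub) auto

definition adjoin :: "complex set \<Rightarrow> complex \<Rightarrow> complex set" where
  "adjoin I x = {u + r * x | u r. u \<in> I \<and> r \<in> Oz}"

lemma adjoin_sub: "add_subgroup I \<Longrightarrow> I \<subseteq> adjoin I x" "add_subgroup I \<Longrightarrow> x \<in> adjoin I x"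
proof -
  have "u = u + 0 * x" for u by simp
  then show "add_subgroup I \<Longrightarrow> I \<subseteq> adjoin I x" unfolding adjoin_def by blast
  assume "add_subgroup I"
  then have "0 + 1 * x \<in> adjoin I x" unfolding adjoin_def using add_subgroup_0 Oz_simps(2) by blast
  then show "x \<in> adjoin I x" by simp
qed

lemma add_subgroup_adjoin: "add_subgroup I \<Longrightarrow> add_subgroup (adjoin I x)"
proof -
  assume I: "add_subgroup I"
  have "u + r * x - (v + s * x) \<in> adjoin I x" if "u \<in> I" "v \<in> I" "r \<in> Oz" "s \<in> Oz" for u v r s
  proof -
    have "(u - v) + (r - s) * x \<in> adjoin I x" unfolding adjoin_def using that I add_subgroup_diff by blast
    then show ?thesis by (simp add: algebra_simps)
  qed
  moreover have "0 \<in> adjoin I x" using adjoin_sub(1)[OF I] add_subgroup_0[OF I] by blast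
  ultimately show ?thesis unfolding add_subgroup_def by (auto simp: adjoin_def)
qed

lemma adjoin_mult: "frac_ideal I \<Longrightarrow> s \<in> Oz \<Longrightarrow> y \<in> adjoin I x \<Longrightarrow> s * y \<in> adjoin I x"
proof -
  assume *: "frac_ideal I" "s \<in> Oz" "y \<in> adjoin I x"
  then obtain u r where "y = u + r * x" "u \<in> I" "r \<in> Oz" by (auto simp: adjoin_def)
  then have "s * y = s * u + (s * r) * x" "s * u \<in> I" "s * r \<in> Oz"
    using * frac_ideal_mult by (auto simp: algebra_simps)
  then show ?thesis unfolding adjoin_def by blast
qed

lemma int_ideal_adjoin:
  assumes "int_ideal I" "x \<in> Oz"
  shows "int_ideal (adjoin I x)"
proof -
  obtain a where a: "a \<in> I" "a \<noteq> 0" using frac_ideal_nonzero assms(1) by blast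
  show ?thesis
    using assms a int_ideal_sub[OF assms(1)] adjoin_sub(1)[of I x]
    by (intro iidI[of _ a] add_subgroup_adjoin adjoin_mult) (auto simp: adjoin_def)
qed

lemma max_ideal_prime:
  assumes "max_ideal P" "x \<in> Oz" "y \<in> Oz" "x * y \<in> P" "x \<notin> P"
  shows "y \<in> P"
proof -
  have P: "int_ideal P" using assms by (simp add: max_ideal_def)
  then have aP: "add_subgroup P" by auto
  have "adjoin P x = Oz"
    using assms int_ideal_adjoin[OF P assms(2)] adjoin_sub[OF aP, of x] unfolding max_ideal_def by blast
  then have "1 \<in> adjoin P x" by simp
  then obtain u r where ur: "1 = u + r * x" "u \<in> P" "r \<in> Oz" by (auto simp: adjoin_def)
  have "y = y * (u + r * x)" using ur by simp
  also have "\<dots> = y * u + r * (x * y)" by (simp add: algebra_simps)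
  also have "\<dots> \<in> P" using ur P assms frac_ideal_mult[of P] by (intro add_subgroup_add aP) auto
  finally show ?thesis .
qed

lemma ex_max_ideal:
  assumes "int_ideal I" "I \<noteq> Oz"
  shows "\<exists>P. max_ideal P \<and> I \<subseteq> P"
  using assms
proof (induction "index Oz I" arbitrary: I rule: less_induct)
  case less
  show ?case
  proof (cases "max_ideal I")
    case False
    then obtain J where "int_ideal J" "I \<subset> J" "J \<noteq> Oz" using less.prems unfolding max_ideal_def by blast
    then show ?thesis using less index_int_ideal_less by (metis psubset_imp_subset subset_trans)
  qed blast
qed

text \<open>The powers of x repeat in the finite quotient by I. It serves to show that a proper
  ideal that is not maximal cannot be prime.\<close>

lemma int_ideal_power_cong:
  assumes I: "int_ideal I" and x: "x \<in> Oz"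
  shows "\<exists>i k. k > 0 \<and> x ^ i * (1 - x ^ k) \<in> I"
proof -
  have "\<not> inj_on (\<lambda>i. (+) (x ^ i) ` I) UNIV"
  proof
    assume "inj_on (\<lambda>i. (+) (x ^ i) ` I) (UNIV :: nat set)"
    moreover have "range (\<lambda>i. (+) (x ^ i) ` I) \<subseteq> cosets Oz I" using x by (auto simp: cosets_def)
    ultimately show False using int_ideal_finite[OF I] infinite_UNIV_nat
      by (meson finite_imageD finite_subset)
  qed
  then obtain i j :: nat where "i < j" "(+) (x ^ i) ` I = (+) (x ^ j) ` I"
    unfolding inj_on_def by (metis linorder_neqE_nat)
  then have "x ^ i - x ^ j \<in> I" using coset_eq_iff I by blast
  moreover have "x ^ i - x ^ j = x ^ i * (1 - x ^ (j - i))"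
    using \<open>i < j\<close> by (simp add: right_diff_distrib flip: power_add)
  ultimately show ?thesis using \<open>i < j\<close> by (metis zero_less_diff)
qed

section \<open>Products of maximal ideals contained in an ideal\<close>

definition lprod :: "complex set list \<Rightarrow> complex set" where
  "lprod Ps = foldr iprod Ps Oz"

lemma lprod_simps [simp]: "lprod [] = Oz" "lprod (P # Ps) = iprod P (lprod Ps)"
  by (simp_all add: lprod_def)

lemma int_ideal_lprod: "\<forall>P\<in>set Ps. int_ideal P \<Longrightarrow> int_ideal (lprod Ps)"
  by (induction Ps) (auto intro: int_ideal_iprod)

lemma lprod_append:
  "\<forall>P\<in>set Ps. int_ideal P \<Longrightarrow> \<forall>P\<in>set Qs. int_ideal P \<Longrightarrow> lprod (Ps @ Qs) = iprod (lprod Ps) (lprod Qs)"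
proof (induction Ps)
  case Nil
  then show ?case using iprod_Oz(2)[of "lprod Qs"] int_ideal_lprod[of Qs] by simp
next
  case (Cons P Ps)
  then show ?case using int_ideal_lprod[of Qs] int_ideal_lprod[of Ps] by (simp add: iprod_assoc)
qed

text \<open>Induction on the index. A proper ideal I that is not maximal is not prime, so it
  contains a b for some a, b outside it; the strictly larger ideals I + (a) and I + (b) contain such
  products, and their own product lies in I.\<close>

lemma contains_lprod:
  assumes "int_ideal I"
  shows "\<exists>Ps. (\<forall>P\<in>set Ps. max_ideal P) \<and> lprod Ps \<subseteq> I"
  using assms
proof (induction "index Oz I" arbitrary: I rule: less_induct)
  case less
  consider "I = Oz" | "max_ideal I" | "I \<noteq> Oz" "\<not> max_ideal I" by blast
  then show ?case
  proof cases
    case 1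
    then show ?thesis by (intro exI[of _ "[]"]) auto
  next
    case 2
    then show ?thesis using iprod_Oz less.prems by (intro exI[of _ "[I]"]) auto
  next
    case 3
    obtain J where J: "int_ideal J" "I \<subset> J" "J \<noteq> Oz" using 3 less.prems unfolding max_ideal_def by blast
    then obtain x where x: "x \<in> J" "x \<notin> I" by blast
    then have xO: "x \<in> Oz" using J int_ideal_sub by blast
    have "\<exists>a b. a \<in> Oz \<and> b \<in> Oz \<and> a \<notin> I \<and> b \<notin> I \<and> a * b \<in> I"
    proof (rule ccontr)
      assume "\<not> ?thesis"
      \<comment> \<open>If I were prime, then x^i (1 - x^k) in I with no power of x in I would put 1
        - x^k into I and hence into J; since x also lies in J, so would 1.\<close>
      then have np: "a \<in> I \<or> b \<in> I" if "a * b \<in> I" "a \<in> Oz" "b \<in> Oz" for a b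
        using that by blast
      obtain i k where ik: "k > 0" "x ^ i * (1 - x ^ k) \<in> I" using int_ideal_power_cong[OF less.prems xO]
        by blast
      have "x ^ i \<notin> I" for i
      proof (induction i)
        case 0
        then show ?case using int_ideal_eq_Oz[OF less.prems] 3(1) by auto
      next
        case (Suc i)
        then show ?case using np[of x "x ^ i"] x xO by auto
      qed
      then have "1 - x ^ k \<in> I" using np[OF ik(2)] xO by (meson Oz_closed(2) Oz_power Oz_simps(2))
      then have "1 - x ^ k \<in> J" using J by blast
      moreover have "x ^ k \<in> J"
      proof -
        have "x ^ (k - 1) * x \<in> J" using x(1) xO J(1) by (intro frac_ideal_mult) auto
        also have "x ^ (k - 1) * x = x ^ k" using ik(1) by (metis power_minus_mult)
        finally show ?thesis .
      qed
      ultimately have "1 - x ^ k + x ^ k \<in> J" using J(1) by (intro add_subgroup_add) auto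
      then show False using int_ideal_eq_Oz[OF J(1)] J(3) by simp
    qed
    then obtain a b where ab: "a \<in> Oz" "b \<in> Oz" "a \<notin> I" "b \<notin> I" "a * b \<in> I" by blast
    have aI: "add_subgroup I" using less.prems by auto
    have smaller: "\<exists>Ps. (\<forall>P\<in>set Ps. max_ideal P) \<and> lprod Ps \<subseteq> adjoin I c" if c: "c \<in> Oz" "c \<notin> I" for c
    proof -
      have int_ideal: "int_ideal (adjoin I c)" by (rule int_ideal_adjoin[OF less.prems c(1)])
      have "I \<noteq> adjoin I c" using adjoin_sub(2)[OF aI, of c] c(2) by auto
      then have "I \<subset> adjoin I c" using adjoin_sub(1)[OF aI, of c] by (simp add: psubset_eq)
      from less.hyps[OF index_int_ideal_less[OF int_ideal less.prems this] int_ideal] show ?thesis .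
    qed
    obtain Ps where Ps: "\<forall>P\<in>set Ps. max_ideal P" "lprod Ps \<subseteq> adjoin I a" using smaller[OF ab(1,3)] by blast
    obtain Qs where Qs: "\<forall>P\<in>set Qs. max_ideal P" "lprod Qs \<subseteq> adjoin I b" using smaller[OF ab(2,4)] by blast
    note PQ = Ps Qs
    have "lprod (Ps @ Qs) = iprod (lprod Ps) (lprod Qs)"
      using PQ by (intro lprod_append) (auto simp: max_ideal_def)
    also have "\<dots> \<subseteq> iprod (adjoin I a) (adjoin I b)" using PQ by (intro iprod_mono)
    also have "\<dots> \<subseteq> I"
    proof (rule iprod_least[OF aI])
      fix x y assume "x \<in> adjoin I a" "y \<in> adjoin I b"
      then obtain u r v s where *: "x = u + r * a" "u \<in> I" "r \<in> Oz" "y = v + s * b" "v \<in> I" "s \<in> Oz"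
        unfolding adjoin_def by blast
      have uO: "u \<in> Oz" using *(2) int_ideal_sub[OF less.prems] by (rule subsetD[rotated])
      have fI: "frac_ideal I" using less.prems by simp
      have "x * y = (u + r * a) * v + ((s * b) * u + (r * s) * (a * b))"
        unfolding * by (simp add: algebra_simps)
      also have "\<dots> \<in> I"
        by (rule add_subgroup_add[OF aI frac_ideal_mult[OF fI] add_subgroup_add[OF aI frac_ideal_mult[OF fI] frac_ideal_mult[OF fI]]];
            intro Oz_closed(1) Oz_closed(3) uO ab *)
      finally show "x * y \<in> I" .
    qed
    finally show ?thesis using PQ by (intro exI[of _ "Ps @ Qs"]) auto
  qed
qed

lemma iprod_sub_prime:
  assumes "max_ideal P" "int_ideal I" "int_ideal J" "iprod I J \<subseteq> P"
  shows "I \<subseteq> P \<or> J \<subseteq> P"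
proof (rule ccontr)
  assume "\<not> ?thesis"
  then obtain x y where xy: "x \<in> I" "x \<notin> P" "y \<in> J" "y \<notin> P" by blast
  then have "x * y \<in> P" using assms(4) iprod.intros by blast
  moreover have "x \<in> Oz" "y \<in> Oz" using xy int_ideal_sub[OF assms(2)] int_ideal_sub[OF assms(3)] by auto
  ultimately show False using max_ideal_prime[OF assms(1), of x y] xy by simp
qed

lemma lprod_sub_prime:
  assumes "max_ideal P" "\<forall>Q\<in>set Ps. max_ideal Q" "lprod Ps \<subseteq> P"
  shows "P \<in> set Ps"
  using assms(2,3)
proof (induction Ps)
  case Nil
  then show ?case using assms(1) by (auto simp: max_ideal_def dest: int_ideal_sub)
next
  case (Cons Q Ps)
  then have "Q \<subseteq> P \<or> lprod Ps \<subseteq> P"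
    using assms(1) by (intro iprod_sub_prime int_ideal_lprod) (auto simp: max_ideal_def)
  then show ?case
  proof
    assume "Q \<subseteq> P"
    then have "Q = P" using Cons.prems assms(1) unfolding max_ideal_def by (metis list.set_intros(1))
    then show ?thesis by simp
  qed (use Cons in simp)
qed

section \<open>Inverses and factorization into maximal ideals\<close>

definition inv_id :: "complex set \<Rightarrow> complex set" where
  "inv_id P = {x. \<forall>y\<in>P. x * y \<in> Oz}"

lemma frac_ideal_inv_id:
  assumes "int_ideal P"
  shows "frac_ideal (inv_id P)" "Oz \<subseteq> inv_id P"
proof -
  obtain a where a: "a \<in> P" "a \<noteq> 0" using frac_ideal_nonzero assms by blast
  show sub: "Oz \<subseteq> inv_id P" using int_ideal_sub[OF assms] by (auto simp: inv_id_def)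
  have aO: "a \<in> Oz" using a int_ideal_sub[OF assms] by blast
  have "\<exists>d\<in>Oz - {0}. \<forall>x\<in>inv_id P. d * x \<in> Oz"
    using a aO by (intro bexI[of _ a]) (auto simp: inv_id_def mult.commute)
  moreover have "add_subgroup (inv_id P)" by (auto simp: add_subgroup_def inv_id_def left_diff_distrib)
  moreover have "1 \<in> inv_id P" using sub Oz_simps(2) by (rule subsetD)
  then have "inv_id P \<noteq> {0}" by (metis singletonD zero_neq_one)
  moreover have "r * x \<in> inv_id P" if "r \<in> Oz" "x \<in> inv_id P" for r x
    using that by (auto simp: inv_id_def mult.assoc)
  ultimately show "frac_ideal (inv_id P)" unfolding frac_ideal_def by blast
qed

text \<open>Take the fewest maximal ideals whose product lies in (a). One of them is P, and without
  it the product contains some b outside (a). But P b still lies in (a), so b / a multiplies P into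
  Z[\<zeta>].\<close>

lemma inv_id_strict:
  assumes "max_ideal P"
  shows "\<exists>x\<in>inv_id P. x \<notin> Oz"
proof -
  have P: "int_ideal P" using assms by (simp add: max_ideal_def)
  obtain a where a: "a \<in> P" "a \<noteq> 0" using frac_ideal_nonzero P by blast
  have aO: "a \<in> Oz" using a int_ideal_sub[OF P] by blast
  have aI: "int_ideal (scale a Oz)" using aO a by (intro int_ideal_principal)
  have aP: "scale a Oz \<subseteq> P" using a frac_ideal_mult[of P _ a] P by (auto simp: scale_def mult.commute)
  define good where "good n \<longleftrightarrow> (\<exists>Ps. length Ps = n \<and> (\<forall>P\<in>set Ps. max_ideal P) \<and> lprod Ps \<subseteq> scale a Oz)" for n
  define n where "n = (LEAST n. good n)"
  have "\<exists>n. good n" unfolding good_def using contains_lprod[OF aI] by blast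
  then have n: "good n" "\<And>m. m < n \<Longrightarrow> \<not> good m" unfolding n_def by (auto intro: LeastI_ex dest: not_less_Least)
  obtain Ps where Ps: "length Ps = n" "\<forall>P\<in>set Ps. max_ideal P" "lprod Ps \<subseteq> scale a Oz"
    using n(1) unfolding good_def by blast
  have "P \<in> set Ps" using lprod_sub_prime[OF assms Ps(2)] Ps(3) aP by blast
  then obtain xs ys where split: "Ps = xs @ P # ys" by (meson split_list)
  have all: "\<forall>Q\<in>set xs. int_ideal Q" "\<forall>Q\<in>set ys. int_ideal Q" "\<forall>Q\<in>set (xs @ ys). max_ideal Q"
    using Ps(2) split by (auto simp: max_ideal_def)
  have len: "length (xs @ ys) < n" using Ps(1) split by simp
  have "\<not> lprod (xs @ ys) \<subseteq> scale a Oz" using n(2)[OF len] all(3) unfolding good_def by blast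
  then obtain b where b: "b \<in> lprod (xs @ ys)" "b \<notin> scale a Oz" by blast
  have "lprod Ps = iprod (lprod xs) (iprod P (lprod ys))"
    unfolding split using all P by (subst lprod_append) auto
  also have "\<dots> = iprod (iprod P (lprod xs)) (lprod ys)"
    using all P int_ideal_lprod[OF all(1)] int_ideal_lprod[OF all(2)]
      by (subst iprod_assoc[symmetric]) (auto simp: iprod_commute)
  also have "\<dots> = iprod P (lprod (xs @ ys))"
    using all P int_ideal_lprod[OF all(1)] int_ideal_lprod[OF all(2)]
      by (subst iprod_assoc) (auto simp: lprod_append)
  finally have eq: "lprod Ps = iprod P (lprod (xs @ ys))" .
  have "b / a * y \<in> Oz" if "y \<in> P" for y
  proof -
    have "y * b \<in> scale a Oz" using that b Ps(3) eq iprod.intros by blast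
    then show ?thesis using a(2) by (simp add: mem_scale_iff mult.commute)
  qed
  then have "b / a \<in> inv_id P" by (simp add: inv_id_def)
  moreover have "b / a \<notin> Oz" using b(2) a(2) by (simp add: mem_scale_iff)
  ultimately show ?thesis by blast
qed

text \<open>The product lies between P and Z[\<zeta>]. If it were P, every element of the inverse
  would stabilise P and thus be integral, contrary to \<open>inv_id_strict\<close>.\<close>

lemma max_ideal_invertible:
  assumes "max_ideal P"
  shows "iprod P (inv_id P) = Oz"
proof -
  have P: "int_ideal P" using assms by (simp add: max_ideal_def)
  let ?J = "iprod P (inv_id P)"
  have sub: "?J \<subseteq> Oz" by (rule iprod_least) (auto simp: inv_id_def mult.commute)
  then have J: "int_ideal ?J" using P
    by (auto simp: int_ideal_def simp del: int_ideal_frac_ideal intro!: frac_ideal_iprod frac_ideal_inv_id)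
  have PJ: "P \<subseteq> ?J" using iprod_mono[of P P Oz "inv_id P"] frac_ideal_inv_id(2)[OF P] iprod_Oz(1)[of P] P
    by auto
  have "?J \<noteq> P"
  proof
    assume eq: "?J = P"
    obtain x where x: "x \<in> inv_id P" "x \<notin> Oz" using inv_id_strict[OF assms] by blast
    have "x * y \<in> P" if "y \<in> P" for y
      using iprod.iprod_mult[OF that x(1)] eq by (simp add: mult.commute)
    then have "x \<in> Oz" using P by (intro stabilizer_integral[of P]) auto
    with x(2) show False by simp
  qed
  then show ?thesis using assms J PJ unfolding max_ideal_def by blast
qed

text \<open>Multiplying I by the inverse of a maximal ideal above it gives a strictly larger
  integral ideal, by the same stabiliser argument, and the index drops.\<close>

lemma factorization:
  assumes "int_ideal I"
  shows "\<exists>Ps. (\<forall>P\<in>set Ps. max_ideal P) \<and> I = lprod Ps"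
  using assms
proof (induction "index Oz I" arbitrary: I rule: less_induct)
  case less
  show ?case
  proof (cases "I = Oz")
    case False
    then obtain P where P: "max_ideal P" "I \<subseteq> P" using ex_max_ideal less.prems by blast
    then have P': "int_ideal P" by (simp add: max_ideal_def)
    have fr: "frac_ideal I" "frac_ideal (inv_id P)" "frac_ideal P" using less.prems P' frac_ideal_inv_id
      by auto
    let ?J = "iprod I (inv_id P)"
    have "?J \<subseteq> Oz" using iprod_mono[OF P(2) order.refl] max_ideal_invertible[OF P(1)] by auto
    then have J: "int_ideal ?J" using fr
      by (auto simp: int_ideal_def simp del: int_ideal_frac_ideal intro!: frac_ideal_iprod)
    have IJ: "I \<subseteq> ?J"
      using iprod_mono[of I I Oz "inv_id P"] frac_ideal_inv_id(2)[OF P'] iprod_Oz(1)[OF fr(1)] by auto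
    have "?J \<noteq> I"
    proof
      assume eq: "?J = I"
      obtain x where x: "x \<in> inv_id P" "x \<notin> Oz" using inv_id_strict[OF P(1)] by blast
      have "x * y \<in> I" if "y \<in> I" for y
        using iprod.iprod_mult[OF that x(1)] eq by (simp add: mult.commute)
      then have "x \<in> Oz" using fr by (intro stabilizer_integral[of I]) auto
      with x(2) show False by simp
    qed
    then have "I \<subset> ?J" using IJ by blast
    then have "index Oz ?J < index Oz I" by (rule index_int_ideal_less[OF J less.prems])
    from less.hyps[OF this J] obtain Ps where Ps: "\<forall>P\<in>set Ps. max_ideal P" "?J = lprod Ps" by blast
    have "lprod (P # Ps) = iprod P ?J" using Ps by simp
    also have "\<dots> = iprod I (iprod (inv_id P) P)" using fr by (subst iprod_commute) (simp add: iprod_assoc)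
    also have "\<dots> = I" using max_ideal_invertible[OF P(1)] iprod_Oz[OF fr(1)] by (simp add: iprod_commute)
    finally show ?thesis using Ps P by (intro exI[of _ "P # Ps"]) auto
  qed (auto intro!: exI[of _ "[]"])
qed

lemma lprod_invertible:
  assumes "\<forall>P\<in>set Ps. max_ideal P"
  shows "\<exists>J. frac_ideal J \<and> iprod (lprod Ps) J = Oz"
  using assms
proof (induction Ps)
  case Nil
  then show ?case by (intro exI[of _ Oz]) (auto simp: iprod_Oz)
next
  case (Cons P Ps)
  then obtain J where J: "frac_ideal J" "iprod (lprod Ps) J = Oz" by auto
  have P: "max_ideal P" "int_ideal P" using Cons by (auto simp: max_ideal_def)
  have L: "int_ideal (lprod Ps)" using Cons by (intro int_ideal_lprod) (auto simp: max_ideal_def)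
  have fr: "frac_ideal (lprod Ps)" "frac_ideal J" "frac_ideal P" "frac_ideal (inv_id P)"
    using J L P frac_ideal_inv_id by auto
  have "iprod (lprod (P # Ps)) (iprod J (inv_id P)) = iprod P (iprod (iprod (lprod Ps) J) (inv_id P))"
    using fr by (simp add: iprod_assoc frac_ideal_add_subgroup add_subgroup_iprod)
  also have "\<dots> = Oz" using J fr iprod_Oz max_ideal_invertible[OF P(1)] by simp
  finally show ?case using fr by (intro exI[of _ "iprod J (inv_id P)"]) (auto intro: frac_ideal_iprod)
qed

lemma frac_ideal_scale_int_ideal:
  assumes "frac_ideal I"
  obtains d where "d \<in> Oz" "d \<noteq> 0" "int_ideal (scale d I)"
proof -
  obtain d where d: "d \<in> Oz" "d \<noteq> 0" "\<forall>x\<in>I. d * x \<in> Oz" using assms unfolding frac_ideal_def by blast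
  then have "int_ideal (scale d I)" using assms
    by (auto simp: int_ideal_def simp del: int_ideal_frac_ideal intro!: frac_ideal_scale) (auto simp: scale_def)
  with d that show ?thesis by blast
qed

lemma frac_ideal_invertible:
  assumes "frac_ideal I"
  obtains J where "frac_ideal J" "iprod I J = Oz"
proof -
  obtain d where d: "d \<in> Oz" "d \<noteq> 0" "int_ideal (scale d I)" using frac_ideal_scale_int_ideal[OF assms] .
  obtain Ps where "\<forall>P\<in>set Ps. max_ideal P" "scale d I = lprod Ps" using factorization[OF d(3)] by blast
  then obtain J where J: "frac_ideal J" "iprod (scale d I) J = Oz" using lprod_invertible by metis
  have "iprod I (scale d J) = Oz" using J(2) by (metis iprod_commute iprod_scale)
  moreover have "frac_ideal (scale d J)" using d J by (intro frac_ideal_scale) auto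
  ultimately show ?thesis using that by blast
qed

lemma iprod_inverse:
  assumes "frac_ideal I" "frac_ideal J" "frac_ideal L" "iprod I J = Oz"
  shows "iprod J (iprod I L) = L" "iprod (iprod I L) J = L" "iprod I (iprod L J) = L"
proof -
  have "iprod J (iprod I L) = iprod (iprod J I) L" using assms by (simp add: iprod_assoc)
  also have "iprod J I = Oz" using assms(4) by (simp add: iprod_commute)
  also have "iprod Oz L = L" by (rule iprod_Oz(2)[OF assms(3)])
  finally show 1: "iprod J (iprod I L) = L" .
  have "iprod (iprod I L) J = iprod J (iprod I L)" by (rule iprod_commute)
  then show "iprod (iprod I L) J = L" using 1 by simp
  have "iprod I (iprod L J) = iprod (iprod I L) J" using assms by (simp add: iprod_assoc)
  also have "\<dots> = iprod J (iprod I L)" by (rule iprod_commute)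
  finally show "iprod I (iprod L J) = L" using 1 by simp
qed

lemma iprod_cancel:
  assumes "frac_ideal I" "frac_ideal J" "frac_ideal H" "iprod H I = iprod H J"
  shows "I = J"
proof -
  obtain H' where H': "frac_ideal H'" "iprod H H' = Oz" using frac_ideal_invertible assms by blast
  have "I = iprod H' (iprod H I)" using H' assms by (intro iprod_inverse(1)[symmetric])
  also have "\<dots> = J" unfolding assms(4) using H' assms by (intro iprod_inverse(1))
  finally show ?thesis .
qed

section \<open>Multiplicativity of the norm\<close>

text \<open>I / I P is a line over the residue field of P. For x in I outside I P, multiplying I P +
  (x) by the inverse of I gives an ideal above P other than P, so I P + (x) = I; and r x lies in I P
  exactly if r lies in P. Hence r -> r x induces a bijection of the coset spaces.\<close>

lemma index_iprod_max_ideal: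
  assumes I: "frac_ideal I" and P: "max_ideal P"
  shows "index I (iprod I P) = index Oz P"
proof -
  have P': "int_ideal P" "P \<noteq> Oz" using P by (auto simp: max_ideal_def)
  let ?J = "iprod I P"
  have J: "frac_ideal ?J" "add_subgroup ?J"
    using I P' by (auto intro!: frac_ideal_iprod frac_ideal_add_subgroup)
  have JI: "?J \<subseteq> I" using I P' by (intro iprod_sub_left)
  have "?J \<noteq> I"
  proof
    assume "?J = I"
    then have "iprod I P = iprod I Oz" using iprod_Oz I by simp
    then show False using iprod_cancel[of P Oz I] I P' by auto
  qed
  then obtain x where x: "x \<in> I" "x \<notin> ?J" using JI by blast
  have key: "r * x \<in> ?J \<longleftrightarrow> r \<in> P" if r: "r \<in> Oz" for r
  proof
    assume rx: "r * x \<in> ?J"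
    show "r \<in> P"
    proof (rule ccontr)
      assume "r \<notin> P"
      then have "adjoin P r = Oz"
        using P int_ideal_adjoin[OF P'(1) r] adjoin_sub[of P r] P' unfolding max_ideal_def by blast
      then have "1 \<in> adjoin P r" by simp
      then obtain u s where us: "1 = u + s * r" "u \<in> P" "s \<in> Oz" by (auto simp: adjoin_def)
      have "x = (u + s * r) * x" using us by simp
      also have "\<dots> = x * u + s * (r * x)" by (simp add: algebra_simps)
      also have "\<dots> \<in> ?J"
        by (rule add_subgroup_add[OF J(2) iprod.iprod_mult[OF x(1) us(2)] frac_ideal_mult[OF J(1) us(3) rx]])
      finally show False using x by simp
    qed
  next
    assume "r \<in> P"
    then show "r * x \<in> ?J" using x iprod.iprod_mult[of x I r P] by (simp add: mult.commute)
  qed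
  have full: "adjoin ?J x = I"
  proof -
    let ?H = "adjoin ?J x"
    have HI: "?H \<subseteq> I" using JI x I by (auto simp: adjoin_def intro!: add_subgroup_add frac_ideal_mult)
    obtain d where d: "d \<in> Oz - {0}" "\<forall>x\<in>I. d * x \<in> Oz" using I unfolding frac_ideal_def by blast
    obtain a where a: "a \<in> ?J" "a \<noteq> 0" using frac_ideal_nonzero J by blast
    then have "a \<in> ?H" using adjoin_sub(1)[OF J(2)] by blast
    then have "?H \<noteq> {0}" using a by blast
    then have H: "frac_ideal ?H"
      unfolding frac_ideal_def using d HI add_subgroup_adjoin[OF J(2)] adjoin_mult[OF J(1)]
      by (intro conjI bexI[of _ d]) auto
    obtain I' where I': "frac_ideal I'" "iprod I I' = Oz" using frac_ideal_invertible I by blast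
    have II: "iprod (iprod I L) I' = L" if "frac_ideal L" for L
      using I' I that by (intro iprod_inverse(2))
    have "iprod ?H I' \<subseteq> Oz" using iprod_mono[OF HI order.refl] I' by metis
    then have 1: "int_ideal (iprod ?H I')"
      using H I' by (auto simp: int_ideal_def simp del: int_ideal_frac_ideal intro: frac_ideal_iprod)
    have 2: "P \<subseteq> iprod ?H I'"
      using iprod_mono[OF adjoin_sub(1)[OF J(2), of x] order.refl] II[of P] P' by auto
    have recov: "iprod I (iprod ?H I') = ?H"
      using H I I' by (intro iprod_inverse(3))
    have ne: "iprod ?H I' \<noteq> P"
    proof
      assume eq: "iprod ?H I' = P"
      have "?J = ?H" using recov unfolding eq .
      have "x \<in> ?H" by (rule adjoin_sub(2)[OF J(2)])
      then have "x \<in> ?J" by (subst \<open>?J = ?H\<close>)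
      with x(2) show False by (rule notE)
    qed
    have "iprod ?H I' = P \<or> iprod ?H I' = Oz" by (rule max_ideal_cases[OF P 1 2])
    then have "iprod ?H I' = Oz" by (rule disjE) (rule notE[OF ne], assumption+)
    with recov have "?H = iprod I Oz" by (simp only:)
    also have "\<dots> = I" by (rule iprod_Oz(1)[OF I])
    finally show ?thesis .
  qed
  \<comment> \<open>Defined through a chosen representative; the next claim shows that the choice
    has no influence.\<close>
  define f where "f c = (+) ((SOME r. r \<in> Oz \<and> c = (+) r ` P) * x) ` ?J" for c
  have f: "f ((+) r ` P) = (+) (r * x) ` ?J" if r: "r \<in> Oz" for r
  proof -
    define s where "s = (SOME s. s \<in> Oz \<and> (+) r ` P = (+) s ` P)"
    have s: "s \<in> Oz \<and> (+) r ` P = (+) s ` P" unfolding s_def by (rule someI[of _ r]) (simp add: r)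
    then have "r - s \<in> P" using coset_eq_iff[of P r s] P' by auto
    then have "(r - s) * x \<in> ?J" using key[of "r - s"] r s by auto
    then have "(+) (s * x) ` ?J = (+) (r * x) ` ?J"
      using coset_eq_iff[OF J(2), of "r * x" "s * x"] by (simp add: left_diff_distrib)
    then show ?thesis unfolding f_def s_def .
  qed
  have "bij_betw f (cosets Oz P) (cosets I ?J)"
    unfolding bij_betw_def
  proof
    show "inj_on f (cosets Oz P)"
    proof (rule inj_onI)
      fix c d assume cd: "c \<in> cosets Oz P" "d \<in> cosets Oz P" "f c = f d"
      then obtain r s where rs: "r \<in> Oz" "c = (+) r ` P" "s \<in> Oz" "d = (+) s ` P" by (auto simp: cosets_def)
      then have "(r - s) * x \<in> ?J"
        using cd(3) f coset_eq_iff[OF J(2), of "r * x" "s * x"] by (simp add: left_diff_distrib)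
      then have "r - s \<in> P" using key[of "r - s"] rs by auto
      then show "c = d" using rs coset_eq_iff[of P r s] P' by auto
    qed
    show "f ` cosets Oz P = cosets I ?J"
    proof (intro equalityI subsetI)
      fix c assume "c \<in> f ` cosets Oz P"
      then obtain r where r: "r \<in> Oz" "c = f ((+) r ` P)" by (auto simp: cosets_def)
      then show "c \<in> cosets I ?J" using f x I unfolding cosets_def by (simp add: frac_ideal_mult)
    next
      fix c assume "c \<in> cosets I ?J"
      then obtain y where y: "y \<in> I" "c = (+) y ` ?J" by (auto simp: cosets_def)
      then obtain u r where ur: "y = u + r * x" "u \<in> ?J" "r \<in> Oz"
        using full unfolding adjoin_def by blast
      then have "c = (+) (r * x) ` ?J" using y coset_eq_iff[OF J(2), of y "r * x"] by simp
      then show "c \<in> f ` cosets Oz P" using f[OF ur(3)] ur(3) unfolding cosets_def by (metis imageI)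
    qed
  qed
  then show ?thesis unfolding index_def by (simp add: bij_betw_same_card)
qed

lemma index_iprod:
  assumes "frac_ideal I" "int_ideal J"
  shows "index I (iprod I J) = index Oz J"
proof -
  obtain Ps where Ps: "\<forall>P\<in>set Ps. max_ideal P" "J = lprod Ps" using factorization assms by blast
  have "\<And>I. frac_ideal I \<Longrightarrow> index I (iprod I (lprod Ps)) = index Oz (lprod Ps)"
    using Ps(1)
  proof (induction Ps)
    case Nil
    have "cosets I I = {(+) 0 ` I}" if "add_subgroup I" for I
    proof -
      have "cosets I I = (\<lambda>x. (+) 0 ` I) ` I"
        unfolding cosets_def by (rule image_cong[OF refl]) (simp only: coset_eq_iff[OF that] diff_zero)
      then show ?thesis using add_subgroup_0[OF that] by auto
    qed
    then have "index I I = 1" if "add_subgroup I" for I unfolding index_def using that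
      by (metis card_1_singleton_iff One_nat_def)
    then show ?case using Nil iprod_Oz by (auto simp: iprod_Oz)
  next
    case (Cons P Ps)
    have P: "max_ideal P" "int_ideal P" and all: "\<forall>P\<in>set Ps. int_ideal P" using Cons.prems
      by (auto simp: max_ideal_def)
    have L: "int_ideal (lprod Ps)" using all by (rule int_ideal_lprod)
    have step: "index I (iprod I (lprod (P # Ps))) = index Oz P * index Oz (lprod Ps)"
      if I: "frac_ideal I" for I
    proof -
      have IP: "frac_ideal (iprod I P)" using I P by (auto intro: frac_ideal_iprod)
      have "iprod I (lprod (P # Ps)) = iprod (iprod I P) (lprod Ps)"
        using I P L by (simp add: iprod_assoc)
      then have "index I (iprod I (lprod (P # Ps))) = index I (iprod I P) * index (iprod I P) (iprod (iprod I P) (lprod Ps))"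
        using index_mult[OF frac_ideal_add_subgroup[OF I] frac_ideal_add_subgroup[OF IP] _ iprod_sub_left[OF IP L] iprod_sub_left[OF I P(2)]]
          frac_ideal_iprod[OF IP int_ideal_frac_ideal[OF L]] by simp
      then show ?thesis using index_iprod_max_ideal[OF I P(1)] Cons.IH[OF IP] Cons.prems by simp
    qed
    from step[OF Cons.prems(1)] step[of Oz] show ?case
      using P L iprod_Oz(2)[OF frac_ideal_iprod[of P "lprod Ps"]] by auto
  qed
  then show ?thesis using assms Ps(2) by simp
qed

lemma index_Oz_iprod:
  assumes "int_ideal I" "int_ideal J"
  shows "index Oz (iprod I J) = index Oz I * index Oz J"
proof -
  have "index Oz (iprod I J) = index Oz I * index I (iprod I J)"
    using assms by (intro index_mult iprod_sub_left int_ideal_sub add_subgroup_iprod) auto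
  then show ?thesis using index_iprod assms by auto
qed

end


section \<open>Small elements of ideals\<close>

text \<open>About an arbitrary centre m, the double sum is 2 |C| times the sum of squares minus
  twice the square of the sum. Leaving m free allows one common centre, that of the box, for all
  classes.\<close>

lemma sum_pairwise_square_le:
  fixes x :: "'a \<Rightarrow> real"
  assumes "finite C"
  shows "(\<Sum>a\<in>C. \<Sum>b\<in>C. (x a - x b)\<^sup>2) \<le> 2 * real (card C) * (\<Sum>a\<in>C. (x a - m)\<^sup>2)"
proof -
  define y where "y a = x a - m" for a
  have "(\<Sum>a\<in>C. \<Sum>b\<in>C. (x a - x b)\<^sup>2) = (\<Sum>a\<in>C. \<Sum>b\<in>C. (y a)\<^sup>2 + (y b)\<^sup>2 - 2 * (y a * y b))"
    by (intro sum.cong refl) (simp add: y_def power2_eq_square algebra_simps)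
  also have "\<dots> = (\<Sum>a\<in>C. \<Sum>b\<in>C. (y a)\<^sup>2) + (\<Sum>a\<in>C. \<Sum>b\<in>C. (y b)\<^sup>2) - (\<Sum>a\<in>C. \<Sum>b\<in>C. 2 * (y a * y b))"
    by (simp only: sum.distrib sum_subtractf)
  also have "(\<Sum>a\<in>C. \<Sum>b\<in>C. (y a)\<^sup>2) = real (card C) * (\<Sum>a\<in>C. (y a)\<^sup>2)"
    by (simp add: sum_distrib_left)
  also have "(\<Sum>a\<in>C. \<Sum>b\<in>C. (y b)\<^sup>2) = real (card C) * (\<Sum>a\<in>C. (y a)\<^sup>2)"
    by simp
  also have "(\<Sum>a\<in>C. \<Sum>b\<in>C. 2 * (y a * y b)) = 2 * ((\<Sum>a\<in>C. y a) * (\<Sum>b\<in>C. y b))"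
    unfolding sum_product by (simp only: sum_distrib_left)
  also have "real (card C) * (\<Sum>a\<in>C. (y a)\<^sup>2) + real (card C) * (\<Sum>a\<in>C. (y a)\<^sup>2) - \<dots> \<le> 2 * real (card C) * (\<Sum>a\<in>C. (y a)\<^sup>2)" by simp
  finally show ?thesis by (simp add: y_def)
qed

text \<open>The source of the constant 12: the variance of a uniform variable on Q consecutive
  integers.\<close>

lemma sum_centered_squares: "(\<Sum>i<Q. (real i - (real Q - 1) / 2)\<^sup>2) = real Q * ((real Q)\<^sup>2 - 1) / 12"
proof -
  have "(\<Sum>i<Q. (real i - a)\<^sup>2) = real Q * (real Q - 1) * (2 * real Q - 1) / 6 - a * real Q * (real Q - 1) + real Q * a\<^sup>2" for a
    by (induction Q) (simp_all add: power2_eq_square algebra_simps add_divide_distrib diff_divide_distrib)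
  from this[of "(real Q - 1) / 2"] show ?thesis
    by (simp add: power2_eq_square field_simps)
qed

lemma sum_box_centered_squares:
  fixes n Q :: nat
  shows "(\<Sum>c\<in>PiE {..<n} (\<lambda>_. {..<Q}). \<Sum>j<n. (real (c j) - (real Q - 1) / 2)\<^sup>2)
    = real n * real Q ^ n * ((real Q)\<^sup>2 - 1) / 12"
proof (induction n)
  case (Suc n)
  let ?a = "(real Q - 1) / 2"
  let ?B = "PiE {..<n} (\<lambda>_. {..<Q})"
  have bij: "bij_betw (\<lambda>(y, g). g(n := y)) ({..<Q} \<times> ?B) (PiE {..<Suc n} (\<lambda>_. {..<Q}))"
    unfolding lessThan_Suc PiE_insert_eq bij_betw_def
    by (auto intro!: inj_combinator[where x = n and S = "{..<n}", simplified])
  have "(\<Sum>c\<in>PiE {..<Suc n} (\<lambda>_. {..<Q}). \<Sum>j<Suc n. (real (c j) - ?a)\<^sup>2)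
      = (\<Sum>(y, g)\<in>{..<Q} \<times> ?B. \<Sum>j<Suc n. (real ((g(n := y)) j) - ?a)\<^sup>2)"
    by (subst sum.reindex_bij_betw[OF bij, symmetric]) (simp add: case_prod_unfold)
  also have "\<dots> = (\<Sum>(y, g)\<in>{..<Q} \<times> ?B. (\<Sum>j<n. (real (g j) - ?a)\<^sup>2) + (real y - ?a)\<^sup>2)"
    by (intro sum.cong refl) auto
  also have "\<dots> = (\<Sum>y<Q. \<Sum>g\<in>?B. (\<Sum>j<n. (real (g j) - ?a)\<^sup>2) + (real y - ?a)\<^sup>2)"
    by (simp add: sum.cartesian_product)
  also have "\<dots> = real Q * (\<Sum>g\<in>?B. \<Sum>j<n. (real (g j) - ?a)\<^sup>2) + real (card ?B) * (\<Sum>y<Q. (real y - ?a)\<^sup>2)"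
    by (simp add: sum.distrib sum_distrib_left)
  also have "card ?B = Q ^ n" by (simp add: card_PiE)
  also have "real Q * (\<Sum>g\<in>?B. \<Sum>j<n. (real (g j) - ?a)\<^sup>2) + real (Q ^ n) * (\<Sum>y<Q. (real y - ?a)\<^sup>2)
     = real (Suc n) * real Q ^ Suc n * ((real Q)\<^sup>2 - 1) / 12"
    unfolding Suc.IH sum_centered_squares by (simp add: field_simps)
  finally show ?case .
qed simp

text \<open>Blichfeldt's averaging: two points of a box in the same class are closer than the box is wide.\<close>
lemma close_pair_in_class:
  fixes n Q m :: nat and f :: "(nat \<Rightarrow> nat) \<Rightarrow> 'c"
  defines "B \<equiv> PiE {..<n} (\<lambda>_. {..<Q})"
  assumes fin: "card (f ` B) \<le> m" and Q: "m < Q ^ n" and n: "n > 0"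
  shows "\<exists>c\<in>B. \<exists>d\<in>B. c \<noteq> d \<and> f c = f d \<and>
    (\<Sum>j<n. (real (c j) - real (d j))\<^sup>2) \<le> real n * (real Q)\<^sup>2 / 6 * (real Q ^ n / (real Q ^ n - real m))"
proof (rule ccontr)
  assume neg: "\<not> ?thesis"
  define D where "D = real n * (real Q)\<^sup>2 / 6 * (real Q ^ n / (real Q ^ n - real m))"
  define d2 where "d2 c d = (\<Sum>j<n. (real (c j) - real (d j))\<^sup>2)" for c d :: "nat \<Rightarrow> nat"
  define S where "S c = (\<Sum>j<n. (real (c j) - (real Q - 1) / 2)\<^sup>2)" for c :: "nat \<Rightarrow> nat"
  have far: "D \<le> d2 c d" if "c \<in> B" "d \<in> B" "c \<noteq> d" "f c = f d" for c d
    using neg that unfolding D_def d2_def by force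
  have finB: "finite B" and cardB: "card B = Q ^ n"
    unfolding B_def by (simp_all add: finite_PiE card_PiE)
  have Qm: "real Q ^ n - real m > 0" using Q by (simp flip: of_nat_power)
  then have D0: "D \<ge> 0" unfolding D_def by (intro mult_nonneg_nonneg divide_nonneg_nonneg) auto
  \<comment> \<open>A class of k points has k (k - 1) ordered pairs at squared distance at least D,
    and its pairwise sum is at most 2 k times its spread about the centre of the box; k
    cancels.\<close>
  have cls: "(real (card {c \<in> B. f c = u}) - 1) * D \<le> 2 * (\<Sum>c | c \<in> B \<and> f c = u. S c)" if u: "u \<in> f ` B" for u
  proof -
    define C where "C = {c \<in> B. f c = u}"
    have finC: "finite C" using finB by (simp add: C_def)
    have "C \<noteq> {}" using u by (auto simp: C_def)
    then have k: "real (card C) > 0" using finC by (simp add: card_gt_0_iff)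
    have "real (card C) * ((real (card C) - 1) * D) = (\<Sum>c\<in>C. \<Sum>d\<in>C - {c}. D)"
      using finC k by (simp add: card_Diff_singleton of_nat_diff Suc_le_eq)
    also have "\<dots> \<le> (\<Sum>c\<in>C. \<Sum>d\<in>C - {c}. d2 c d)"
      by (intro sum_mono far) (auto simp: C_def)
    also have "\<dots> \<le> (\<Sum>c\<in>C. \<Sum>d\<in>C. d2 c d)"
      using finC by (intro sum_mono sum_mono2) (auto simp: d2_def intro!: sum_nonneg)
    also have "\<dots> = (\<Sum>j<n. \<Sum>c\<in>C. \<Sum>d\<in>C. (real (c j) - real (d j))\<^sup>2)"
      unfolding d2_def by (simp add: sum.swap[of _ C "{..<n}"])
    also have "\<dots> \<le> (\<Sum>j<n. 2 * real (card C) * (\<Sum>c\<in>C. (real (c j) - (real Q - 1) / 2)\<^sup>2))"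
      by (intro sum_mono sum_pairwise_square_le finC)
    also have "\<dots> = 2 * real (card C) * (\<Sum>c\<in>C. S c)"
      unfolding S_def by (simp add: sum_distrib_left sum.swap[of _ C "{..<n}"])
    finally have "real (card C) * ((real (card C) - 1) * D) \<le> real (card C) * (2 * (\<Sum>c\<in>C. S c))"
      by (simp add: mult_ac)
    then show ?thesis using k unfolding C_def[symmetric] by (simp only: mult_le_cancel_left_pos)
  qed
  \<comment> \<open>Summed over the classes, the coefficients of D add up to the number of points
    minus the number of classes, while the spreads add up to the spread of the whole box. The
    contradiction comes from Q^2 - 1 < Q^2.\<close>
  have "(real Q ^ n - real m) * D \<le> (real (card B) - real (card (f ` B))) * D"
    using fin D0 cardB by (intro mult_right_mono) auto
  also have "real (card B) = (\<Sum>u\<in>f ` B. real (card {c \<in> B. f c = u}))"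
    using sum.image_gen[OF finB, of "\<lambda>_. 1 :: real" f] by simp
  also have "((\<Sum>u\<in>f ` B. real (card {c \<in> B. f c = u})) - real (card (f ` B))) * D
      = (\<Sum>u\<in>f ` B. (real (card {c \<in> B. f c = u}) - 1) * D)"
    by (simp add: sum_subtractf sum_distrib_right[symmetric] left_diff_distrib)
  also have "\<dots> \<le> (\<Sum>u\<in>f ` B. 2 * (\<Sum>c | c \<in> B \<and> f c = u. S c))" by (intro sum_mono cls)
  also have "\<dots> = 2 * (\<Sum>c\<in>B. S c)"
    using sum.image_gen[OF finB, of S f] by (simp add: sum_distrib_left)
  also have "(\<Sum>c\<in>B. S c) = real n * real Q ^ n * ((real Q)\<^sup>2 - 1) / 12"
    unfolding S_def B_def by (rule sum_box_centered_squares)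
  finally have "(real Q ^ n - real m) * D \<le> real n * real Q ^ n * ((real Q)\<^sup>2 - 1) / 6" by simp
  moreover have "(real Q ^ n - real m) * D = real n * real Q ^ n * (real Q)\<^sup>2 / 6"
    using Qm by (simp add: D_def field_simps)
  moreover have "real n * real Q ^ n > 0" using n Q by (cases "Q = 0") (auto simp: power_0_left)
  ultimately have "real n * real Q ^ n * (real Q)\<^sup>2 \<le> real n * real Q ^ n * ((real Q)\<^sup>2 - 1)" by simp
  with \<open>real n * real Q ^ n > 0\<close> show False by (simp only: mult_le_cancel_left_pos)
qed

lemma powr_inverse_power:
  fixes y :: real
  assumes "y \<ge> 0" "m > 0"
  shows "(y powr (1 / real m)) ^ m = y"
proof (cases "y = 0")
  case False
  then have "(y powr (1 / real m)) ^ m = (y powr (1 / real m)) powr real m"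
    using assms by (intro powr_realpow[symmetric]) auto
  then show ?thesis using assms False by (simp add: powr_powr)
qed (use assms in simp)

context cyclotomic
begin

section \<open>Elements of small norm and ideal classes\<close>

definition hf :: nat where "hf = (p - 1) div 2"

lemma hf: "p - 1 = 2 * hf" "hf \<ge> 1" "p = 2 * hf + 1"
  using p_odd p_gt_2 unfolding hf_def by auto

text \<open>The arithmetic-geometric mean inequality for the p - 1 squared absolute values of the
  conjugates. Their product is the square of the norm, whence the exponent \<open>hf\<close> instead
  of p - 1.\<close>

lemma Nm_le_coords:
  assumes "x = (\<Sum>j<p - 1. of_int (c j) * \<zeta> ^ j)"
  shows "cmod (Nm x) \<le> (real p * (\<Sum>j<p - 1. (of_int (c j))\<^sup>2) / real (p - 1)) ^ hf"
proof -
  let ?S = "{1..<p}" and ?n = "p - 1"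
  let ?T = "\<Sum>k\<in>?S. (cmod (sig k x))\<^sup>2"
  have card: "card ?S = ?n" by simp
  let ?P = "\<Prod>k\<in>?S. (cmod (sig k x))\<^sup>2"
  let ?A = "real p * (\<Sum>j<?n. (of_int (c j))\<^sup>2) / real ?n"
  have n: "real ?n > 0" using p_gt_2 by simp
  have P0: "?P \<ge> 0" by (intro prod_nonneg) auto
  have A0: "?A \<ge> 0" by (intro divide_nonneg_nonneg mult_nonneg_nonneg sum_nonneg) auto
  have "?P powr (1 / real ?n) \<le> (\<Sum>k\<in>?S. (cmod (sig k x))\<^sup>2 / real ?n)"
    using arith_geom_mean[of ?S "\<lambda>k. (cmod (sig k x))\<^sup>2"] p_gt_2 unfolding card by auto
  also have "\<dots> = ?T / real ?n" by (simp only: sum_divide_distrib)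
  also have "\<dots> \<le> ?A"
    unfolding assms by (intro divide_right_mono sum_conjugates_square_le) auto
  finally have "(?P powr (1 / real ?n)) ^ ?n \<le> ?A ^ ?n"
    by (intro power_mono) auto
  also have "(?P powr (1 / real ?n)) ^ ?n = ?P"
    using P0 p_gt_2 by (intro powr_inverse_power) auto
  also have "?P = (cmod (Nm x))\<^sup>2"
    by (simp only: Nm_def prod_norm[symmetric] prod_power_distrib)
  also have "?A ^ ?n = (?A ^ hf)\<^sup>2" by (metis hf(1) mult.commute power_mult)
  finally show ?thesis by (rule power2_le_imp_le[OF _ zero_le_power[OF A0]])
qed

lemma small_element_box:
  fixes Q :: nat
  assumes I: "int_ideal I" and Q: "index Oz I < Q ^ (p - 1)"
  shows "\<exists>b\<in>I. b \<noteq> 0 \<and> cmod (Nm b) \<le>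
    (real p / 6 * (real Q)\<^sup>2 * (real Q ^ (p - 1) / (real Q ^ (p - 1) - real (index Oz I)))) ^ hf"
proof -
  let ?n = "p - 1"
  define g where "g c = (\<Sum>j<?n. of_int (int (c j)) * \<zeta> ^ j)" for c :: "nat \<Rightarrow> nat"
  define f where "f c = (+) (g c) ` I" for c
  let ?B = "PiE {..<?n} (\<lambda>_. {..<Q})"
  have g_Oz: "g c \<in> Oz" for c unfolding g_def by (intro Oz_sum Oz_closed) auto
  have "card (f ` ?B) \<le> index Oz I"
    unfolding index_def by (intro card_mono int_ideal_finite I) (auto simp: f_def cosets_def g_Oz)
  from close_pair_in_class[OF this Q] p_gt_2 obtain c d where cd: "c \<in> ?B" "d \<in> ?B" "c \<noteq> d" "f c = f d"
    "(\<Sum>j<?n. (real (c j) - real (d j))\<^sup>2) \<le>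
      real ?n * (real Q)\<^sup>2 / 6 * (real Q ^ ?n / (real Q ^ ?n - real (index Oz I)))" (is "_ \<le> ?R") by auto
  define b where "b = g c - g d"
  have "add_subgroup I" using I by auto
  then have bI: "b \<in> I" using cd(4) coset_eq_iff unfolding f_def b_def by blast
  have b0: "b \<noteq> 0"
  proof
    assume "b = 0"
    then have eq: "(\<Sum>j<?n. of_int (int (c j)) * \<zeta> ^ j) = (\<Sum>j<?n. of_int (int (d j)) * \<zeta> ^ j)"
      by (simp add: b_def g_def)
    have "c j = d j" if "j \<in> {..<?n}" for j using sum_zeta_eq[OF eq, of j] that by simp
    then have "c = d" by (rule PiE_ext[OF cd(1,2)])
    with cd(3) show False by simp
  qed
  have "b = (\<Sum>j<?n. of_int (int (c j) - int (d j)) * \<zeta> ^ j)"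
    by (simp add: b_def g_def sum_subtractf left_diff_distrib)
  from Nm_le_coords[OF this] have "cmod (Nm b) \<le> (real p * (\<Sum>j<?n. (real (c j) - real (d j))\<^sup>2) / real ?n) ^ hf"
    by simp
  also have "\<dots> \<le> (real p * ?R / real ?n) ^ hf"
    using cd(5)
      by (intro power_mono divide_right_mono mult_left_mono divide_nonneg_nonneg mult_nonneg_nonneg sum_nonneg) auto
  also have "real p * ?R / real ?n = real p / 6 * (real Q)\<^sup>2 * (real Q ^ ?n / (real Q ^ ?n - real (index Oz I)))"
    using p_gt_2 by simp
  finally show ?thesis using bI b0 by blast
qed

text \<open>The factor \<open>(p / 6) ^ hf\<close> is the averaging bound. Taking
  \<open>hf + 1\<close> times as many points as classes contributes \<open>hf + 1\<close> itself and
  (1 + 1/hf)^hf \<le> e; rounding the side of the box up to an integer contributes e^(1/4).\<close>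

definition Mb :: real where "Mb = exp (5/4) * real (hf + 1) * (real p / 6) ^ hf"

text \<open>The side Q has to be an integer with Q^(p-1) just above a prescribed number, and for
  ideals of small index rounding up would be costly. So I is first replaced by t I, which forces Q >
  t; the factor t^(p-1) is divided out again at the end.\<close>

lemma small_element:
  assumes I: "int_ideal I"
  shows "\<exists>b\<in>I. b \<noteq> 0 \<and> cmod (Nm b) \<le> Mb * real (index Oz I)"
proof -
  let ?n = "p - 1" and ?m = "index Oz I"
  have m: "?m > 0" using int_ideal_finite[OF I] by (intro index_pos) auto
  have n: "?n > 0" using p_gt_2 by simp
  \<comment> \<open>Chosen such that the rounding loss (1 + 1/t)^(p-1) is at most e^(1/4).\<close>
  define t where "t = 4 * ?n"
  have t: "t > 0" using n by (simp add: t_def)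
  let ?tI = "scale (of_nat t) I"
  have tI: "int_ideal ?tI"
  proof -
    have "frac_ideal ?tI" using I t by (intro frac_ideal_scale Oz_Kz) auto
    moreover have "?tI \<subseteq> Oz" using int_ideal_sub[OF I] by (auto simp: scale_def)
    ultimately show ?thesis by (simp add: int_ideal_def)
  qed
  have m': "index Oz ?tI = t ^ ?n * ?m"
  proof -
    have "index Oz ?tI = index Oz (scale (of_nat t) Oz) * index (scale (of_nat t) Oz) ?tI"
      using int_ideal_sub[OF I] I by (intro index_mult add_subgroup_scale scale_mono) (auto simp: scale_def)
    also have "index (scale (of_nat t) Oz) ?tI = ?m"
      using t I int_ideal_sub[OF I] by (intro index_scale) auto
    finally show ?thesis using index_nat_multiple[OF t] by simp
  qed
  \<comment> \<open>With \<open>hf + 1\<close> times as many points as classes, the quotient Q^n /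
    (Q^n - M) in the averaging bound is at most 1 + 1/hf, and its power \<open>hf\<close> at most
    e.\<close>
  define K where "K = (hf + 1) * (t ^ ?n * ?m)"
  define Q where "Q = (LEAST Q. K \<le> Q ^ ?n)"
  have K0: "K > 0" using t m by (simp add: K_def)
  have "\<exists>Q. K \<le> Q ^ ?n" using n K0 self_le_power[of K ?n] by (intro exI[of _ K]) simp
  then have Q1: "K \<le> Q ^ ?n" unfolding Q_def by (rule LeastI_ex)
  have "2 * 1 \<le> (hf + 1) * ?m" using hf(2) m by (intro mult_le_mono) auto
  then have "t ^ ?n * 1 < t ^ ?n * ((hf + 1) * ?m)" using t by (intro mult_strict_left_mono) auto
  then have tK: "t ^ ?n < K" by (simp only: K_def mult_ac mult_1_right)
  have "t < Q"
  proof (rule ccontr)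
    assume "\<not> t < Q"
    then have "Q ^ ?n \<le> t ^ ?n" by (intro power_mono) auto
    with tK Q1 show False by simp
  qed
  then have "\<not> K \<le> (Q - 1) ^ ?n"
    using not_less_Least[of "Q - 1" "\<lambda>Q. K \<le> Q ^ ?n"] unfolding Q_def[symmetric] by simp
  then have Q2: "real (Q - 1) ^ ?n \<le> real K" by (simp flip: of_nat_power)
  have Q2': "real Q ^ ?n \<le> exp (1/4) * real K"
  proof -
    have "real Q \<le> (1 + 1 / real t) * real (Q - 1)"
      using \<open>t < Q\<close> t by (simp add: field_simps of_nat_diff)
    then have "real Q ^ ?n \<le> ((1 + 1 / real t) * real (Q - 1)) ^ ?n" by (intro power_mono) auto
    also have "\<dots> = (1 + 1 / real t) ^ ?n * real (Q - 1) ^ ?n" by (simp add: power_mult_distrib)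
    also have "\<dots> \<le> exp (1/4) * real K"
    proof (intro mult_mono Q2)
      have "(1 + 1 / real t) ^ ?n \<le> exp (1 / real t) ^ ?n"
        using t by (intro power_mono exp_ge_add_one_self add_nonneg_nonneg) auto
      also have "\<dots> = exp (real ?n * (1 / real t))" by (simp only: exp_of_nat_mult)
      also have "real ?n * (1 / real t) = 1/4" using n by (simp add: t_def)
      finally show "(1 + 1 / real t) ^ ?n \<le> exp (1/4)" .
    qed auto
    finally show ?thesis .
  qed
  let ?M = "t ^ ?n * ?m"
  have M0: "?M > 0" using t m by simp
  have KM: "real K = real (hf + 1) * real ?M" by (simp only: K_def of_nat_mult)
  have QM: "real (hf + 1) * real ?M \<le> real Q ^ ?n" unfolding KM[symmetric] using Q1
    by (simp flip: of_nat_power)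
  have "?M < (hf + 1) * ?M" using M0 hf(2) by (intro n_less_m_mult_n) auto
  also have "\<dots> \<le> Q ^ ?n" using Q1 by (simp only: K_def)
  finally have "?M < Q ^ ?n" .
  from small_element_box[OF tI, unfolded m', OF this] obtain b where b: "b \<in> ?tI" "b \<noteq> 0"
    "cmod (Nm b) \<le> (real p / 6 * (real Q)\<^sup>2 * (real Q ^ ?n / (real Q ^ ?n - real ?M))) ^ hf" by auto
  have pos: "real Q ^ ?n - real ?M > 0"
  proof -
    have "real ?M < real (Q ^ ?n)" using \<open>?M < Q ^ ?n\<close> by (simp only: of_nat_less_iff)
    then show ?thesis by (simp only: of_nat_power)
  qed
  have frac: "real Q ^ ?n / (real Q ^ ?n - real ?M) \<le> 1 + 1 / real hf"
  proof -
    have h: "real hf > 0" using hf(2) by simp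
    have "real hf * real Q ^ ?n \<le> (real hf + 1) * (real Q ^ ?n - real ?M)"
      using QM by (simp add: algebra_simps)
    then have "real Q ^ ?n \<le> (real hf + 1) / real hf * (real Q ^ ?n - real ?M)"
      using h by (simp add: field_simps)
    then have "real Q ^ ?n / (real Q ^ ?n - real ?M) \<le> (real hf + 1) / real hf"
      using pos by (simp only: pos_divide_le_eq)
    then show ?thesis using h by (simp add: add_divide_distrib)
  qed
  obtain b' where b': "b' \<in> I" "b = of_nat t * b'" using b(1) by (auto simp: scale_def)
  have b'O: "b' \<in> Oz" using b' int_ideal_sub[OF I] by blast
  have "Nm b = Nm (of_nat t) * Nm b'" unfolding b' using b'O by (intro Nm_mult) auto
  also have "Nm (of_nat t) = of_nat t ^ ?n"
  proof -
    have "sig k (of_nat t) = of_nat t" if "k \<in> {1..<p}" for k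
      using sig_of_int[OF not_dvd_range[OF that], of "int t"] by simp
    then show ?thesis by (simp add: Nm_def)
  qed
  finally have Nb: "cmod (Nm b) = real t ^ ?n * cmod (Nm b')" by (simp add: norm_mult norm_power)
  have "cmod (Nm b) \<le> (real p / 6 * (real Q)\<^sup>2 * (1 + 1 / real hf)) ^ hf"
  proof -
    have c0: "0 \<le> real p / 6 * (real Q)\<^sup>2" by simp
    have "0 \<le> real Q ^ ?n / (real Q ^ ?n - real ?M)" using pos by (intro divide_nonneg_pos) auto
    from power_mono[OF mult_left_mono[OF frac c0] mult_nonneg_nonneg[OF c0 this]] show ?thesis
      using b(3) by (rule order.trans[rotated])
  qed
  also have "\<dots> = (real p / 6) ^ hf * real Q ^ ?n * (1 + 1 / real hf) ^ hf"
    by (simp only: power_mult_distrib hf(1) power_mult)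
  also have "\<dots> \<le> (real p / 6) ^ hf * (exp (1/4) * real K) * exp 1"
  proof (intro mult_mono order.refl Q2')
    have "(1 + 1 / real hf) ^ hf \<le> exp (1 / real hf) ^ hf"
      by (intro power_mono exp_ge_add_one_self add_nonneg_nonneg) auto
    also have "\<dots> = exp (real hf * (1 / real hf))" by (simp only: exp_of_nat_mult)
    also have "real hf * (1 / real hf) = 1" using hf(2) by simp
    finally show "(1 + 1 / real hf) ^ hf \<le> exp 1" .
  qed auto
  also have "\<dots> = real t ^ ?n * (Mb * real ?m)"
  proof -
    have "exp (5/4) = exp (1/4) * exp (1::real)" by (simp flip: exp_add)
    then show ?thesis by (simp add: Mb_def KM mult_ac)
  qed
  finally have "real t ^ ?n * cmod (Nm b') \<le> real t ^ ?n * (Mb * real ?m)" by (simp only: Nb)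
  then have "cmod (Nm b') \<le> Mb * real ?m" using t by simp
  moreover have "b' \<noteq> 0" using b(2) b' by auto
  ultimately show ?thesis using b' by blast
qed

text \<open>A small element b is taken in an integral multiple I = d A' of the inverse A' of A. Then
  J = (b / d) A is integral with I J = (b), and the norm of I cancels from the bound.\<close>

lemma small_class_representative:
  assumes A: "frac_ideal A"
  shows "\<exists>J x. int_ideal J \<and> real (index Oz J) \<le> Mb \<and> x \<in> Kz \<and> x \<noteq> 0 \<and> A = scale x J"
proof -
  obtain A' where A': "frac_ideal A'" "iprod A A' = Oz" using frac_ideal_invertible[OF A] .
  obtain d where d: "d \<in> Oz" "d \<noteq> 0" "int_ideal (scale d A')" using frac_ideal_scale_int_ideal[OF A'(1)] .
  let ?I = "scale d A'"
  obtain b where b: "b \<in> ?I" "b \<noteq> 0" "cmod (Nm b) \<le> Mb * real (index Oz ?I)"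
    using small_element[OF d(3)] by (elim bexE conjE) (rule that)
  have bO: "b \<in> Oz" using b(1) int_ideal_sub[OF d(3)] by blast
  let ?J = "scale (b / d) A"
  have bd: "b / d \<in> A'" using b(1) d(2) by (simp add: mem_scale_iff)
  have bK: "b / d \<in> Kz" "d / b \<in> Kz" using bO d by auto
  have "?J \<subseteq> Oz"
  proof
    fix x assume "x \<in> ?J"
    then obtain a where "a \<in> A" "x = b / d * a" by (auto simp: scale_def)
    then have "x \<in> iprod A A'" using bd iprod.iprod_mult[of a A "b / d" A'] by (simp add: mult.commute)
    then show "x \<in> Oz" using A' by simp
  qed
  moreover have "frac_ideal ?J" using A bK b d by (intro frac_ideal_scale) auto
  ultimately have J: "int_ideal ?J" by (simp add: int_ideal_def)
  have "iprod ?I ?J = scale d (iprod A' ?J)" by (rule iprod_scale)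
  also have "iprod A' ?J = scale (b / d) (iprod A A')" by (metis iprod_commute iprod_scale)
  also have "scale d (scale (b / d) (iprod A A')) = scale b Oz" using A' d by (simp add: scale_scale)
  finally have "index Oz (scale b Oz) = index Oz ?I * index Oz ?J" using index_Oz_iprod[OF d(3) J] by simp
  then have "real (index Oz ?I) * real (index Oz ?J) \<le> real (index Oz ?I) * Mb"
    using b index_principal[OF bO b(2)] by (simp add: mult.commute)
  moreover have "0 < index Oz ?I" using int_ideal_finite[OF d(3)] by (intro index_pos) auto
  ultimately have "real (index Oz ?J) \<le> Mb" by simp
  moreover have "A = scale (d / b) ?J" using b d by (simp add: scale_scale)
  ultimately show ?thesis using J bK b d by (intro exI[of _ ?J] exI[of _ "d / b"]) auto
qed

end


section \<open>Counting ideals of bounded norm\<close>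

context cyclotomic
begin

section \<open>Norms of prime ideals\<close>

text \<open>Translation by 1 permutes the cosets, so the representatives have the same sum before
  and after; comparing term by term modulo I leaves one 1 for every coset.\<close>

lemma index_mem:
  assumes I: "int_ideal I"
  shows "of_nat (index Oz I) \<in> I"
proof -
  have aI: "add_subgroup I" using I by simp
  define r where "r c = (SOME x. x \<in> Oz \<and> c = (+) x ` I)" for c
  have r: "r c \<in> Oz \<and> c = (+) (r c) ` I" if "c \<in> cosets Oz I" for c
    unfolding r_def by (rule someI_ex) (use that in \<open>auto simp: cosets_def\<close>)
  define s where "s c = (+) (r c + 1) ` I" for c
  have s_mem: "s c \<in> cosets Oz I" if "c \<in> cosets Oz I" for c
    using r[OF that] unfolding s_def cosets_def by (intro imageI) auto
  have "inj_on s (cosets Oz I)"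
  proof (rule inj_onI)
    fix c d assume cd: "c \<in> cosets Oz I" "d \<in> cosets Oz I" "s c = s d"
    then have "r c - r d \<in> I" by (simp add: s_def coset_eq_iff[OF aI])
    then show "c = d" using r[OF cd(1)] r[OF cd(2)] coset_eq_iff[OF aI] by metis
  qed
  then have "bij_betw s (cosets Oz I) (cosets Oz I)"
    using endo_inj_surj[of "cosets Oz I" s] int_ideal_finite[OF I] s_mem by (auto simp: bij_betw_def)
  then have "(\<Sum>c\<in>cosets Oz I. r (s c)) = (\<Sum>c\<in>cosets Oz I. r c)" by (rule sum.reindex_bij_betw)
  then have "of_nat (index Oz I) = (\<Sum>c\<in>cosets Oz I. (r c + 1) - r (s c))"
    by (simp add: sum_subtractf sum.distrib index_def)
  also have "\<dots> \<in> I"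
  proof (rule add_subgroup_sum[OF aI])
    fix c assume "c \<in> cosets Oz I"
    then have "s c = (+) (r (s c)) ` I" using r s_mem by blast
    then show "r c + 1 - r (s c) \<in> I" unfolding s_def[of c] by (simp only: coset_eq_iff[OF aI])
  qed
  finally show ?thesis .
qed

lemma max_ideal_norm_ge_2: "max_ideal P \<Longrightarrow> index Oz P \<ge> 2"
proof -
  assume "max_ideal P"
  then have P: "int_ideal P" "P \<noteq> Oz" by (simp_all add: max_ideal_def)
  have "index Oz P > 0" using int_ideal_finite P by (intro index_pos) auto
  moreover have "index Oz P \<noteq> 1" using index_eq_1[of Oz P] P int_ideal_sub by auto
  ultimately show ?thesis by simp
qed

lemma index_lprod: "\<forall>P\<in>set Ps. max_ideal P \<Longrightarrow> index Oz (lprod Ps) = (\<Prod>P\<leftarrow>Ps. index Oz P)"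
proof (induction Ps)
  case Nil
  have "index Oz Oz = index Oz Oz * index Oz Oz"
    using index_Oz_iprod[OF int_ideal_Oz int_ideal_Oz]
      unfolding iprod_Oz(1)[OF int_ideal_frac_ideal[OF int_ideal_Oz]] .
  then have "index Oz Oz * index Oz Oz = index Oz Oz * 1" by (simp only: mult_1_right)
  moreover have "index Oz Oz > 0" using int_ideal_finite[of Oz] by (intro index_pos) auto
  ultimately have "index Oz Oz = 1" by (simp only: nat_mult_eq_cancel1)
  then show ?case by simp
next
  case (Cons P Ps)
  then have "int_ideal P" "int_ideal (lprod Ps)" by (auto simp: max_ideal_def intro!: int_ideal_lprod)
  then show ?case using Cons by (simp add: index_Oz_iprod)
qed

text \<open>Distinct maximal ideals above I can be split off one by one: P contains I but not the
  product of the others, so by primality it contains the remaining cofactor J, and J can be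
  multiplied by the inverse of P.\<close>

lemma sub_all_primes:
  assumes "int_ideal I"
  shows "distinct Ps \<Longrightarrow> \<forall>P\<in>set Ps. max_ideal P \<and> I \<subseteq> P \<Longrightarrow> \<exists>J. int_ideal J \<and> I = iprod (lprod Ps) J"
proof (induction Ps)
  case Nil
  then show ?case using assms iprod_Oz(2)[of I] by auto
next
  case (Cons P Ps)
  then obtain J where J: "int_ideal J" "I = iprod (lprod Ps) J" by auto
  have P: "max_ideal P" "int_ideal P" "I \<subseteq> P" using Cons.prems by (auto simp: max_ideal_def)
  have L: "int_ideal (lprod Ps)" using Cons.prems by (intro int_ideal_lprod) (auto simp: max_ideal_def)
  have "\<not> lprod Ps \<subseteq> P" using lprod_sub_prime[OF P(1), of Ps] Cons.prems by auto
  then have JP: "J \<subseteq> P" using iprod_sub_prime[OF P(1) L J(1)] P(3) J(2) by auto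
  have fP: "frac_ideal (inv_id P)" by (rule frac_ideal_inv_id[OF P(2)])
  let ?J = "iprod J (inv_id P)"
  have "?J \<subseteq> Oz" using iprod_mono[OF JP order.refl] max_ideal_invertible[OF P(1)] by auto
  then have 1: "int_ideal ?J" using frac_ideal_iprod[of J "inv_id P"] fP J(1) by (simp add: int_ideal_def)
  have "iprod P ?J = J" using iprod_inverse(3)[of P "inv_id P" J] P J fP max_ideal_invertible[OF P(1)] by simp
  then have "I = iprod (lprod Ps) (iprod P ?J)" using J by simp
  also have "\<dots> = iprod (iprod (lprod Ps) P) ?J" using P L 1 by (intro iprod_assoc[symmetric]) auto
  also have "iprod (lprod Ps) P = iprod P (lprod Ps)" by (rule iprod_commute)
  finally show ?case using 1 by auto
qed

text \<open>Every prime ideal of norm N contains N, so the product of any finite set of them divides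
  (N), an ideal of norm N^(p-1).\<close>

lemma card_max_ideal_norm:
  "finite {P. max_ideal P \<and> index Oz P = N} \<and> card {P. max_ideal P \<and> index Oz P = N} \<le> p - 1"
proof (rule finite_if_finite_subsets_card_bdd)
  fix G assume G: "G \<subseteq> {P. max_ideal P \<and> index Oz P = N}" "finite G"
  show "card G \<le> p - 1"
  proof (cases "G = {}")
    case False
    then obtain P where "max_ideal P" "index Oz P = N" using G by auto
    then have N: "N \<ge> 2" using max_ideal_norm_ge_2 by blast
    obtain Ps where Ps: "set Ps = G" "distinct Ps" using finite_distinct_list[OF G(2)] by blast
    let ?I = "scale (of_nat N) Oz"
    have I: "int_ideal ?I" using N by (intro int_ideal_principal) auto
    have "?I \<subseteq> P" if "P \<in> G" for P
    proof
      fix x assume "x \<in> ?I"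
      then obtain y where y: "y \<in> Oz" "x = y * of_nat N" by (auto simp: scale_def mult.commute)
      have P: "max_ideal P" "index Oz P = N" using G that by auto
      then have "of_nat N \<in> P" using index_mem[of P] by (auto simp: max_ideal_def)
      then show "x \<in> P" using y P by (simp add: max_ideal_def frac_ideal_mult)
    qed
    then obtain J where J: "int_ideal J" "?I = iprod (lprod Ps) J"
      using sub_all_primes[OF I Ps(2)] G Ps(1) by blast
    have all: "\<forall>P\<in>set Ps. max_ideal P" using G Ps by auto
    then have L: "int_ideal (lprod Ps)" by (intro int_ideal_lprod) (auto simp: max_ideal_def)
    have "map (index Oz) Ps = map (\<lambda>_. N) Ps" using G Ps by (intro map_cong) auto
    then have "index Oz (lprod Ps) = N ^ length Ps"
      using index_lprod[OF all] by (simp add: map_replicate_const prod_list_replicate)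
    moreover have "N ^ (p - 1) = index Oz (lprod Ps) * index Oz J"
      using index_nat_multiple[of N] index_Oz_iprod[OF L J(1)] J(2) N by simp
    moreover have "index Oz J > 0" using int_ideal_finite[OF J(1)] J(1) by (intro index_pos) auto
    ultimately have "N ^ length Ps \<le> N ^ (p - 1)" by simp
    then have "length Ps \<le> p - 1" using N by (simp add: power_le_imp_le_exp)
    then show ?thesis using Ps distinct_card by metis
  qed simp
qed

lemma one_minus_zeta_power: "\<exists>y\<in>Oz. 1 - \<zeta> ^ j = lam * y"
proof
  show "1 - \<zeta> ^ j = lam * (\<Sum>i<j. \<zeta> ^ i)" by (simp add: lam_def one_diff_power_eq)
  show "(\<Sum>i<j. \<zeta> ^ i) \<in> Oz" by auto
qed

text \<open>\<zeta> is congruent to 1 modulo \<open>lam\<close>, so the sum of the coordinates is an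
  integer residue.\<close>

lemma lam_residue:
  assumes "x \<in> Oz"
  shows "\<exists>s::int. x - of_int s \<in> scale lam Oz"
proof -
  obtain c where c: "x = (\<Sum>j<p - 1. of_int (c j) * \<zeta> ^ j)" using Oz_coords[OF assms] .
  have "x - of_int (\<Sum>j<p - 1. c j) = (\<Sum>j<p - 1. of_int (c j) * (\<zeta> ^ j - 1))"
    by (simp add: c sum_subtractf right_diff_distrib)
  also have "\<dots> \<in> scale lam Oz"
  proof (rule add_subgroup_sum)
    show "add_subgroup (scale lam Oz)" by (intro add_subgroup_scale) auto
    fix j
    obtain y where y: "y \<in> Oz" "1 - \<zeta> ^ j = lam * y" using one_minus_zeta_power by blast
    have "of_int (c j) * (\<zeta> ^ j - 1) = - of_int (c j) * (1 - \<zeta> ^ j)" by (simp add: algebra_simps)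
    also have "\<dots> = lam * (- of_int (c j) * y)" unfolding y by simp
    finally have eq: "of_int (c j) * (\<zeta> ^ j - 1) = lam * (- of_int (c j) * y)" .
    have "- of_int (c j) * y \<in> Oz" using y by auto
    then show "of_int (c j) * (\<zeta> ^ j - 1) \<in> scale lam Oz" unfolding eq scale_def by (rule imageI)
  qed
  finally show ?thesis by blast
qed

lemma of_int_in_lam_iff: "of_int s \<in> scale lam Oz \<longleftrightarrow> int p dvd s"
proof
  assume "of_int s \<in> scale lam Oz"
  then obtain y where "y \<in> Oz" "of_int s = lam * y" by (auto simp: scale_def)
  then have "pdvd lam (of_int s)" unfolding pdvd_def using algebraic_int_Oz by blast
  then show "int p dvd s" by (rule lam_dvd_int)
next
  assume "int p dvd s"
  then obtain k where k: "s = int p * k" by blast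
  have "1 \<le> p - 1" using p_gt_2 by simp
  from lam_power_dvd_p[OF this] obtain t where t: "t \<in> Oz" "of_nat p = lam ^ 1 * t" by blast
  then have "of_int s = lam * (t * of_int k)" by (simp add: k)
  moreover have "t * of_int k \<in> Oz" using t by auto
  ultimately show "of_int s \<in> scale lam Oz" by (auto simp: scale_def)
qed

lemma int_ideal_lam: "int_ideal (scale lam Oz)"
  by (intro int_ideal_principal) auto

lemma max_ideal_lam: "max_ideal (scale lam Oz)"
  unfolding max_ideal_def
proof (intro conjI allI impI)
  show "int_ideal (scale lam Oz)" by (rule int_ideal_lam)
  show "scale lam Oz \<noteq> Oz"
  proof
    assume "scale lam Oz = Oz"
    then have "of_int 1 \<in> scale lam Oz" by simp
    then show False using of_int_in_lam_iff[of 1] p_gt_2 by (auto dest: zdvd_imp_le)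
  qed
  fix J assume J: "int_ideal J \<and> scale lam Oz \<subseteq> J"
  show "J = scale lam Oz \<or> J = Oz"
  proof (cases "J \<subseteq> scale lam Oz")
    case False
    then obtain x where x: "x \<in> J" "x \<notin> scale lam Oz" by blast
    then have "x \<in> Oz" using J int_ideal_sub by blast
    then obtain s where s: "x - of_int s \<in> scale lam Oz" using lam_residue by blast
    have aL: "add_subgroup (scale lam Oz)" by (intro add_subgroup_scale) auto
    have aJ: "add_subgroup J" using J by simp
    have "\<not> int p dvd s"
    proof
      assume "int p dvd s"
      then have "x - of_int s + of_int s \<in> scale lam Oz"
        using s of_int_in_lam_iff by (intro add_subgroup_add[OF aL]) auto
      then show False using x by simp
    qed
    then have "coprime (int p) s" using prime_p by (simp add: prime_imp_coprime)
    then obtain u v where uv: "u * int p + v * s = 1" by (metis bezout_int coprime_iff_gcd_eq_1)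
    have "x - (x - of_int s) \<in> J" using s x J by (intro add_subgroup_diff[OF aJ, of x "x - of_int s"]) auto
    then have "of_int s \<in> J" by simp
    moreover have "of_int (int p) \<in> J" using of_int_in_lam_iff[of "int p"] J by auto
    ultimately have "of_int u * of_int (int p) + of_int v * of_int s \<in> J"
      using J by (intro add_subgroup_add[OF aJ] frac_ideal_mult) auto
    also have "of_int u * of_int (int p) + of_int v * of_int s = of_int (u * int p + v * s)" by simp
    finally have "1 \<in> J" by (simp only: uv) simp
    then show ?thesis using J int_ideal_eq_Oz by blast
  qed (use J in auto)
qed

lemma index_lam: "index Oz (scale lam Oz) = p"
proof -
  let ?L = "scale lam Oz"
  have aL: "add_subgroup ?L" by (intro add_subgroup_scale) auto
  have "bij_betw (\<lambda>i::nat. (+) (of_int (int i)) ` ?L) {..<p} (cosets Oz ?L)"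
    unfolding bij_betw_def
  proof
    show "inj_on (\<lambda>i::nat. (+) (of_int (int i)) ` ?L) {..<p}"
    proof (rule inj_onI)
      fix i j assume ij: "i \<in> {..<p}" "j \<in> {..<p}" "(+) (of_int (int i)) ` ?L = (+) (of_int (int j)) ` ?L"
      then have "of_int (int i - int j) \<in> ?L" by (simp only: coset_eq_iff[OF aL] of_int_diff)
      then have "int p dvd int i - int j" by (simp only: of_int_in_lam_iff)
      then have "int i mod int p = int j mod int p" by (simp add: mod_eq_dvd_iff)
      then show "i = j" using ij by simp
    qed
    show "(\<lambda>i::nat. (+) (of_int (int i)) ` ?L) ` {..<p} = cosets Oz ?L"
    proof (intro equalityI subsetI)
      fix c assume "c \<in> cosets Oz ?L"
      then obtain x where x: "x \<in> Oz" "c = (+) x ` ?L" by (auto simp: cosets_def)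
      obtain s where s: "x - of_int s \<in> ?L" using lam_residue[OF x(1)] by blast
      define i where "i = nat (s mod int p)"
      have i: "int i = s mod int p" "i < p" using p_gt_2 by (auto simp: i_def nat_less_iff)
      have "int p dvd s - int i" by (simp add: i minus_mod_eq_mult_div)
      then have "of_int (s - int i) \<in> ?L" by (simp only: of_int_in_lam_iff)
      then have "x - of_int s + of_int (s - int i) \<in> ?L" using s by (intro add_subgroup_add[OF aL])
      then have "c = (+) (of_int (int i)) ` ?L" using x by (simp add: coset_eq_iff[OF aL])
      then show "c \<in> (\<lambda>i::nat. (+) (of_int (int i)) ` ?L) ` {..<p}" using i by blast
    qed (auto simp: cosets_def)
  qed
  then show ?thesis unfolding index_def by (simp add: bij_betw_same_card[symmetric])
qed

text \<open>Multiplication by \<open>\<zeta>\<close> splits the nonzero residues modulo \<open>P\<close> into orbits of length \<open>p\<close>.\<close>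
lemma max_ideal_norm_cases:
  assumes P: "max_ideal P"
  shows "P = scale lam Oz \<or> (\<exists>k\<ge>1. index Oz P = k * p + 1)"
proof (cases "lam \<in> P")
  case True
  have iP: "int_ideal P" using P by (simp add: max_ideal_def)
  then have "scale lam Oz \<subseteq> P" using True frac_ideal_mult[of P _ lam] by (auto simp: scale_def mult.commute)
  then have "P = scale lam Oz \<or> P = Oz" using max_ideal_cases[OF max_ideal_lam iP] by blast
  then show ?thesis using P by (auto simp: max_ideal_def)
next
  case False
  have iP: "int_ideal P" and aP: "add_subgroup P" using P by (simp_all add: max_ideal_def)
  define cl where "cl x = (+) x ` P" for x
  have cl_eq: "cl x = cl y \<longleftrightarrow> x - y \<in> P" for x y unfolding cl_def by (rule coset_eq_iff[OF aP])
  define T where "T = cosets Oz P - {cl 0}"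
  have cosets: "cosets Oz P = cl ` Oz" by (simp add: cosets_def cl_def)
  have finT: "finite T" using int_ideal_finite[OF iP] by (simp add: T_def)
  define orb where "orb x = range (\<lambda>i. cl (\<zeta> ^ i * x))" for x
  have unit: "x \<in> P" if "\<zeta> ^ i * x \<in> P" for i x
  proof -
    have "\<zeta> ^ ((p - 1) * i) * (\<zeta> ^ i * x) \<in> P" using that iP
      by (intro frac_ideal_mult[of P _ "\<zeta> ^ i * x"]) auto
    also have "\<zeta> ^ ((p - 1) * i) * (\<zeta> ^ i * x) = \<zeta> ^ ((p - 1) * i + i) * x" by (simp add: power_add)
    also have "(p - 1) * i + i = p * i" by (simp add: diff_mult_distrib)
    also have "\<zeta> ^ (p * i) = 1" by (simp add: zeta_eq_1_iff)
    finally show ?thesis by simp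
  qed
  \<comment> \<open>Multiplication by 1 - \<zeta>^k is injective modulo P: 1 - \<zeta>^k divides
    \<open>lam\<close>, which lies outside the prime ideal P.\<close>
  have key: "x \<in> P" if x: "x \<in> Oz" "(1 - \<zeta> ^ k) * x \<in> P" "\<not> p dvd k" for x k
  proof -
    obtain l where l: "\<not> p dvd l" "k * l mod p = 1" using ex_inverse_mod[OF x(3)] .
    have "lam = 1 - (\<zeta> ^ k) ^ l" using zeta_mod[of "k * l"] l by (simp add: lam_def power_mult)
    also have "\<dots> = (1 - \<zeta> ^ k) * (\<Sum>i<l. (\<zeta> ^ k) ^ i)" by (rule one_diff_power_eq)
    finally have "lam * x = (\<Sum>i<l. (\<zeta> ^ k) ^ i) * ((1 - \<zeta> ^ k) * x)" by simp
    moreover have "(\<Sum>i<l. (\<zeta> ^ k) ^ i) \<in> Oz" by (intro Oz_sum Oz_power) auto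
    ultimately have "lam * x \<in> P" using x(2) iP by (simp only: frac_ideal_mult int_ideal_frac_ideal)
    then show ?thesis using max_ideal_prime[OF P _ x(1)] False by auto
  qed
  have orb_img: "orb x = (\<lambda>i. cl (\<zeta> ^ i * x)) ` {..<p}" for x
  proof
    show "orb x \<subseteq> (\<lambda>i. cl (\<zeta> ^ i * x)) ` {..<p}"
      unfolding orb_def
    proof (rule image_subsetI)
      fix i show "cl (\<zeta> ^ i * x) \<in> (\<lambda>i. cl (\<zeta> ^ i * x)) ` {..<p}"
        using zeta_mod[of i] by (intro image_eqI[of _ _ "i mod p"]) auto
    qed
  qed (auto simp: orb_def)
  have card_orb: "card (orb x) = p" if x: "x \<in> Oz" "x \<notin> P" for x
  proof -
    have "inj_on (\<lambda>i. cl (\<zeta> ^ i * x)) {..<p}"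
    proof (rule linorder_inj_onI)
      fix i j :: nat assume ij: "i < j" "i \<in> {..<p}" "j \<in> {..<p}"
      show "cl (\<zeta> ^ i * x) \<noteq> cl (\<zeta> ^ j * x)"
      proof
        assume "cl (\<zeta> ^ i * x) = cl (\<zeta> ^ j * x)"
        then have "\<zeta> ^ i * x - \<zeta> ^ j * x \<in> P" by (simp only: cl_eq)
        also have "\<zeta> ^ i * x - \<zeta> ^ j * x = \<zeta> ^ i * ((1 - \<zeta> ^ (j - i)) * x)"
          using ij by (simp add: algebra_simps flip: power_add)
        finally have "(1 - \<zeta> ^ (j - i)) * x \<in> P" by (rule unit)
        moreover have "\<not> p dvd j - i" using ij by (auto dest: dvd_imp_le)
        ultimately show False using key x by blast
      qed
    qed auto
    then show ?thesis unfolding orb_img by (simp add: card_image)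
  qed
  have orb_eq: "orb x \<subseteq> orb y" if eq: "cl (\<zeta> ^ i * x) = cl (\<zeta> ^ j * y)" for x y i j
    unfolding orb_def[of x]
  proof (rule image_subsetI)
    fix k
    have "\<zeta> ^ (k + (p - 1) * i) * (\<zeta> ^ i * x - \<zeta> ^ j * y) \<in> P"
      using eq iP by (intro frac_ideal_mult) (auto simp: cl_eq)
    also have "\<zeta> ^ (k + (p - 1) * i) * (\<zeta> ^ i * x - \<zeta> ^ j * y)
        = \<zeta> ^ (k + ((p - 1) * i + i)) * x - \<zeta> ^ (k + (p - 1) * i + j) * y"
      by (simp add: power_add right_diff_distrib mult_ac)
    also have "\<zeta> ^ (k + ((p - 1) * i + i)) = \<zeta> ^ k"
    proof -
      have "(p - 1) * i + i = p * i" by (simp add: diff_mult_distrib)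
      moreover have "\<zeta> ^ (p * i) = 1" by (simp add: zeta_eq_1_iff)
      ultimately show ?thesis by (simp only: power_add) simp
    qed
    finally have "cl (\<zeta> ^ k * x) = cl (\<zeta> ^ (k + (p - 1) * i + j) * y)" by (simp only: cl_eq)
    then show "cl (\<zeta> ^ k * x) \<in> orb y" unfolding orb_def by blast
  qed
  define C where "C = orb ` (Oz - P)"
  have UC: "\<Union>C = T"
  proof (intro equalityI subsetI)
    fix c assume "c \<in> \<Union>C"
    then obtain x i where xi: "x \<in> Oz" "x \<notin> P" "c = cl (\<zeta> ^ i * x)" by (auto simp: C_def orb_def)
    then have "c \<noteq> cl 0" using unit[of i x] by (auto simp: cl_eq)
    moreover have "c \<in> cl ` Oz" using xi by auto
    ultimately show "c \<in> T" by (simp add: T_def cosets)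
  next
    fix c assume "c \<in> T"
    then obtain x where x: "x \<in> Oz" "c = cl x" "c \<noteq> cl 0" by (auto simp: T_def cosets)
    then have "x \<notin> P" using cl_eq[of x 0] by auto
    moreover have "c \<in> orb x" unfolding orb_def using x(2) by (intro image_eqI[of _ _ 0]) auto
    ultimately show "c \<in> \<Union>C" using x by (auto simp: C_def)
  qed
  have "p dvd card (\<Union>C)"
  proof (rule dvd_partition)
    show "finite (\<Union>C)" using finT UC by simp
    show "\<forall>c\<in>C. p dvd card c" using card_orb by (auto simp: C_def)
    show "\<forall>c1\<in>C. \<forall>c2\<in>C. c1 \<noteq> c2 \<longrightarrow> c1 \<inter> c2 = {}"
    proof (intro ballI impI)
      fix c d assume cd: "c \<in> C" "d \<in> C" "c \<noteq> d"
      then obtain x y where xy: "c = orb x" "d = orb y" by (auto simp: C_def)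
      show "c \<inter> d = {}"
      proof (rule ccontr)
        assume "c \<inter> d \<noteq> {}"
        then obtain i j where eq: "cl (\<zeta> ^ i * x) = cl (\<zeta> ^ j * y)" unfolding xy orb_def by auto
        from orb_eq[OF eq] orb_eq[OF eq[symmetric]] have "c = d" unfolding xy by (rule equalityI)
        with cd(3) show False by simp
      qed
    qed
  qed
  then obtain k where k: "card T = p * k" unfolding UC by blast
  have "cl 0 \<in> cosets Oz P" unfolding cosets by (intro imageI) auto
  then have "index Oz P = card T + 1"
    using card.remove[OF int_ideal_finite[OF iP]] by (simp only: T_def index_def Suc_eq_plus1)
  then have "index Oz P = k * p + 1" using k by (simp add: mult.commute)
  moreover have "k \<ge> 1" using calculation max_ideal_norm_ge_2[OF P] by (cases k) auto
  ultimately show ?thesis by blast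
qed

lemma lprod_move:
  assumes "\<forall>Q\<in>set (xs @ P # ys). int_ideal Q"
  shows "lprod (xs @ P # ys) = iprod P (lprod (xs @ ys))"
  using assms
proof (induction xs)
  case (Cons Q xs)
  have 1: "int_ideal Q" "int_ideal P" "int_ideal (lprod (xs @ ys))" using Cons.prems
    by (auto intro!: int_ideal_lprod)
  have "lprod ((Q # xs) @ P # ys) = iprod Q (iprod P (lprod (xs @ ys)))" using Cons by simp
  also have "\<dots> = iprod (iprod Q P) (lprod (xs @ ys))" using 1 by (intro iprod_assoc[symmetric]) auto
  also have "iprod Q P = iprod P Q" by (rule iprod_commute)
  also have "iprod (iprod P Q) (lprod (xs @ ys)) = iprod P (iprod Q (lprod (xs @ ys)))"
    using 1 by (intro iprod_assoc) auto
  finally show ?case by simp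
qed simp

lemma lprod_mset_cong:
  "mset Ps = mset Qs \<Longrightarrow> \<forall>P\<in>set Ps. int_ideal P \<Longrightarrow> lprod Ps = lprod Qs"
proof (induction Ps arbitrary: Qs)
  case (Cons P Ps)
  have "P \<in> set Qs" using Cons.prems(1) by (metis list.set_intros(1) mset_eq_setD)
  then obtain xs ys where Q: "Qs = xs @ P # ys" by (meson split_list)
  have "mset Ps = mset (xs @ ys)" using Cons.prems(1) Q by simp
  then have "lprod Ps = lprod (xs @ ys)" using Cons by auto
  moreover have "\<forall>Q\<in>set Qs. int_ideal Q" using Cons.prems by (metis mset_eq_setD)
  ultimately show ?case using lprod_move[of xs P ys] Q by simp
qed simp

section \<open>Rankin's count of ideals\<close>

definition primes_upto :: "real \<Rightarrow> complex set set" where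
  "primes_upto x = {P. max_ideal P \<and> real (index Oz P) \<le> x}"

definition ideals_upto :: "real \<Rightarrow> complex set set" where
  "ideals_upto x = {J. int_ideal J \<and> real (index Oz J) \<le> x}"

lemma finite_primes_upto: "finite (primes_upto x)"
proof -
  have "primes_upto x \<subseteq> (\<Union>N\<le>nat \<lfloor>x\<rfloor>. {P. max_ideal P \<and> index Oz P = N})"
    unfolding primes_upto_def by (auto simp: le_nat_floor)
  then show ?thesis by (rule finite_subset) (simp add: card_max_ideal_norm)
qed

lemma prod_list_count_list:
  fixes f :: "'a \<Rightarrow> 'b :: comm_monoid_mult"
  assumes "finite S" "set xs \<subseteq> S"
  shows "(\<Prod>x\<leftarrow>xs. f x) = (\<Prod>x\<in>S. f x ^ count_list xs x)"
  using assms(2)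
proof (induction xs)
  case (Cons a xs)
  have "(\<Prod>x\<in>S. f x ^ count_list (a # xs) x) = (\<Prod>x\<in>S. (if a = x then f x else 1) * f x ^ count_list xs x)"
    by (intro prod.cong refl) auto
  also have "\<dots> = f a * (\<Prod>x\<in>S. f x ^ count_list xs x)"
    using Cons.prems assms(1) by (simp add: prod.distrib)
  finally show ?case using Cons by simp
qed simp

lemma count_mset_list: "count (mset xs) x = count_list xs x"
  by (induction xs) auto

text \<open>Rankin's method: weight an ideal \<open>J\<close> of norm at most \<open>x\<close> by \<open>(x / N J)\<^sup>s \<ge> 1\<close>.\<close>
lemma card_ideals_upto:
  assumes x: "x \<ge> 1" and s: "s \<ge> 1"
  shows "finite (ideals_upto x) \<and>
    real (card (ideals_upto x)) \<le> x powr s * exp (\<Sum>P\<in>primes_upto x. 1 / (real (index Oz P) powr s - 1))"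
proof -
  let ?S = "primes_upto x" and ?J = "ideals_upto x"
  define L where "L = nat \<lfloor>x\<rfloor>"
  define q where "q P = real (index Oz P) powr (- s)" for P
  have finS: "finite ?S" by (rule finite_primes_upto)
  have "\<exists>Ps. (\<forall>P\<in>set Ps. max_ideal P) \<and> J = lprod Ps" if "J \<in> ?J" for J
    using that factorization unfolding ideals_upto_def by blast
  then obtain fac where fac: "\<And>J. J \<in> ?J \<Longrightarrow> (\<forall>P\<in>set (fac J). max_ideal P) \<and> J = lprod (fac J)" by metis
  have norm: "index Oz J = (\<Prod>P\<leftarrow>fac J. index Oz P)" if "J \<in> ?J" for J
    using index_lprod[of "fac J"] fac[OF that] by simp
  have in_S: "set (fac J) \<subseteq> ?S" if J: "J \<in> ?J" for J
  proof
    fix P assume P: "P \<in> set (fac J)"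
    have "index Oz P dvd index Oz J" unfolding norm[OF J] using P by (intro prod_list_dvd) auto
    moreover have "index Oz J > 0" using J int_ideal_finite unfolding ideals_upto_def
      by (intro index_pos) auto
    ultimately have "index Oz P \<le> index Oz J" by (rule dvd_imp_le)
    then show "P \<in> ?S" using J P fac[OF J] unfolding primes_upto_def ideals_upto_def by auto
  qed
  have len: "length (fac J) \<le> L" if J: "J \<in> ?J" for J
  proof -
    have "\<forall>P\<in>set Ps. max_ideal P \<Longrightarrow> 2 ^ length Ps \<le> (\<Prod>P\<leftarrow>Ps. index Oz P)" for Ps
      by (induction Ps) (auto intro!: mult_le_mono max_ideal_norm_ge_2)
    then have "2 ^ length (fac J) \<le> index Oz J" using fac[OF J] norm[OF J] by simp
    then have "length (fac J) \<le> index Oz J" using less_exp[of "length (fac J)"] by linarith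
    moreover have "index Oz J \<le> L" using J unfolding L_def ideals_upto_def by (simp add: le_nat_floor)
    ultimately show ?thesis by simp
  qed
  define e where "e J = (\<lambda>P\<in>?S. count_list (fac J) P)" for J
  let ?E = "PiE ?S (\<lambda>_. {..L})"
  have e_mem: "e J \<in> ?E" if "J \<in> ?J" for J
    using len[OF that] count_le_length[of "fac J"] order.trans by (fastforce simp: e_def)
  \<comment> \<open>An ideal is the product of its chosen factorization, so the exponents determine
    it.\<close>
  have inj: "inj_on e ?J"
  proof (rule inj_onI)
    fix I J assume IJ: "I \<in> ?J" "J \<in> ?J" "e I = e J"
    have "count_list (fac I) P = count_list (fac J) P" for P
    proof (cases "P \<in> ?S")
      case True
      then show ?thesis using fun_cong[OF IJ(3), of P] by (simp add: e_def)
    next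
      case False
      then show ?thesis using in_S[OF IJ(1)] in_S[OF IJ(2)] by (metis count_list_0_iff subsetD)
    qed
    then have "mset (fac I) = mset (fac J)" by (intro multiset_eqI) (simp only: count_mset_list)
    then have "lprod (fac I) = lprod (fac J)" using fac[OF IJ(1)]
      by (intro lprod_mset_cong) (auto simp: max_ideal_def)
    then show "I = J" using fac IJ by metis
  qed
  have finE: "finite ?E" using finS by (intro finite_PiE) auto
  have fin: "finite ?J" using inj finE e_mem by (metis finite_imageD finite_subset image_subsetI)
  have w: "x powr (- s) \<le> (\<Prod>P\<in>?S. q P ^ e J P)" if J: "J \<in> ?J" for J
  proof -
    have pos: "real (index Oz J) > 0" using J int_ideal_finite unfolding ideals_upto_def
      by (simp add: index_pos)
    have "real (index Oz J) = (\<Prod>P\<in>?S. real (index Oz P) ^ e J P)"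
      unfolding norm[OF J] prod_list_count_list[OF finS in_S[OF J]] by (simp add: e_def)
    then have "real (index Oz J) powr (- s) = (\<Prod>P\<in>?S. (real (index Oz P) ^ e J P) powr (- s))"
      by (simp add: prod_powr_distrib)
    also have "\<dots> = (\<Prod>P\<in>?S. q P ^ e J P)"
    proof (intro prod.cong refl)
      fix P assume "P \<in> ?S"
      then have "real (index Oz P) > 0" using max_ideal_norm_ge_2 unfolding primes_upto_def by fastforce
      then show "(real (index Oz P) ^ e J P) powr (- s) = q P ^ e J P"
        unfolding q_def by (simp add: powr_realpow[symmetric] powr_powr mult.commute)
    qed
    finally show ?thesis using J pos s powr_mono2'[of "- s" "real (index Oz J)" x] unfolding ideals_upto_def
      by simp
  qed
  \<comment> \<open>The Euler factor is 1 / (1 - q) = 1 + 1 / (N^s - 1), bounded by an exponential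
    so that the product becomes a sum in the exponent.\<close>
  have q01: "0 < q P \<and> q P < 1 \<and> 1 / (1 - q P) \<le> exp (1 / (real (index Oz P) powr s - 1))" if "P \<in> ?S" for P
  proof -
    have N: "real (index Oz P) \<ge> 2" using that max_ideal_norm_ge_2 unfolding primes_upto_def by fastforce
    have "real (index Oz P) powr 1 \<le> real (index Oz P) powr s" using N s by (intro powr_mono) auto
    then have y: "real (index Oz P) powr s \<ge> 2" using N by simp
    define Y where "Y = real (index Oz P) powr s"
    have Y: "Y \<ge> 2" using y by (simp add: Y_def)
    have q: "q P = 1 / Y" by (simp add: q_def Y_def powr_minus_divide)
    have "1 / (1 - 1 / Y) = 1 + 1 / (Y - 1)" using Y by (simp add: field_simps)
    also have "\<dots> \<le> exp (1 / (Y - 1))" by (rule exp_ge_add_one_self)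
    finally show ?thesis using Y unfolding q Y_def[symmetric] by simp
  qed
  have "real (card ?J) * x powr (- s) \<le> (\<Sum>J\<in>?J. \<Prod>P\<in>?S. q P ^ e J P)"
    using sum_mono[OF w] by simp
  also have "\<dots> = (\<Sum>g\<in>e ` ?J. \<Prod>P\<in>?S. q P ^ g P)" by (simp add: sum.reindex[OF inj])
  also have "\<dots> \<le> (\<Sum>g\<in>?E. \<Prod>P\<in>?S. q P ^ g P)"
  proof (rule sum_mono2[OF finE])
    show "e ` ?J \<subseteq> ?E" using e_mem by (rule image_subsetI)
    fix g
    have "0 \<le> q P" if "P \<in> ?S" for P using q01[OF that] by linarith
    then show "0 \<le> (\<Prod>P\<in>?S. q P ^ g P)" by (intro prod_nonneg zero_le_power)
  qed
  also have "\<dots> = (\<Prod>P\<in>?S. \<Sum>k\<le>L. q P ^ k)"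
    using finS by (intro prod_sum_PiE[symmetric]) auto
  also have "\<dots> \<le> (\<Prod>P\<in>?S. exp (1 / (real (index Oz P) powr s - 1)))"
  proof (intro prod_mono conjI)
    fix P assume P: "P \<in> ?S"
    show "0 \<le> (\<Sum>k\<le>L. q P ^ k)" using q01[OF P] by (intro sum_nonneg zero_le_power) auto
    have "(\<Sum>k\<le>L. q P ^ k) \<le> 1 / (1 - q P)"
      using q01[OF P] sum_gp0[of "q P" L] by (simp add: divide_right_mono)
    then show "(\<Sum>k\<le>L. q P ^ k) \<le> exp (1 / (real (index Oz P) powr s - 1))" using q01[OF P] by linarith
  qed
  also have "\<dots> = exp (\<Sum>P\<in>?S. 1 / (real (index Oz P) powr s - 1))" by (simp add: exp_sum finS)
  finally have "real (card ?J) * x powr (- s) \<le> \<dots>" .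
  then have le: "real (card ?J) * x powr (- s) * x powr s \<le> exp (\<Sum>P\<in>?S. 1 / (real (index Oz P) powr s - 1)) * x powr s"
    by (intro mult_right_mono) auto
  have "x powr (- s) * x powr s = 1" using x by (simp flip: powr_add)
  then have "real (card ?J) = real (card ?J) * x powr (- s) * x powr s"
    by (simp only: mult.assoc mult_1_right)
  also note le
  finally show ?thesis using fin by (simp only: mult.commute)
qed

text \<open>Apart from \<open>lam\<close>, which generates the prime ideal of norm p, the norms are
  k p + 1 with k \<ge> 1, each attained at most p - 1 times. The sum over primes is thus compared
  with a zeta sum over k.\<close>

lemma sum_primes_upto_le:
  fixes K :: nat
  assumes s: "s \<ge> 1" and K: "\<And>k. real (k * p + 1) \<le> x \<Longrightarrow> k \<le> K"
  shows "(\<Sum>P\<in>primes_upto x. 1 / (real (index Oz P) powr s - 1))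
    \<le> 1 / (real p powr s - 1) + (\<Sum>k=1..K. real (p - 1) / (real (k * p) powr s))"
proof -
  let ?f = "\<lambda>P. 1 / (real (index Oz P) powr s - 1)"
  define A where "A k = {P. max_ideal P \<and> index Oz P = k * p + 1}" for k
  have finA: "finite (A k)" "card (A k) \<le> p - 1" for k unfolding A_def using card_max_ideal_norm by auto
  have nn: "?f P \<ge> 0" if "max_ideal P" for P
  proof -
    have "real (index Oz P) \<ge> 2" using max_ideal_norm_ge_2[OF that] by simp
    then have "1 powr s \<le> real (index Oz P) powr s" using s by (intro powr_mono2) auto
    then show ?thesis by simp
  qed
  have sub: "primes_upto x \<subseteq> {scale lam Oz} \<union> (\<Union>k\<in>{1..K}. A k)"
  proof
    fix P assume P: "P \<in> primes_upto x"
    then have "max_ideal P" by (simp add: primes_upto_def)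
    from max_ideal_norm_cases[OF this] show "P \<in> {scale lam Oz} \<union> (\<Union>k\<in>{1..K}. A k)"
    proof
      assume "\<exists>k\<ge>1. index Oz P = k * p + 1"
      then obtain k where k: "k \<ge> 1" "index Oz P = k * p + 1" by blast
      then have "k \<le> K" using P by (intro K) (simp only: primes_upto_def mem_Collect_eq)
      then show ?thesis using k \<open>max_ideal P\<close> by (auto simp: A_def)
    qed simp
  qed
  have "(\<Sum>P\<in>primes_upto x. ?f P) \<le> (\<Sum>P\<in>{scale lam Oz} \<union> (\<Union>k\<in>{1..K}. A k). ?f P)"
  proof (rule sum_mono2[OF _ sub])
    fix P assume "P \<in> ({scale lam Oz} \<union> (\<Union>k\<in>{1..K}. A k)) - primes_upto x"
    then have "max_ideal P" using max_ideal_lam unfolding A_def by auto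
    then show "?f P \<ge> 0" by (rule nn)
  qed (use finA in auto)
  also have "\<dots> \<le> (\<Sum>P\<in>{scale lam Oz}. ?f P) + (\<Sum>P\<in>(\<Union>k\<in>{1..K}. A k). ?f P)"
  proof -
    have "0 \<le> (\<Sum>P\<in>{scale lam Oz} \<inter> (\<Union>k\<in>{1..K}. A k). ?f P)" using nn max_ideal_lam by (intro sum_nonneg) blast
    then show ?thesis using finA sum.union_inter[of "{scale lam Oz}" "\<Union>k\<in>{1..K}. A k" ?f] by simp
  qed
  also have "(\<Sum>P\<in>{scale lam Oz}. ?f P) = 1 / (real p powr s - 1)" by (simp add: index_lam)
  also have "(\<Sum>P\<in>(\<Union>k\<in>{1..K}. A k). ?f P) = (\<Sum>k=1..K. \<Sum>P\<in>A k. ?f P)"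
    using finA p_gt_2 by (intro sum.UNION_disjoint) (auto simp: A_def)
  also have "\<dots> \<le> (\<Sum>k=1..K. real (p - 1) / (real (k * p) powr s))"
  proof (intro sum_mono)
    fix k assume k: "k \<in> {1..K}"
    let ?y = "real (k * p)"
    have y: "?y \<ge> 1" using k p_gt_2 by (simp add: Suc_le_eq flip: of_nat_mult)
    \<comment> \<open>Superadditivity of y -> y^s for s \<ge> 1: the 1 in the norm k p + 1
      compensates the -1 in the denominator.\<close>
    have "?y powr s + 1 \<le> (?y + 1) powr s"
    proof -
      have a: "?y powr (s - 1) \<le> (?y + 1) powr (s - 1)" using s y by (intro powr_mono2) auto
      have b: "1 powr (s - 1) \<le> (?y + 1) powr (s - 1)" using s y by (intro powr_mono2) auto
      have "?y powr s + 1 = ?y * ?y powr (s - 1) + 1 powr (s - 1)" using y by (simp add: powr_mult_base)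
      also have "\<dots> \<le> ?y * (?y + 1) powr (s - 1) + (?y + 1) powr (s - 1)"
        using y a b by (intro add_mono mult_left_mono) auto
      also have "\<dots> = (?y + 1) * (?y + 1) powr (s - 1)" by (simp add: distrib_right)
      also have "\<dots> = (?y + 1) powr s" using y by (simp add: powr_mult_base)
      finally show ?thesis .
    qed
    then have le: "1 / ((?y + 1) powr s - 1) \<le> 1 / (?y powr s)"
    proof -
      have gen: "1 / (Z - 1) \<le> 1 / Y" if "Y + 1 \<le> Z" "Y > 0" for Y Z :: real
        using that by (simp add: field_simps)
      have "?y \<noteq> 0" using y by linarith
      then have "?y powr s > 0" by (rule powr_gt_zero[THEN iffD2])
      from gen[OF \<open>?y powr s + 1 \<le> (?y + 1) powr s\<close> this] show ?thesis .
    qed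
    have "(\<Sum>P\<in>A k. ?f P) = (\<Sum>P\<in>A k. 1 / ((?y + 1) powr s - 1))"
      by (intro sum.cong refl) (simp add: A_def add.commute)
    also have "\<dots> \<le> (\<Sum>P\<in>A k. 1 / (?y powr s))" by (intro sum_mono le)
    also have "\<dots> = real (card (A k)) / (?y powr s)" by simp
    also have "\<dots> \<le> real (p - 1) / (?y powr s)" using finA(2)[of k]
      by (intro divide_right_mono) (simp_all only: of_nat_le_iff powr_ge_zero)
    finally show "(\<Sum>P\<in>A k. ?f P) \<le> real (p - 1) / (?y powr s)" .
  qed
  finally show ?thesis by simp
qed

end

text \<open>Comparison with the integral of t^(-1-e), done by telescoping: 1 / y^(1+e) \<le> (x^(-e)
  - y^(-e)) / e for y = x + 1, which reduces to 1 + t \<le> exp t.\<close>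

lemma sum_powr_le:
  assumes e: "e > 0"
  shows "(\<Sum>k=1..K. 1 / real k powr (1 + e)) \<le> 1 + 1 / e"
proof (cases K)
  case (Suc K')
  have "(\<Sum>k=1..Suc K. 1 / real k powr (1 + e)) \<le> 1 + (1 - real (Suc K) powr (- e)) / e" for K
  proof (induction K)
    case (Suc K)
    let ?x = "real (Suc K)" and ?y = "real (Suc (Suc K))"
    have xy: "?x > 0" "?y > 0" by auto
    have "ln (?x / ?y) \<le> ?x / ?y - 1" using xy by (intro ln_le_minus_one divide_pos_pos)
    also have "\<dots> = - (1 / ?y)" using xy by (simp add: field_simps)
    finally have "1 / ?y \<le> ln (?y / ?x)" using xy by (simp add: ln_div)
    then have "1 + e * (1 / ?y) \<le> 1 + e * ln (?y / ?x)" using e by (intro add_left_mono mult_left_mono) auto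
    also have "\<dots> \<le> exp (e * ln (?y / ?x))" by (rule exp_ge_add_one_self)
    also have "\<dots> = (?y / ?x) powr e" using xy by (simp add: powr_def)
    finally have le: "e / ?y \<le> ?y powr e / ?x powr e - 1" using xy by (simp add: powr_divide)
    define a where "a = ?x powr e"
    define b where "b = ?y powr e"
    have ab: "a > 0" "b > 0" by (simp_all add: a_def b_def)
    have "(e / ?y) * (1 / b) \<le> (b / a - 1) * (1 / b)"
      using le ab unfolding a_def[symmetric] b_def[symmetric] by (intro mult_right_mono) auto
    also have "\<dots> = 1 / a - 1 / b" using ab by (simp add: left_diff_distrib diff_divide_distrib)
    finally have "e * (1 / (?y * b)) \<le> 1 / a - 1 / b" by simp
    moreover have "?y powr (1 + e) = ?y * b" using xy by (simp add: powr_add b_def)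
    ultimately have "e * (1 / ?y powr (1 + e)) \<le> ?x powr (- e) - ?y powr (- e)"
      by (simp only: powr_minus_divide a_def b_def)
    then have "1 / ?y powr (1 + e) \<le> (?x powr (- e) - ?y powr (- e)) / e"
      by (simp only: pos_le_divide_eq[OF e] mult.commute)
    with Suc.IH show ?case by (simp add: diff_divide_distrib)
  qed simp
  from this[of K'] have "(\<Sum>k=1..K. 1 / real k powr (1 + e)) \<le> 1 + (1 - real K powr (- e)) / e" using Suc
    by simp
  also have "\<dots> \<le> 1 + 1 / e" using e by (intro add_left_mono divide_right_mono) auto
  finally show ?thesis .
qed (use e in simp)

lemma six_mult_less_three_power: "3 \<le> n \<Longrightarrow> 6 * (n + 1) < (3::nat) ^ n"
proof (induction n rule: dec_induct)
  case (step n)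
  then show ?case by simp
qed simp

context cyclotomic
begin

section \<open>The numerical estimate\<close>

text \<open>Rankin's count assumes a bound of at least 1. This follows from the meaning of
  \<open>Mb\<close>: some nonzero element of Z[\<zeta>] has norm at most \<open>Mb\<close>, and its
  norm is a nonzero integer.\<close>

lemma Mb_ge_1: "Mb \<ge> 1"
proof -
  obtain b where b: "b \<in> Oz" "b \<noteq> 0" "cmod (Nm b) \<le> Mb * real (index Oz Oz)"
    using small_element[OF int_ideal_Oz] by (elim bexE conjE) (rule that)
  obtain n where n: "Nm b = of_int n" using Nm_in_Ints[OF b(1)] by (auto elim: Ints_cases)
  have "n \<noteq> 0" using n Nm_eq_0_iff[OF b(1)] b(2) by auto
  then have "1 \<le> cmod (Nm b)" unfolding n by simp
  moreover have "index Oz Oz = 1" using index_lprod[of "[]"] by simp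
  ultimately show ?thesis using b(3) by simp
qed

lemma exp_5_4_less: "exp (5/4 :: real) < 4"
proof -
  have "exp (5/4 :: real) ^ 4 = exp 1 ^ 5" by (simp flip: exp_of_nat_mult)
  also have "\<dots> \<le> 3 ^ 5" by (intro power_mono exp_le) auto
  also have "\<dots> < (4::real) ^ 4" by simp
  finally show ?thesis by (rule power_less_imp_less_base) simp
qed

text \<open>For p \<ge> 7 the sum over primes is at most 3/4 + 3/4 ln p, so the count is at most Mb
  2^hf e^(3/4) p^(3/4), that is e^2 (hf + 1) (p/3)^hf p^(3/4). Now e^2 \<le> 9 and 6 (hf + 1) < 3^hf
  reduce this to 3/2 p^(hf + 3/4), and 3/2 \<le> p^(1/4). As 6 (hf + 1) < 3^hf starts at hf = 3, the
  primes 3 and 5 are done separately with exponent 1.\<close>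

lemma card_ideals_upto_Mb:
  "finite (ideals_upto Mb) \<and> real (card (ideals_upto Mb)) < real p ^ (hf + 1)"
proof -
  have fin: "finite (ideals_upto Mb)" using card_ideals_upto[OF Mb_ge_1, of 1] by simp
  consider "hf = 1" | "hf = 2" | "hf \<ge> 3" using hf(2) by linarith
  then have "real (card (ideals_upto Mb)) < real p ^ (hf + 1)"
  proof cases
    case 1
    then have p: "p = 3" using hf(3) by simp
    have "Mb = exp (5/4) * real (1 + 1) * (3 / 6) ^ 1" unfolding Mb_def 1 using p by simp
    then have Mb: "Mb < 4" using exp_5_4_less by simp
    \<comment> \<open>Below 4 the only possible norm of a prime ideal is p = 3, since the next
      candidate is p + 1 = 4; the sum over k is empty.\<close>
    have "(\<Sum>P\<in>primes_upto Mb. 1 / (real (index Oz P) powr 1 - 1)) \<le> 1 / (real p powr 1 - 1) + (\<Sum>k=1..0. real (p - 1) / (real (k * p) powr 1))"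
      by (rule sum_primes_upto_le) (use Mb p in auto)
    also have "\<dots> = 1 / 2" using p by simp
    finally have le: "(\<Sum>P\<in>primes_upto Mb. 1 / (real (index Oz P) powr 1 - 1)) \<le> 1 / 2" .
    have "exp (1/2 :: real) ^ 2 = exp 1" by (simp flip: exp_of_nat_mult)
    also have "\<dots> < (2::real) ^ 2" by (rule order.strict_trans1[OF exp_le]) simp
    finally have e: "exp (1/2 :: real) < 2" by (rule power_less_imp_less_base) simp
    have "real (card (ideals_upto Mb)) \<le> Mb powr 1 * exp (1/2)"
      using card_ideals_upto[OF Mb_ge_1, of 1] le by (auto elim!: order.trans intro!: mult_left_mono)
    also have "\<dots> \<le> 4 * 2" using Mb Mb_ge_1 e by (intro mult_mono) auto
    also have "\<dots> < real p ^ (hf + 1)" using p 1 by simp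
    finally show ?thesis .
  next
    case 2
    then have p: "p = 5" using hf(3) by simp
    have "Mb = exp (5/4) * real (2 + 1) * (5 / 6) ^ 2" unfolding Mb_def 2 using p by simp
    then have Mb: "Mb \<le> 25 / 3" using exp_5_4_less by (simp add: power2_eq_square)
    \<comment> \<open>Up to 25/3 the candidates are the norms 5 and 6; the next one is 11.\<close>
    have "(\<Sum>P\<in>primes_upto Mb. 1 / (real (index Oz P) powr 1 - 1)) \<le> 1 / (real p powr 1 - 1) + (\<Sum>k=1..1. real (p - 1) / (real (k * p) powr 1))"
    proof (rule sum_primes_upto_le)
      fix k assume "real (k * p + 1) \<le> Mb"
      then have "real (k * 5 + 1) \<le> 25 / 3" using Mb p by simp
      then show "k \<le> 1" by simp
    qed simp
    also have "\<dots> \<le> 2" using p by simp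
    finally have le: "(\<Sum>P\<in>primes_upto Mb. 1 / (real (index Oz P) powr 1 - 1)) \<le> 2" .
    have "exp (2 :: real) = exp 1 ^ 2" by (simp flip: exp_of_nat_mult)
    also have "\<dots> \<le> 3 ^ 2" by (intro power_mono exp_le) auto
    finally have e: "exp (2 :: real) \<le> 9" by simp
    have "real (card (ideals_upto Mb)) \<le> Mb powr 1 * exp 2"
      using card_ideals_upto[OF Mb_ge_1, of 1] le by (auto elim!: order.trans intro!: mult_left_mono)
    also have "\<dots> \<le> 25 / 3 * 9" using Mb Mb_ge_1 e by (intro mult_mono) auto
    also have "\<dots> < real p ^ (hf + 1)" using p 2 by simp
    finally show ?thesis .
  next
    case 3
    then have p7: "p \<ge> 7" using hf(3) by simp
    \<comment> \<open>The exponent of Rankin's method is chosen such that \<open>p\<^sup>e = 2\<close>.\<close>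
    define e where "e = ln 2 / ln (real p)"
    have lnp: "ln (real p) > 0" using p7 by simp
    have e0: "e > 0" using lnp by (simp add: e_def)
    have pe: "real p powr e = 2" using lnp p7 by (simp add: e_def powr_def)
    have ps: "real p powr (1 + e) = 2 * real p" using pe p7 by (simp add: powr_add)
    \<comment> \<open>Here 1 / e = ln p / ln 2, and ln 2 \<ge> 2/3.\<close>
    have ie: "1 / e \<le> 3 / 2 * ln (real p)"
      using ln2_ge_two_thirds lnp by (simp add: e_def field_simps)
    define K where "K = nat \<lfloor>Mb\<rfloor>"
    have "(\<Sum>P\<in>primes_upto Mb. 1 / (real (index Oz P) powr (1 + e) - 1))
        \<le> 1 / (real p powr (1 + e) - 1) + (\<Sum>k=1..K. real (p - 1) / (real (k * p) powr (1 + e)))"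
    proof (rule sum_primes_upto_le)
      fix k assume "real (k * p + 1) \<le> Mb"
      moreover have "k \<le> k * p + 1" using p7 by (cases p) auto
      ultimately have "real k \<le> Mb" by linarith
      then show "k \<le> K" unfolding K_def by (rule le_nat_floor)
    qed (use e0 in simp)
    also have "(\<Sum>k=1..K. real (p - 1) / (real (k * p) powr (1 + e)))
        = real (p - 1) / (2 * real p) * (\<Sum>k=1..K. 1 / real k powr (1 + e))"
      unfolding sum_distrib_left by (intro sum.cong refl) (simp add: powr_mult ps)
    also have "\<dots> \<le> 1 / 2 * (1 + 1 / e)"
      using e0 p7 by (intro mult_mono sum_powr_le) (auto simp: field_simps intro!: sum_nonneg)
    finally have a1: "(\<Sum>P\<in>primes_upto Mb. 1 / (real (index Oz P) powr (1 + e) - 1))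
        \<le> 1 / (real p powr (1 + e) - 1) + 1 / 2 * (1 + 1 / e)" by simp
    have a2: "1 / (real p powr (1 + e) - 1) \<le> 1 / 4" unfolding ps using p7 by (simp add: field_simps)
    have gen: "a \<le> 3 / 4 + 3 / 4 * l"
      if "a \<le> b + 1 / 2 * (1 + c)" "b \<le> 1 / 4" "c \<le> 3 / 2 * l" for a b c l :: real
      using that by (simp add: field_simps)
    have le: "(\<Sum>P\<in>primes_upto Mb. 1 / (real (index Oz P) powr (1 + e) - 1)) \<le> 3 / 4 + 3 / 4 * ln (real p)"
      by (rule gen[OF a1 a2 ie])
    have nine: "exp (2 :: real) \<le> 9"
    proof -
      have "exp (2 :: real) = exp 1 ^ 2" by (simp flip: exp_of_nat_mult)
      also have "\<dots> \<le> 3 ^ 2" by (intro power_mono exp_le) auto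
      finally show ?thesis by simp
    qed
    have hf6: "6 * (real hf + 1) < 3 ^ hf"
    proof -
      have "real (6 * (hf + 1)) < real (3 ^ hf)" using six_mult_less_three_power[OF 3]
        by (simp only: of_nat_less_iff)
      then show ?thesis by simp
    qed
    \<comment> \<open>Giving away the factor gained over \<open>p ^ hf\<close> is harmless here: the
      estimate is used only inside the power with the small exponent e.\<close>
    have Mb_le: "Mb \<le> real p ^ hf"
    proof -
      have "exp (5/4) * (real hf + 1) \<le> 4 * (real hf + 1)"
        using exp_5_4_less by (intro mult_right_mono) auto
      also have "\<dots> \<le> 3 ^ hf" using hf6 by simp
      also have "\<dots> \<le> 6 ^ hf" by (intro power_mono) auto
      finally have "exp (5/4) * (real hf + 1) * (real p / 6) ^ hf \<le> 6 ^ hf * (real p / 6) ^ hf"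
        by (intro mult_right_mono) auto
      also have "\<dots> = real p ^ hf" by (simp flip: power_mult_distrib)
      finally show ?thesis by (simp add: Mb_def add.commute)
    qed
    have Mbe: "Mb powr e \<le> 2 ^ hf"
    proof -
      have "Mb powr e \<le> (real p ^ hf) powr e" using Mb_le Mb_ge_1 e0 by (intro powr_mono2) auto
      also have "(real p ^ hf) powr e = (real p powr e) ^ hf"
        using p7 by (simp add: powr_realpow[symmetric] powr_powr mult.commute powr_power)
      finally show ?thesis by (simp add: pe)
    qed
    have p14: "real p powr (1/4) \<ge> 3 / 2"
    proof -
      have "(3/2 :: real) ^ 4 \<le> 7" by (simp add: power_divide)
      also have "7 \<le> real p" using p7 by simp
      also have "real p = (real p powr (1/4)) ^ 4" using p7 by (simp add: powr_power)
      finally show ?thesis using power_mono_iff[of "3/2" "real p powr (1/4)" 4] by simp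
    qed
    have pp: "real p = real p powr (3/4) * real p powr (1/4)" using p7 by (simp flip: powr_add)
    have "real (card (ideals_upto Mb)) \<le> Mb powr (1 + e) * exp (\<Sum>P\<in>primes_upto Mb. 1 / (real (index Oz P) powr (1 + e) - 1))"
      using card_ideals_upto[OF Mb_ge_1, of "1 + e"] e0 by simp
    also have "\<dots> \<le> Mb powr (1 + e) * exp (3 / 4 + 3 / 4 * ln (real p))"
      using le by (intro mult_left_mono) auto
    also have "\<dots> = Mb * Mb powr e * (exp (3/4) * real p powr (3/4))"
    proof -
      have "Mb powr (1 + e) = Mb * Mb powr e" using Mb_ge_1 by (simp add: powr_add)
      moreover have "exp (3/4 * ln (real p)) = real p powr (3/4)" using p7 by (simp add: powr_def)
      ultimately show ?thesis by (simp only: exp_add)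
    qed
    also have "\<dots> \<le> Mb * 2 ^ hf * (exp (3/4) * real p powr (3/4))"
      using Mbe Mb_ge_1 by (intro mult_right_mono mult_left_mono) auto
    also have "\<dots> = (exp (5/4) * exp (3/4)) * (real hf + 1) * ((real p / 6) ^ hf * 2 ^ hf) * real p powr (3/4)"
      by (simp add: Mb_def)
    also have "exp (5/4) * exp (3/4) = exp (2 :: real)" by (simp flip: exp_add)
    also have "(real p / 6) ^ hf * 2 ^ hf = (real p / 3) ^ hf" by (simp flip: power_mult_distrib)
    also have "exp 2 * (real hf + 1) * (real p / 3) ^ hf * real p powr (3/4)
        \<le> 9 * (real hf + 1) * (real p / 3) ^ hf * real p powr (3/4)"
      using nine by (intro mult_right_mono) auto
    also have "\<dots> < (3 / 2 * 3 ^ hf) * (real p / 3) ^ hf * real p powr (3/4)"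
      using hf6 p7 by (intro mult_strict_right_mono) auto
    also have "\<dots> = real p ^ hf * (3 / 2 * real p powr (3/4))" by (simp add: power_divide)
    also have "\<dots> \<le> real p ^ hf * (real p powr (1/4) * real p powr (3/4))"
      using p14 by (intro mult_left_mono mult_right_mono) auto
    also have "\<dots> = real p ^ (hf + 1)" using pp by (simp add: mult.commute)
    finally show ?thesis .
  qed
  with fin show ?thesis by blast
qed

end


section \<open>Units\<close>

text \<open>A maximal set without related pairs meets every class. This turns bounds on independent
  families into bounds on sets of representatives, with no quotient group to form.\<close>

lemma max_transversal:
  fixes D :: "'a set" and rel :: "'a \<Rightarrow> 'a \<Rightarrow> bool" and n :: nat
  assumes bound: "\<And>S. finite S \<Longrightarrow> S \<subseteq> D \<Longrightarrow> (\<And>x y. x \<in> S \<Longrightarrow> y \<in> S \<Longrightarrow> rel x y \<Longrightarrow> x = y) \<Longrightarrow> card S \<le> n"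
    and rel_sym: "\<And>x y. x \<in> D \<Longrightarrow> y \<in> D \<Longrightarrow> rel x y \<Longrightarrow> rel y x"
    and rel_refl: "\<And>x. x \<in> D \<Longrightarrow> rel x x"
  shows "\<exists>S\<subseteq>D. finite S \<and> card S \<le> n \<and> (\<forall>x\<in>D. \<exists>s\<in>S. rel x s)"
proof -
  define ok where "ok S \<longleftrightarrow> finite S \<and> S \<subseteq> D \<and> (\<forall>x\<in>S. \<forall>y\<in>S. rel x y \<longrightarrow> x = y)" for S
  have okn: "card S \<le> n" if "ok S" for S using that bound[of S] unfolding ok_def by blast
  have "ok {}" by (simp add: ok_def)
  then obtain S where S: "ok S" "\<And>T. ok T \<Longrightarrow> card T \<le> card S"
    using ex_has_greatest_nat[of ok "{}" card "Suc n"] okn by (auto simp: less_Suc_eq_le)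
  have "\<exists>s\<in>S. rel x s" if x: "x \<in> D" for x
  proof (rule ccontr)
    assume no: "\<not> ?thesis"
    then have "x \<notin> S" using rel_refl[OF x] by blast
    have "ok (insert x S)"
      unfolding ok_def
    proof (intro conjI ballI impI)
      show "finite (insert x S)" "insert x S \<subseteq> D" using S x by (auto simp: ok_def)
      fix y z assume yz: "y \<in> insert x S" "z \<in> insert x S" "rel y z"
      then have D: "y \<in> D" "z \<in> D" using S x by (auto simp: ok_def)
      have 1: "y = x \<Longrightarrow> z \<in> S \<Longrightarrow> False" using no yz(3) by blast
      have 2: "z = x \<Longrightarrow> y \<in> S \<Longrightarrow> False" using no rel_sym[OF D yz(3)] by blast
      have 3: "y \<in> S \<Longrightarrow> z \<in> S \<Longrightarrow> y = z" using S(1) yz(3) unfolding ok_def by blast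
      show "y = z" using yz(1,2) 1 2 3 by (elim insertE) auto
    qed
    from S(2)[OF this] show False using \<open>x \<notin> S\<close> S(1) by (simp add: ok_def)
  qed
  moreover have "S \<subseteq> D" "finite S" using S(1) by (simp_all add: ok_def)
  ultimately show ?thesis using okn[OF S(1)] by (intro exI[of _ S] conjI ballI)
qed

context cyclotomic
begin

section \<open>Units and their logarithms\<close>

definition units_Oz :: "complex set" where
  "units_Oz = {u \<in> Oz. u \<noteq> 0 \<and> inverse u \<in> Oz}"

lemma units_Oz_closed:
  "1 \<in> units_Oz" "u \<in> units_Oz \<Longrightarrow> v \<in> units_Oz \<Longrightarrow> u * v \<in> units_Oz" "u \<in> units_Oz \<Longrightarrow> inverse u \<in> units_Oz"
  "u \<in> units_Oz \<Longrightarrow> v \<in> units_Oz \<Longrightarrow> u / v \<in> units_Oz" "u \<in> units_Oz \<Longrightarrow> u ^ k \<in> units_Oz"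
proof -
  show 1: "1 \<in> units_Oz" by (simp add: units_Oz_def)
  show 2: "u \<in> units_Oz \<Longrightarrow> v \<in> units_Oz \<Longrightarrow> u * v \<in> units_Oz" for u v by (auto simp: units_Oz_def)
  show 3: "u \<in> units_Oz \<Longrightarrow> inverse u \<in> units_Oz" for u by (simp add: units_Oz_def)
  show "u \<in> units_Oz \<Longrightarrow> v \<in> units_Oz \<Longrightarrow> u / v \<in> units_Oz" using 2[of u "inverse v"] 3[of v]
    by (simp add: divide_inverse)
  show "u \<in> units_Oz \<Longrightarrow> u ^ k \<in> units_Oz" by (induction k) (auto intro: 1 2)
qed

lemma units_Oz_nz: "u \<in> units_Oz \<Longrightarrow> u \<noteq> 0" and units_Oz_Oz: "u \<in> units_Oz \<Longrightarrow> u \<in> Oz"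
  by (simp_all add: units_Oz_def)

lemma cmod_Nm_units_Oz: "u \<in> units_Oz \<Longrightarrow> cmod (Nm u) = 1"
proof -
  assume u: "u \<in> units_Oz"
  then have O: "u \<in> Oz" "inverse u \<in> Oz" "u \<noteq> 0" by (auto simp: units_Oz_def)
  obtain m n where mn: "Nm u = of_int m" "Nm (inverse u) = of_int n"
    using Nm_in_Ints[OF O(1)] Nm_in_Ints[OF O(2)] by (auto elim!: Ints_cases)
  have "Nm (u * inverse u) = Nm u * Nm (inverse u)" using O by (intro Nm_mult)
  moreover have "Nm 1 = 1" unfolding Nm_def by (intro prod.neutral ballI sig_0_1 not_dvd_range)
  ultimately have "of_int (m * n) = (1 :: complex)" using O mn by simp
  then have "m * n = 1" using of_int_eq_1_iff by blast
  then have "\<bar>m\<bar> = 1" by (auto simp: zmult_eq_1_iff)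
  then show ?thesis unfolding mn norm_of_int by simp
qed

definition lg :: "nat \<Rightarrow> complex \<Rightarrow> real" where "lg k u = ln (cmod (sig k u))"

lemma sig_units_Oz_pos: "k \<in> {1..<p} \<Longrightarrow> u \<in> units_Oz \<Longrightarrow> cmod (sig k u) > 0"
  using sig_eq_0_iff[OF not_dvd_range] units_Oz_nz units_Oz_Oz by simp

lemma lg_mult: "k \<in> {1..<p} \<Longrightarrow> u \<in> units_Oz \<Longrightarrow> v \<in> units_Oz \<Longrightarrow> lg k (u * v) = lg k u + lg k v"
  unfolding lg_def using sig_units_Oz_pos[of k u] sig_units_Oz_pos[of k v] not_dvd_range[of k] units_Oz_Oz
  by (simp add: sig_simps norm_mult ln_mult)

lemma lg_1: "k \<in> {1..<p} \<Longrightarrow> lg k 1 = 0"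
  using not_dvd_range[of k] by (simp add: lg_def)

lemma lg_power: "k \<in> {1..<p} \<Longrightarrow> u \<in> units_Oz \<Longrightarrow> lg k (u ^ m) = real m * lg k u"
  by (induction m) (simp_all add: lg_1[simplified] lg_mult[simplified] units_Oz_closed algebra_simps)

lemma lg_divide: "k \<in> {1..<p} \<Longrightarrow> u \<in> units_Oz \<Longrightarrow> v \<in> units_Oz \<Longrightarrow> lg k (u / v) = lg k u - lg k v"
  using lg_mult[of k "u / v" v] units_Oz_closed(4) units_Oz_nz[of v] by fastforce

lemma sig_complement:
  assumes "k < p" "\<not> p dvd k" "\<not> p dvd p - k" "x \<in> Oz"
  shows "sig (p - k) x = cnj (sig k x)"
proof -
  obtain c where c: "x = (\<Sum>j<p - 1. of_int (c j) * \<zeta> ^ j)" using Oz_coords[OF assms(4)] .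
  have "\<zeta> ^ ((p - k) * j) = cnj (\<zeta> ^ (k * j))" for j
    using cnj_zeta_power[of k j] assms(1) by (simp add: mult.commute)
  then show ?thesis unfolding c sig_coords[OF assms(2)] sig_coords[OF assms(3)]
    by (simp add: cnj_sum)
qed

lemma lg_complement: "k \<in> {1..<p} \<Longrightarrow> u \<in> units_Oz \<Longrightarrow> lg (p - k) u = lg k u"
  using sig_complement[of k u] not_dvd_range[of k] not_dvd_range[of "p - k"] units_Oz_Oz[of u]
  by (auto simp: lg_def)

text \<open>The norm of a unit is \<plusminus>1, and k and p - k give complex conjugates, so the sum
  over 1, ..., p - 1 is twice this one.\<close>

lemma sum_lg:
  assumes u: "u \<in> units_Oz"
  shows "(\<Sum>k\<in>{1..hf}. lg k u) = 0"
proof -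
  have "(\<Sum>k\<in>{1..<p}. lg k u) = ln (\<Prod>k\<in>{1..<p}. cmod (sig k u))"
    unfolding lg_def using sig_units_Oz_pos[OF _ u] by (intro ln_prod[symmetric]) auto
  also have "\<dots> = 0" using cmod_Nm_units_Oz[OF u] by (simp add: Nm_def flip: prod_norm)
  finally have "0 = (\<Sum>k\<in>{1..hf} \<union> {Suc hf..<p}. lg k u)"
    using hf(3)
      by (simp add: ivl_disj_un_one(7) ivl_disj_un_two(7) atLeastLessThanSuc_atLeastAtMost[symmetric] ivl_disj_un_two(3))
  also have "\<dots> = (\<Sum>k\<in>{1..hf}. lg k u) + (\<Sum>k\<in>{Suc hf..<p}. lg k u)"
    by (intro sum.union_disjoint) auto
  also have "(\<Sum>k\<in>{Suc hf..<p}. lg k u) = (\<Sum>k\<in>{1..hf}. lg k u)"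
  proof (rule sum.reindex_bij_witness[of _ "\<lambda>k. p - k" "\<lambda>k. p - k"])
    fix k assume "k \<in> {Suc hf..<p}"
    then show "lg (p - k) u = lg k u" using u by (intro lg_complement) auto
  qed (use hf(3) in auto)
  finally show ?thesis by simp
qed

text \<open>By \<open>Tr_coeff\<close> p times a coordinate is a difference of two traces, each at
  most p |B| in absolute value, so coordinates are bounded by 2 |B|.\<close>

lemma finite_bounded_conjugates:
  "finite {x \<in> Oz. \<forall>k\<in>{1..<p}. cmod (sig k x) \<le> B}" (is "finite ?F")
proof -
  define N where "N = \<lceil>2 * \<bar>B\<bar>\<rceil>"
  define g where "g c = (\<Sum>j<p - 1. of_int (c j) * \<zeta> ^ j)" for c :: "nat \<Rightarrow> int"
  have "?F \<subseteq> g ` PiE {..<p - 1} (\<lambda>_. {-N..N})"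
  proof
    fix x assume x: "x \<in> ?F"
    then obtain c where c: "x = (\<Sum>j<p - 1. of_int (c j) * \<zeta> ^ j)" using Oz_coords by blast
    have tr: "cmod (Tr (x * \<zeta> ^ i)) \<le> real p * \<bar>B\<bar>" for i
    proof -
      have "cmod (Tr (x * \<zeta> ^ i)) \<le> (\<Sum>k\<in>{1..<p}. \<bar>B\<bar>)"
        unfolding Tr_def
      proof (rule sum_norm_le)
        fix k assume k: "k \<in> {1..<p}"
        then have nd: "\<not> p dvd k" by (rule not_dvd_range)
        have "cmod (sig k x) \<le> B" using x k by blast
        moreover have "sig k (x * \<zeta> ^ i) = sig k x * \<zeta> ^ (k * i)"
          using x by (simp only: sig_simps(3)[OF nd] sig_zeta_power[OF nd] mem_Collect_eq Oz_simps)
        ultimately show "cmod (sig k (x * \<zeta> ^ i)) \<le> \<bar>B\<bar>" by (simp only: norm_mult norm_zeta)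
      qed
      also have "\<dots> \<le> real p * \<bar>B\<bar>" by (simp add: mult_right_mono)
      finally show ?thesis .
    qed
    have "c j \<in> {-N..N}" if j: "j < p - 1" for j
    proof -
      have "real p * \<bar>of_int (c j)\<bar> = cmod (of_nat p * of_int (c j))" by (simp add: norm_mult)
      also have "\<dots> = cmod (Tr (x * \<zeta> ^ (p - j)) - Tr (x * \<zeta> ^ 1))" using Tr_coeff[OF j c] by simp
      also have "\<dots> \<le> real p * \<bar>B\<bar> + real p * \<bar>B\<bar>"
        by (rule order.trans[OF norm_triangle_ineq4 add_mono[OF tr tr]])
      finally have "real p * \<bar>of_int (c j)\<bar> \<le> real p * (2 * \<bar>B\<bar>)" by simp
      then have "\<bar>of_int (c j)\<bar> \<le> 2 * \<bar>B\<bar>" by simp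
      then have "\<bar>c j\<bar> \<le> N" unfolding N_def by linarith
      then show ?thesis by auto
    qed
    then have "restrict c {..<p - 1} \<in> PiE {..<p - 1} (\<lambda>_. {-N..N})" by auto
    moreover have "x = g (restrict c {..<p - 1})" by (simp add: c g_def)
    ultimately show "x \<in> g ` PiE {..<p - 1} (\<lambda>_. {-N..N})" by blast
  qed
  then show ?thesis by (rule finite_subset) (intro finite_imageI finite_PiE, auto)
qed

text \<open>The unit cube containing the logarithms of a unit. The conjugates come in complex conjugate pairs and
  the logarithms sum to 0, so \<open>(p - 3) / 2\<close> coordinates determine all of them.\<close>
definition cell :: "complex \<Rightarrow> nat \<Rightarrow> int" where
  "cell u = (\<lambda>k\<in>{1..<hf}. \<lfloor>lg k u\<rfloor>)"

definition small_units :: "complex set" where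
  "small_units = {u \<in> units_Oz. \<forall>k\<in>{1..<p}. cmod (sig k u) \<le> exp (real hf)}"

lemma finite_small_units: "finite small_units"
  by (rule finite_subset[OF _ finite_bounded_conjugates[of "exp (real hf)"]])
    (auto simp: small_units_def units_Oz_def)

text \<open>The logarithms of the quotient have absolute value at most 1 in the first
  \<open>hf - 1\<close> coordinates; as all \<open>hf\<close> of them sum to 0, the last is at most
  \<open>hf\<close>. This is the origin of the bound \<open>exp hf\<close>.\<close>

lemma cell_eq_small:
  assumes uv: "u \<in> units_Oz" "v \<in> units_Oz" "cell u = cell v"
  shows "u / v \<in> small_units"
proof -
  have w: "u / v \<in> units_Oz" using uv by (intro units_Oz_closed)
  have sub: "{1..hf} \<subseteq> {1..<p}" using hf by auto
  have small: "\<bar>lg k (u / v)\<bar> \<le> 1" if k: "k \<in> {1..<hf}" for k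
  proof -
    have "\<lfloor>lg k u\<rfloor> = \<lfloor>lg k v\<rfloor>" using fun_cong[OF uv(3), of k] k by (simp add: cell_def)
    moreover have "k \<in> {1..<p}" using k hf(3) by auto
    then have "lg k (u / v) = lg k u - lg k v" using uv by (intro lg_divide)
    ultimately show ?thesis by linarith
  qed
  have "{1..hf} = insert hf {1..<hf}" using hf(2) by auto
  then have "lg hf (u / v) = - (\<Sum>k\<in>{1..<hf}. lg k (u / v))" using sum_lg[OF w] by simp
  moreover have "\<bar>\<Sum>k\<in>{1..<hf}. lg k (u / v)\<bar> \<le> (\<Sum>k\<in>{1..<hf}. 1)"
    by (rule order.trans[OF sum_abs sum_mono[OF small]])
  ultimately have last: "\<bar>lg hf (u / v)\<bar> \<le> real hf" by simp
  have le: "lg k (u / v) \<le> real hf" if k: "k \<in> {1..hf}" for k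
    using small[of k] last hf(2) k by (cases "k = hf") (auto simp: abs_le_iff)
  have "lg k (u / v) \<le> real hf" if k: "k \<in> {1..<p}" for k
  proof (cases "k \<le> hf")
    case False
    then have "lg (p - k) (u / v) \<le> real hf" using k hf(3) by (intro le) auto
    then show ?thesis using lg_complement[OF k w] by simp
  qed (use k le in auto)
  then have "cmod (sig k (u / v)) \<le> exp (real hf)" if k: "k \<in> {1..<p}" for k
    using k sig_units_Oz_pos[OF k w] unfolding lg_def by (metis exp_le_cancel_iff exp_ln)
  then show ?thesis using w by (simp only: small_units_def mem_Collect_eq) blast
qed

lemma card_units_cells:
  assumes U: "U \<subseteq> units_Oz" "finite U" and C: "finite C" "cell ` U \<subseteq> C"
  shows "card U \<le> card small_units * card C"
proof -
  have "card U \<le> (\<Sum>c\<in>C. card {u \<in> U. cell u = c})"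
  proof -
    have "U = (\<Union>c\<in>C. {u \<in> U. cell u = c})" using C by auto
    then show ?thesis using card_UN_le[OF C(1)] by metis
  qed
  also have "\<dots> \<le> (\<Sum>c\<in>C. card small_units)"
  proof (rule sum_mono)
    fix c
    show "card {u \<in> U. cell u = c} \<le> card small_units"
    proof (cases "{u \<in> U. cell u = c} = {}")
      case False
      then obtain v where v: "v \<in> U" "cell v = c" by blast
      then have "v \<noteq> 0" using U units_Oz_nz by blast
      then have "inj_on (\<lambda>u. u / v) {u \<in> U. cell u = c}" by (intro inj_onI) simp
      moreover have "(\<lambda>u. u / v) ` {u \<in> U. cell u = c} \<subseteq> small_units"
        using U v by (intro image_subsetI cell_eq_small) auto
      ultimately show ?thesis by (rule card_inj_on_le[OF _ _ finite_small_units])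
    next
      case True
      show ?thesis unfolding True by simp
    qed
  qed
  finally show ?thesis by (simp add: mult.commute)
qed

section \<open>Units modulo p-th powers\<close>

definition torsion :: "complex set" where "torsion = {z \<in> units_Oz. \<exists>m>0. z ^ m = 1}"

definition digits_prod :: "complex list \<Rightarrow> complex" where
  "digits_prod xs = foldr (\<lambda>x y. x * y ^ p) xs 1"

lemma digits_prod_simps [simp]: "digits_prod [] = 1" "digits_prod (x # xs) = x * digits_prod xs ^ p"
  by (simp_all add: digits_prod_def)

lemma digits_prod_units_Oz: "set xs \<subseteq> units_Oz \<Longrightarrow> digits_prod xs \<in> units_Oz"
  by (induction xs) (auto intro: units_Oz_closed)

definition unit_rel :: "complex \<Rightarrow> complex \<Rightarrow> bool" where
  "unit_rel u v \<longleftrightarrow> (\<exists>z\<in>torsion. \<exists>w\<in>units_Oz. u = v * z * w ^ p)"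

lemma torsion_closed: "1 \<in> torsion" "z \<in> torsion \<Longrightarrow> w \<in> torsion \<Longrightarrow> z * w \<in> torsion" "z \<in> torsion \<Longrightarrow> inverse z \<in> torsion"
  "w \<in> units_Oz \<Longrightarrow> w ^ Suc k \<in> torsion \<Longrightarrow> w \<in> torsion"
proof -
  show "1 \<in> torsion" by (auto simp: torsion_def units_Oz_closed intro: exI[of _ 1])
  assume "z \<in> torsion"
  then obtain m where m: "m > 0" "z ^ m = 1" "z \<in> units_Oz" by (auto simp: torsion_def)
  show "inverse z \<in> torsion" using m by (auto simp: torsion_def units_Oz_closed power_inverse)
  assume "w \<in> torsion"
  then obtain n where n: "n > 0" "w ^ n = 1" "w \<in> units_Oz" by (auto simp: torsion_def)
  have "(z * w) ^ (m * n) = (z ^ m) ^ n * (w ^ n) ^ m"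
    by (simp add: power_mult_distrib power_mult[symmetric] mult.commute)
  then have "(z * w) ^ (m * n) = 1" using m n by simp
  then show "z * w \<in> torsion" using m n by (auto simp: torsion_def units_Oz_closed intro!: exI[of _ "m * n"])
next
  assume w: "w \<in> units_Oz" "w ^ Suc k \<in> torsion"
  then obtain m where "m > 0" "(w ^ Suc k) ^ m = 1" by (auto simp: torsion_def)
  then have "w ^ (Suc k * m) = 1" "Suc k * m > 0" by (simp_all only: power_mult) simp
  then show "w \<in> torsion" using w by (auto simp only: torsion_def)
qed

text \<open>Reading a product as a number in base \<open>p\<close> with digits in \<open>S\<close>: independence modulo \<open>p\<close>-th powers
  identifies the lowest digit.\<close>
lemma digits_prod_inj:
  assumes S: "S \<subseteq> units_Oz" "\<And>x y. x \<in> S \<Longrightarrow> y \<in> S \<Longrightarrow> unit_rel x y \<Longrightarrow> x = y"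
  shows "length xs = length ys \<Longrightarrow> set xs \<subseteq> S \<Longrightarrow> set ys \<subseteq> S \<Longrightarrow> z \<in> torsion \<Longrightarrow>
    digits_prod xs = z * digits_prod ys \<Longrightarrow> xs = ys"
proof (induction xs ys arbitrary: z rule: list_induct2)
  case (Cons x xs y ys)
  let ?X = "digits_prod xs" and ?Y = "digits_prod ys"
  have XY: "?X \<in> units_Oz" "?Y \<in> units_Oz" using Cons.prems S(1) by (auto intro!: digits_prod_units_Oz)
  have nz: "?X \<noteq> 0" "?Y \<noteq> 0" using XY units_Oz_nz by auto
  have eq: "x * ?X ^ p = z * (y * ?Y ^ p)" using Cons.prems(4) by simp
  have "x = x * ?X ^ p / ?X ^ p" using nz by simp
  also have "\<dots> = y * z * (?Y / ?X) ^ p" unfolding eq by (simp add: power_divide)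
  finally have "x = y * z * (?Y / ?X) ^ p" .
  moreover have "?Y / ?X \<in> units_Oz" using XY by (intro units_Oz_closed)
  ultimately have "unit_rel x y" unfolding unit_rel_def using Cons.prems(3) by blast
  then have xy: "x = y" using S(2) Cons.prems by simp
  have "x \<noteq> 0" using Cons.prems S(1) units_Oz_nz by auto
  moreover have "x * ?X ^ p = x * (z * ?Y ^ p)" using eq xy by simp
  ultimately have "?X ^ p = z * ?Y ^ p" by simp
  \<comment> \<open>The quotient of the higher digits is torsion because its p-th power is. It
    replaces z in the induction, which is why the claim allows a torsion factor.\<close>
  then have "(?X / ?Y) ^ p = z" using nz by (simp add: power_divide)
  then have "(?X / ?Y) ^ Suc (p - 1) \<in> torsion" using Cons.prems(3) by simp
  then have "?X / ?Y \<in> torsion" by (rule torsion_closed(4)[OF units_Oz_closed(4)[OF XY]])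
  moreover have "?X = (?X / ?Y) * ?Y" using nz by simp
  ultimately have "xs = ys" using Cons.IH[of "?X / ?Y"] Cons.prems by auto
  with xy show ?case by simp
qed simp

text \<open>A geometric sum; the \<open>- 1\<close> in the bound is what absorbs the lowest digit in
  the induction step.\<close>

lemma lg_digits_prod:
  assumes "k \<in> {1..<p}" "A \<ge> 0" "\<And>x. x \<in> S \<Longrightarrow> \<bar>lg k x\<bar> \<le> A" "S \<subseteq> units_Oz"
  shows "set xs \<subseteq> S \<Longrightarrow> \<bar>lg k (digits_prod xs)\<bar> \<le> A * (real p ^ length xs - 1)"
proof (induction xs)
  case (Cons x xs)
  let ?X = "digits_prod xs"
  have X: "?X \<in> units_Oz" "x \<in> units_Oz" "x \<in> S" using Cons.prems assms(4)
    by (auto intro!: digits_prod_units_Oz)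
  have "lg k (digits_prod (x # xs)) = lg k x + real p * lg k ?X"
    using X assms(1) by (simp only: digits_prod_simps lg_mult lg_power units_Oz_closed)
  then have "\<bar>lg k (digits_prod (x # xs))\<bar> \<le> \<bar>lg k x\<bar> + real p * \<bar>lg k ?X\<bar>"
    by (metis abs_mult abs_of_nat abs_triangle_ineq)
  also have "\<dots> \<le> A + real p * (A * (real p ^ length xs - 1))"
    using assms(3)[OF X(3)] Cons by (intro add_mono mult_left_mono) auto
  also have "\<dots> = A * (real p ^ length (x # xs) - real p + 1)" by (simp add: algebra_simps)
  also have "\<dots> \<le> A * (real p ^ length (x # xs) - 1)"
    using assms(2) p_gt_2 by (intro mult_left_mono) auto
  finally show ?case .
qed (use lg_1[OF assms(1)] in simp)

text \<open>Growth rates: there are |S|^m digit products of length m, all distinct, with logarithms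
  at most A p^m. They fall into at most (3 A p^m)^(hf-1) cells, each holding a bounded number of
  units. If |S| exceeded p^(hf-1), large m would be impossible.\<close>

lemma card_independent_units:
  assumes S: "finite S" "S \<subseteq> units_Oz" "\<And>x y. x \<in> S \<Longrightarrow> y \<in> S \<Longrightarrow> unit_rel x y \<Longrightarrow> x = y"
  shows "card S \<le> p ^ (hf - 1)"
proof (rule ccontr)
  assume big: "\<not> card S \<le> p ^ (hf - 1)"
  define T where "T = insert 0 ((\<lambda>(k, x). \<bar>lg k x\<bar>) ` ({1..<p} \<times> S))"
  have finT: "finite T" using S by (simp add: T_def)
  define A :: nat where "A = Suc (nat \<lceil>Max T\<rceil>)"
  have A: "\<bar>lg k x\<bar> \<le> real A" if "k \<in> {1..<p}" "x \<in> S" for k x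
  proof -
    have "\<bar>lg k x\<bar> \<in> T" using that by (force simp: T_def)
    then have "\<bar>lg k x\<bar> \<le> Max T" using finT by (rule Max_ge[rotated])
    then show ?thesis unfolding A_def by linarith
  qed
  define c where "c = real (card small_units) * (3 * real A) ^ (hf - 1)"
  have key: "real (card S) ^ m \<le> c * (real p ^ (hf - 1)) ^ m" for m
  proof -
    let ?L = "{xs. set xs \<subseteq> S \<and> length xs = m}"
    define U where "U = digits_prod ` ?L"
    have inj: "inj_on digits_prod ?L"
    proof (rule inj_onI)
      fix xs ys assume "xs \<in> ?L" "ys \<in> ?L" "digits_prod xs = digits_prod ys"
      then show "xs = ys" using digits_prod_inj[OF S(2,3), of xs ys 1] torsion_closed(1) by simp
    qed
    have finL: "finite ?L" and cardL: "card ?L = card S ^ m"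
      using finite_lists_length_eq[OF S(1)] card_lists_length_eq[OF S(1)] by auto
    have cardU: "card U = card S ^ m" unfolding U_def using card_image[OF inj] cardL by simp
    have U: "U \<subseteq> units_Oz" "finite U" using S(2) finL by (auto simp: U_def intro!: digits_prod_units_Oz)
    define b where "b = int (A * p ^ m)"
    let ?C = "PiE {1..<hf} (\<lambda>_. {-b..b})"
    have finC: "finite ?C" by (intro finite_PiE) auto
    have "cell ` U \<subseteq> ?C"
    proof (rule image_subsetI)
      fix u assume "u \<in> U"
      then obtain xs where xs: "u = digits_prod xs" "set xs \<subseteq> S" "length xs = m" by (auto simp: U_def)
      have "\<lfloor>lg k u\<rfloor> \<in> {-b..b}" if k: "k \<in> {1..<hf}" for k
      proof -
        have k': "k \<in> {1..<p}" using k hf(3) by auto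
        have "\<bar>lg k u\<bar> \<le> real A * (real p ^ m - 1)"
          unfolding xs(1) xs(3)[symmetric] by (rule lg_digits_prod[OF k' _ A[OF k'] S(2) xs(2)]) auto
        also have "\<dots> \<le> real A * real p ^ m" by (intro mult_left_mono) auto
        also have "\<dots> = real_of_int b" by (simp add: b_def)
        finally show ?thesis by (simp add: abs_le_iff le_floor_iff floor_le_iff)
      qed
      then show "cell u \<in> ?C" unfolding cell_def by (intro restrict_PiE_iff[THEN iffD2] ballI)
    qed
    from card_units_cells[OF U finC this]
    have "card S ^ m \<le> card small_units * card ?C" by (simp only: cardU)
    also have "card ?C = (nat (2 * b + 1)) ^ (hf - 1)" by (simp add: card_PiE)
    finally have le: "real (card S ^ m) \<le> real (card small_units * nat (2 * b + 1) ^ (hf - 1))"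
      by (simp only: of_nat_le_iff)
    have "1 * 1 \<le> A * p ^ m" unfolding A_def by (intro mult_le_mono) auto
    \<comment> \<open>A is a successor, so A p^m \<ge> 1 and the middle cell is absorbed.\<close>
    then have "nat (2 * b + 1) \<le> 3 * (A * p ^ m)" unfolding b_def by linarith
    then have "nat (2 * b + 1) ^ (hf - 1) \<le> (3 * (A * p ^ m)) ^ (hf - 1)" by (rule power_mono) simp
    then have "real (nat (2 * b + 1) ^ (hf - 1)) \<le> real ((3 * (A * p ^ m)) ^ (hf - 1))"
      by (simp only: of_nat_le_iff)
    also have "\<dots> = (3 * real A) ^ (hf - 1) * (real p ^ (hf - 1)) ^ m"
      by (simp add: power_mult_distrib power_mult[symmetric] mult.commute)
    finally have "real (card small_units) * real (nat (2 * b + 1) ^ (hf - 1)) \<le> c * (real p ^ (hf - 1)) ^ m"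
      unfolding c_def mult.assoc by (rule mult_left_mono) simp
    with le show ?thesis by simp
  qed
  let ?r = "real (card S) / real p ^ (hf - 1)"
  have P: "real p ^ (hf - 1) > 0" by simp
  have "real (p ^ (hf - 1)) < real (card S)" using big by (simp only: of_nat_less_iff not_le)
  then have "?r > 1" using P by (simp add: field_simps)
  then obtain m where "c < ?r ^ m" using real_arch_pow by blast
  then have "c * (real p ^ (hf - 1)) ^ m < real (card S) ^ m" using P by (simp add: power_divide field_simps)
  with key[of m] show False by simp
qed

lemma finite_torsion: "finite torsion"
proof (rule finite_subset[OF _ finite_bounded_conjugates[of 1]])
  show "torsion \<subseteq> {x \<in> Oz. \<forall>k\<in>{1..<p}. cmod (sig k x) \<le> 1}"
  proof (intro subsetI CollectI conjI ballI)
    fix z k assume z: "z \<in> torsion" and k: "k \<in> {1..<p}"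
    then obtain m where m: "m > 0" "z ^ m = 1" "z \<in> units_Oz" by (auto simp: torsion_def)
    have "real m * lg k z = 0" using lg_power[OF k m(3), of m] lg_1[OF k] m(2) by simp
    then have "lg k z = 0" using m by simp
    then show "cmod (sig k z) \<le> 1" using sig_units_Oz_pos[OF k m(3)] by (simp add: lg_def)
  qed (auto simp: torsion_def units_Oz_def)
qed

text \<open>For the finite group T of torsion units, |T| \<le> p |T^p| since a number has at most p
  roots of order p, while independence makes the products of S and T^p distinct, so |S| |T^p| \<le>
  |T|.\<close>

lemma card_independent_torsion:
  assumes S: "finite S" "S \<subseteq> torsion" "\<And>x y. x \<in> S \<Longrightarrow> y \<in> S \<Longrightarrow> \<exists>w\<in>torsion. x = y * w ^ p \<Longrightarrow> x = y"
  shows "card S \<le> p"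
proof -
  let ?Q = "(\<lambda>z. z ^ p) ` torsion"
  have finQ: "finite ?Q" using finite_torsion by simp
  have nz: "z \<noteq> 0" if "z \<in> torsion" for z using that units_Oz_nz by (auto simp: torsion_def)
  have "torsion = (\<Union>c\<in>?Q. {z \<in> torsion. z ^ p = c})" by auto
  then have "card torsion \<le> (\<Sum>c\<in>?Q. card {z \<in> torsion. z ^ p = c})" using card_UN_le[OF finQ] by metis
  also have "\<dots> \<le> (\<Sum>c\<in>?Q. p)"
  proof (rule sum_mono)
    fix c assume "c \<in> ?Q"
    then have "c \<noteq> 0" using nz by auto
    then have "card {z. z ^ p = c} = p" by (intro card_nth_roots) auto
    moreover have "finite {z. z ^ p = c}" using calculation p_pos(2) by (metis card.infinite)
    ultimately show "card {z \<in> torsion. z ^ p = c} \<le> p"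
      using card_mono[of "{z. z ^ p = c}" "{z \<in> torsion. z ^ p = c}"] by auto
  qed
  finally have 1: "card torsion \<le> card ?Q * p" by simp
  have powc: "w ^ k \<in> torsion" if "w \<in> torsion" for w k using that
    by (induction k) (auto intro: torsion_closed)
  have "inj_on (\<lambda>(s, q). s * q) (S \<times> ?Q)"
  proof (rule inj_onI, clarify)
    fix s v s' v' assume *: "s \<in> S" "s' \<in> S" "v \<in> torsion" "v' \<in> torsion" "s * v ^ p = s' * v' ^ p"
    have "s = s * v ^ p / v ^ p" using nz[OF *(3)] by simp
    also have "\<dots> = s' * (v' * inverse v) ^ p"
      unfolding *(5) by (simp add: power_mult_distrib power_inverse divide_inverse)
    finally have "s = s' * (v' * inverse v) ^ p" .
    moreover have "v' * inverse v \<in> torsion" by (rule torsion_closed(2)[OF *(4) torsion_closed(3)[OF *(3)]])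
    ultimately have "s = s'" using S(3) * by blast
    moreover have "s \<noteq> 0" using * S nz by blast
    ultimately show "s = s' \<and> v ^ p = v' ^ p" using * by simp
  qed
  moreover have "(\<lambda>(s, q). s * q) ` (S \<times> ?Q) \<subseteq> torsion" using S powc torsion_closed by auto
  ultimately have "card (S \<times> ?Q) \<le> card torsion" by (rule card_inj_on_le[OF _ _ finite_torsion])
  then have "card S * card ?Q \<le> card ?Q * p" using 1 unfolding card_cartesian_product by (rule order.trans)
  moreover have "card ?Q > 0" using finQ torsion_closed(1) by (auto simp: card_gt_0_iff)
  ultimately show ?thesis by simp
qed

text \<open>The factor p^(hf-1) counts units modulo torsion and p-th powers, the remaining p counts
  torsion modulo p-th powers.\<close>

lemma units_mod_powers:
  "\<exists>B\<subseteq>units_Oz. finite B \<and> card B \<le> p ^ hf \<and> (\<forall>u\<in>units_Oz. \<exists>b\<in>B. \<exists>v\<in>units_Oz. u = b * v ^ p)"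
proof -
  have "\<exists>S\<subseteq>units_Oz. finite S \<and> card S \<le> p ^ (hf - 1) \<and> (\<forall>x\<in>units_Oz. \<exists>s\<in>S. unit_rel x s)"
  proof (rule max_transversal)
    fix x y assume "x \<in> units_Oz" "y \<in> units_Oz" "unit_rel x y"
    then obtain z w where zw: "z \<in> torsion" "w \<in> units_Oz" "x = y * z * w ^ p" by (auto simp: unit_rel_def)
    then have "z \<noteq> 0" "w \<noteq> 0" using units_Oz_nz by (auto simp: torsion_def)
    then have "y = x * inverse z * inverse w ^ p" using zw by (simp add: power_inverse field_simps)
    then show "unit_rel y x" unfolding unit_rel_def using zw torsion_closed units_Oz_closed by blast
  next
    fix x assume "x \<in> units_Oz"
    have "x = x * 1 * 1 ^ p" by simp
    then show "unit_rel x x" unfolding unit_rel_def using torsion_closed(1) units_Oz_closed(1) by blast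
  qed (use card_independent_units in blast)
  then obtain S where S: "S \<subseteq> units_Oz" "finite S" "card S \<le> p ^ (hf - 1)" "\<forall>x\<in>units_Oz. \<exists>s\<in>S. unit_rel x s"
    by blast
  have "\<exists>Z\<subseteq>torsion. finite Z \<and> card Z \<le> p \<and> (\<forall>x\<in>torsion. \<exists>s\<in>Z. \<exists>w\<in>torsion. x = s * w ^ p)"
  proof (rule max_transversal)
    fix x y assume "x \<in> torsion" "y \<in> torsion" "\<exists>w\<in>torsion. x = y * w ^ p"
    then obtain w where w: "w \<in> torsion" "x = y * w ^ p" by blast
    then have "w \<noteq> 0" using units_Oz_nz by (auto simp: torsion_def)
    then have "y = x * inverse w ^ p" using w by (simp add: power_inverse field_simps)
    then show "\<exists>w\<in>torsion. y = x * w ^ p" using w torsion_closed by blast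
  next
    fix x assume "x \<in> torsion"
    have "x = x * 1 ^ p" by simp
    then show "\<exists>w\<in>torsion. x = x * w ^ p" using torsion_closed(1) by blast
  qed (use card_independent_torsion in blast)
  then obtain Z where Z: "Z \<subseteq> torsion" "finite Z" "card Z \<le> p" "\<forall>x\<in>torsion. \<exists>s\<in>Z. \<exists>w\<in>torsion. x = s * w ^ p"
    by blast
  define B where "B = (\<lambda>(s, z). s * z) ` (S \<times> Z)"
  have "card B \<le> card (S \<times> Z)" unfolding B_def using S Z by (intro card_image_le) auto
  also have "\<dots> \<le> p ^ (hf - 1) * p" using S Z by (simp add: card_cartesian_product mult_le_mono)
  also have "\<dots> = p ^ hf" using hf(2) by (intro power_minus_mult) simp
  finally have "card B \<le> p ^ hf" .
  moreover have "finite B" using S Z by (simp add: B_def)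
  moreover have torU: "torsion \<subseteq> units_Oz" by (auto simp: torsion_def)
  then have "B \<subseteq> units_Oz" using S(1) Z(1) unfolding B_def by (auto intro!: units_Oz_closed(2))
  moreover have "\<exists>b\<in>B. \<exists>v\<in>units_Oz. u = b * v ^ p" if u: "u \<in> units_Oz" for u
  proof -
    obtain s z w where 1: "s \<in> S" "z \<in> torsion" "w \<in> units_Oz" "u = s * z * w ^ p"
      using S(4) u unfolding unit_rel_def by blast
    obtain t y where 2: "t \<in> Z" "y \<in> torsion" "z = t * y ^ p" using Z(4) 1(2) by blast
    have "u = (s * t) * (y * w) ^ p" unfolding 1(4) 2(3) by (simp add: power_mult_distrib mult_ac)
    moreover have "s * t \<in> B" using 1 2 by (auto simp: B_def)
    moreover have "y * w \<in> units_Oz" using 1 2 torU by (intro units_Oz_closed) auto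
    ultimately show ?thesis by blast
  qed
  ultimately show ?thesis by blast
qed

end


section \<open>Ranks of finite abelian groups\<close>

lemma (in group) rcoset_eq_iff:
  assumes "subgroup H G" "a \<in> carrier G" "b \<in> carrier G"
  shows "H #> a = H #> b \<longleftrightarrow> a \<otimes> inv b \<in> H"
proof
  assume "H #> a = H #> b"
  then have "a \<in> H #> b" using rcos_self[OF assms(2,1)] by simp
  then show "a \<otimes> inv b \<in> H" using subgroup.rcos_module[OF assms(1) is_group assms(3,2)] by simp
next
  assume "a \<otimes> inv b \<in> H"
  then have "a \<in> H #> b" using subgroup.rcos_module[OF assms(1) is_group assms(3,2)] by simp
  then show "H #> a = H #> b" using repr_independence[OF _ assms(3,1)] by simp
qed

lemma (in group) rcoset_eq_self_iff:
  assumes "subgroup H G" "a \<in> carrier G"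
  shows "H #> a = H \<longleftrightarrow> a \<in> H"
  using rcoset_eq_iff[OF assms one_closed] assms(2) subgroup.subset[OF assms(1)] by simp

lemma (in comm_group) pow_in_hom: "(\<lambda>x. x [^] (n :: nat)) \<in> hom G G"
  by (intro homI) (simp_all add: nat_pow_distrib)

lemma (in comm_group) subgroup_power_subgroup: "subgroup (power_subgroup n G) G"
proof -
  interpret h: group_hom G G "\<lambda>x. x [^] n"
    by (intro group_hom.intro group_hom_axioms.intro is_group pow_in_hom)
  show ?thesis unfolding power_subgroup_def by (rule h.img_is_subgroup)
qed

lemma (in comm_group) comm_group_subgroup:
  assumes "subgroup H G"
  shows "comm_group (G\<lparr>carrier := H\<rparr>)"
proof (rule group.group_comm_groupI)
  show "group (G\<lparr>carrier := H\<rparr>)" using subgroup.subgroup_is_group[OF assms is_group] .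
  show "x \<otimes>\<^bsub>G\<lparr>carrier := H\<rparr>\<^esub> y = y \<otimes>\<^bsub>G\<lparr>carrier := H\<rparr>\<^esub> x"
    if "x \<in> carrier (G\<lparr>carrier := H\<rparr>)" "y \<in> carrier (G\<lparr>carrier := H\<rparr>)" for x y
    using that subgroup.subset[OF assms] by (auto intro: m_comm)
qed

text \<open>The n-th power map has image G^n and kernel the n-torsion; Lagrange's theorem for both
  subgroups gives the equality. It exchanges the quotient in the definition of the rank for the
  p-torsion.\<close>

lemma (in comm_group) card_mod_power_subgroup:
  assumes fin: "finite (carrier G)"
  shows "card (carrier (G Mod power_subgroup n G)) = card {x \<in> carrier G. x [^] n = \<one>}"
proof -
  let ?P = "power_subgroup n G" and ?h = "\<lambda>x. x [^] n"
  have P: "subgroup ?P G" by (rule subgroup_power_subgroup)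
  let ?S = "G\<lparr>carrier := ?P\<rparr>"
  have hom: "?h \<in> hom G ?S"
    by (intro homI) (simp_all add: nat_pow_distrib power_subgroup_def)
  interpret h: group_hom G ?S ?h
    by (intro group_hom.intro group_hom_axioms.intro is_group hom subgroup.subgroup_is_group[OF P])
  have ker: "kernel G ?S ?h = {x \<in> carrier G. x [^] n = \<one>}" by (simp add: kernel_def)
  have "(\<lambda>U. the_elem (?h ` U)) \<in> iso (G Mod kernel G ?S ?h) ?S"
    by (rule h.FactGroup_iso_set) (simp add: power_subgroup_def)
  then have "card (carrier (G Mod kernel G ?S ?h)) = card ?P"
    by (auto simp: Group.iso_def dest: bij_betw_same_card)
  then have 1: "card (rcosets (kernel G ?S ?h)) = card ?P" by (simp add: FactGroup_def)
  have "card (rcosets (kernel G ?S ?h)) * card (kernel G ?S ?h) = card (rcosets ?P) * card ?P"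
    using lagrange[OF h.subgroup_kernel] lagrange[OF P] by simp
  moreover have "card ?P > 0"
    using subgroup.subset[OF P] fin subgroup.one_closed[OF P] by (metis card_gt_0_iff empty_iff finite_subset)
  ultimately have "card (rcosets ?P) = card (kernel G ?S ?h)" using 1 by simp
  then show ?thesis using ker by (simp add: FactGroup_def)
qed

text \<open>Coordinates with respect to a basis identify the quotient with the vectors of length r
  over Z/p. From here on ranks are exponents of cardinalities.\<close>

lemma rk_eq:
  assumes A: "comm_group A" and p: "Factorial_Ring.prime p"
    and fin: "finite (carrier (A Mod power_subgroup p A))"
  shows "\<exists>r. rk p A = enat r \<and> card (carrier (A Mod power_subgroup p A)) = p ^ r"
proof -
  define Q where "Q = A Mod power_subgroup p A"
  define F where "F = residue_ring (int p)"
  define V where "V = mod_powers p A"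
  interpret A: comm_group A by (rule A)
  have P: "subgroup (power_subgroup p A) A" by (rule A.subgroup_power_subgroup)
  interpret Q: comm_group Q unfolding Q_def by (rule A.abelian_FactGroup[OF P])
  interpret N: normal "power_subgroup p A" A by (rule A.subgroup_imp_normal[OF P])
  have V_simps: "carrier V = carrier Q" "\<zero>\<^bsub>V\<^esub> = \<one>\<^bsub>Q\<^esub>" "x \<oplus>\<^bsub>V\<^esub> y = x \<otimes>\<^bsub>Q\<^esub> y"
    "k \<odot>\<^bsub>V\<^esub> x = x [^]\<^bsub>Q\<^esub> k" for x y k
    by (simp_all add: V_def mod_powers_def Let_def Q_def)
  have p1: "int p > 1" using prime_gt_1_nat[OF p] by simp
  have F_simps: "carrier F = {0..int p - 1}" "\<one>\<^bsub>F\<^esub> = 1" "\<zero>\<^bsub>F\<^esub> = 0" "a \<oplus>\<^bsub>F\<^esub> b = (a + b) mod int p"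
    "a \<otimes>\<^bsub>F\<^esub> b = (a * b) mod int p" for a b
    by (simp_all add: F_def residue_ring_def)
  have exp: "x [^]\<^bsub>Q\<^esub> p = \<one>\<^bsub>Q\<^esub>" if x: "x \<in> carrier Q" for x
  proof -
    obtain a where a: "a \<in> carrier A" "x = power_subgroup p A #>\<^bsub>A\<^esub> a"
      using x by (auto simp: Q_def carrier_FactGroup)
    have "x [^]\<^bsub>Q\<^esub> p = power_subgroup p A #>\<^bsub>A\<^esub> (a [^]\<^bsub>A\<^esub> p)"
      unfolding Q_def a(2) by (rule N.FactGroup_pow[OF a(1)])
    also have "\<dots> = power_subgroup p A"
      using A.rcoset_eq_self_iff[OF P, of "a [^]\<^bsub>A\<^esub> p"] a(1) by (simp add: power_subgroup_def)
    finally show ?thesis by (simp add: Q_def)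
  qed
  \<comment> \<open>Scalars are residues 0, ..., p - 1 with sums and products reduced modulo p; the
    module laws hold because exponents matter only modulo p.\<close>
  have pow_mod: "x [^]\<^bsub>Q\<^esub> (k mod int p) = x [^]\<^bsub>Q\<^esub> k" if x: "x \<in> carrier Q" for x and k :: int
  proof -
    have "x [^]\<^bsub>Q\<^esub> k = x [^]\<^bsub>Q\<^esub> (int p * (k div int p) + k mod int p)" by simp
    also have "\<dots> = x [^]\<^bsub>Q\<^esub> (int p * (k div int p)) \<otimes>\<^bsub>Q\<^esub> x [^]\<^bsub>Q\<^esub> (k mod int p)"
      by (rule Q.int_pow_mult[OF x])
    also have "x [^]\<^bsub>Q\<^esub> (int p * (k div int p)) = (x [^]\<^bsub>Q\<^esub> int p) [^]\<^bsub>Q\<^esub> (k div int p)"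
      by (rule Q.int_pow_pow[OF x, symmetric])
    also have "x [^]\<^bsub>Q\<^esub> int p = \<one>\<^bsub>Q\<^esub>" using exp[OF x] by (simp add: int_pow_int)
    finally show ?thesis using x by simp
  qed
  interpret F: residues_prime p F
    by unfold_locales (simp_all add: F_def p)
  interpret V: vectorspace F V
  proof (intro vectorspace.intro module.intro module_axioms.intro)
    show "cring F" by (rule F.cring)
    show "Ring.field F" by (rule F.is_field)
    show "abelian_group V"
    proof (rule abelian_groupI)
      fix x assume "x \<in> carrier V"
      then show "\<exists>y\<in>carrier V. y \<oplus>\<^bsub>V\<^esub> x = \<zero>\<^bsub>V\<^esub>"
        by (intro bexI[of _ "inv\<^bsub>Q\<^esub> x"]) (simp_all add: V_simps)
    qed (simp_all add: V_simps Q.m_ac)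
    show "a \<odot>\<^bsub>V\<^esub> x \<in> carrier V" if "x \<in> carrier V" for a b x using that by (simp add: V_simps)
    show "(a \<oplus>\<^bsub>F\<^esub> b) \<odot>\<^bsub>V\<^esub> x = a \<odot>\<^bsub>V\<^esub> x \<oplus>\<^bsub>V\<^esub> b \<odot>\<^bsub>V\<^esub> x" if "x \<in> carrier V" for a b x
      using that by (simp add: V_simps F_simps pow_mod Q.int_pow_mult)
    show "a \<odot>\<^bsub>V\<^esub> (x \<oplus>\<^bsub>V\<^esub> y) = a \<odot>\<^bsub>V\<^esub> x \<oplus>\<^bsub>V\<^esub> a \<odot>\<^bsub>V\<^esub> y" if "x \<in> carrier V" "y \<in> carrier V" for a x y
      using that by (simp add: V_simps Q.int_pow_mult_distrib Q.m_comm)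
    show "(a \<otimes>\<^bsub>F\<^esub> b) \<odot>\<^bsub>V\<^esub> x = a \<odot>\<^bsub>V\<^esub> (b \<odot>\<^bsub>V\<^esub> x)" if "x \<in> carrier V" for a b x
      using that by (simp add: V_simps F_simps pow_mod Q.int_pow_pow mult.commute)
    show "\<one>\<^bsub>F\<^esub> \<odot>\<^bsub>V\<^esub> x = x" if "x \<in> carrier V" for a b x using that by (simp add: V_simps F_simps)
  qed
  have finV: "finite (carrier V)" using fin by (simp add: V_simps Q_def)
  have "carrier V \<subseteq> V.span (carrier V)" by (intro V.in_own_span) simp
  then have "V.gen_set (carrier V)" using V.span_is_subset2[of "carrier V"] by blast
  then have fd: "V.fin_dim" unfolding V.fin_dim_def using finV by blast
  then obtain B where B: "finite B" "V.basis B" using V.finite_basis_exists by blast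
  have BV: "B \<subseteq> carrier V" using B by (simp add: V.basis_def)
  have crit: "\<forall>v. v \<in> carrier V \<longrightarrow> (\<exists>!a. a \<in> B \<rightarrow>\<^sub>E carrier F \<and> V.lincomb a B = v)"
    using V.basis_criterion[OF B(1) BV] B(2) by simp
  have "bij_betw (\<lambda>a. V.lincomb a B) (B \<rightarrow>\<^sub>E carrier F) (carrier V)"
  proof (rule bij_betwI')
    fix a b assume ab: "a \<in> B \<rightarrow>\<^sub>E carrier F" "b \<in> B \<rightarrow>\<^sub>E carrier F"
    then have "V.lincomb a B \<in> carrier V" using BV by (intro V.lincomb_closed) auto
    then show "(V.lincomb a B = V.lincomb b B) = (a = b)" using crit ab by metis
  next
    fix a assume "a \<in> B \<rightarrow>\<^sub>E carrier F"
    then show "V.lincomb a B \<in> carrier V" using BV by (intro V.lincomb_closed) auto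
  next
    fix v assume "v \<in> carrier V"
    then show "\<exists>a\<in>B \<rightarrow>\<^sub>E carrier F. v = V.lincomb a B" using crit by metis
  qed
  then have "card (carrier V) = card (B \<rightarrow>\<^sub>E carrier F)" by (simp add: bij_betw_same_card)
  also have "\<dots> = p ^ card B" using B(1) by (simp add: card_PiE F_simps)
  also have "card B = V.dim" using V.dim_basis[OF B] by simp
  finally have "card (carrier Q) = p ^ V.dim" by (simp add: V_simps)
  moreover have "rk p A = enat V.dim" unfolding rk_def Let_def F_def[symmetric] V_def[symmetric] using fd
    by simp
  ultimately show ?thesis by (auto simp: Q_def)
qed

lemma rk_exponent:
  assumes A: "comm_group A" and p: "Factorial_Ring.prime p" and fin: "finite (carrier A)"
    and exp: "\<And>x. x \<in> carrier A \<Longrightarrow> x [^]\<^bsub>A\<^esub> p = \<one>\<^bsub>A\<^esub>"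
  shows "\<exists>r. rk p A = enat r \<and> card (carrier A) = p ^ r"
proof -
  interpret comm_group A by (rule A)
  have eq: "card (carrier (A Mod power_subgroup p A)) = card (carrier A)"
    using card_mod_power_subgroup[OF fin, of p] exp
      by (metis (mono_tags, lifting) Collect_cong Collect_mem_eq)
  have "card (carrier A) > 0" using fin one_closed by (auto simp: card_gt_0_iff)
  then have "finite (carrier (A Mod power_subgroup p A))" using eq by (metis card_gt_0_iff)
  from rk_eq[OF A p this] show ?thesis using eq by simp
qed

lemma (in group) pow_mod_exponent:
  assumes "x \<in> carrier G" "x [^] (q :: nat) = \<one>"
  shows "x [^] (n mod q) = x [^] n"
proof -
  have "x [^] n = x [^] (q * (n div q) + n mod q)" by simp
  also have "\<dots> = (x [^] q) [^] (n div q) \<otimes> x [^] (n mod q)"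
    using assms(1) by (simp only: nat_pow_mult[symmetric] nat_pow_pow)
  finally show ?thesis using assms by simp
qed

text \<open>The definite description in \<open>sylow_part\<close> calls for uniqueness. In a
  commutative group a Sylow subgroup contains every element whose order is prime to its index: with
  order dividing p^a this gives uniqueness, with order dividing p it places the p-torsion
  inside.\<close>

lemma sylow_part_comm_group:
  fixes G (structure)
  assumes G: "comm_group G" and fin: "finite (carrier G)" and p: "Factorial_Ring.prime p"
  defines "S \<equiv> sylow_part p G"
  defines "T \<equiv> {x \<in> carrier G. x [^]\<^bsub>G\<^esub> p = \<one>\<^bsub>G\<^esub>}"
  shows "comm_group S" "finite (carrier S)" "{x \<in> carrier S. x [^]\<^bsub>S\<^esub> p = \<one>\<^bsub>S\<^esub>} = T" "\<one>\<^bsub>S\<^esub> = \<one>\<^bsub>G\<^esub>"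
proof -
  interpret comm_group G by (rule G)
  define a where "a = multiplicity p (Coset.order G)"
  have ord0: "Coset.order G > 0" using fin one_closed by (auto simp: Coset.order_def card_gt_0_iff)
  obtain m where m: "Coset.order G = p ^ a * m" "\<not> p dvd m"
    using multiplicity_decompose'[of "Coset.order G" p] ord0 p unfolding a_def
    by (metis less_numeral_extra(3) not_prime_unit)
  have cop: "coprime m p" using m(2) p by (metis coprime_commute prime_imp_coprime)
  obtain H where H: "subgroup H G" "card H = p ^ a" using sylow_thm[OF p is_group m(1) fin] by blast
  \<comment> \<open>The quotient by K has order m, so x^m lies in K, and x is a power of x^m because
    m is invertible modulo q.\<close>
  have mem: "x \<in> K"
    if K: "subgroup K G" "card K = p ^ a" and x: "x \<in> carrier G" "x [^] q = \<one>" "coprime m q" for K x q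
  proof -
    interpret N: normal K G by (rule subgroup_imp_normal[OF K(1)])
    interpret Q: group "G Mod K" by (rule N.factorgroup_is_group)
    have "card (rcosets K) * p ^ a = m * p ^ a" using lagrange[OF K(1)] K(2) m(1) by (metis mult.commute)
    moreover have "p ^ a > 0" using prime_gt_0_nat[OF p] by simp
    ultimately have "card (rcosets K) = m" by (metis mult_cancel2 less_numeral_extra(3))
    then have "Coset.order (G Mod K) = m" by (simp add: Coset.order_def FactGroup_def)
    moreover have "K #> x \<in> carrier (G Mod K)" using x by (auto simp: carrier_FactGroup)
    ultimately have "(K #> x) [^]\<^bsub>G Mod K\<^esub> m = K" using Q.pow_order_eq_1 by fastforce
    then have "K #> (x [^] m) = K" using N.FactGroup_pow[OF x(1)] by simp
    then have xm: "x [^] m \<in> K" using rcoset_eq_self_iff[OF K(1)] x by simp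
    obtain v where "[m * v = 1] (mod q)" using cong_solve_coprime_nat[OF x(3)] by auto
    then have v: "m * v mod q = 1 mod q" by (simp add: cong_def)
    have "x [^] (m * v) = x [^] (1 :: nat)"
      using pow_mod_exponent[OF x(1,2), of "m * v"] pow_mod_exponent[OF x(1,2), of 1] v by simp
    then have "(x [^] m) [^] v = x" using x by (simp add: nat_pow_pow)
    moreover have "(x [^] m) [^] v \<in> K"
      using xm by (induction v) (simp_all add: subgroup.one_closed[OF K(1)] subgroup.m_closed[OF K(1)])
    ultimately show ?thesis by simp
  qed
  have uniq: "K = H" if K: "subgroup K G" "card K = p ^ a" for K
  proof -
    have "K \<subseteq> H"
    proof
      fix x assume x: "x \<in> K"
      interpret K: group "G\<lparr>carrier := K\<rparr>" by (rule subgroup.subgroup_is_group[OF K(1) is_group])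
      have "x [^]\<^bsub>G\<lparr>carrier := K\<rparr>\<^esub> Coset.order (G\<lparr>carrier := K\<rparr>) = \<one>\<^bsub>G\<lparr>carrier := K\<rparr>\<^esub>"
        using x by (intro K.pow_order_eq_1) simp
      then have "x [^] (p ^ a) = \<one>" using K(2) by (simp add: Coset.order_def flip: nat_pow_consistent)
      then show "x \<in> H" using x subgroup.subset[OF K(1)] cop by (intro mem[OF H, of x "p ^ a"]) auto
    qed
    moreover have "finite H" using H fin subgroup.subset finite_subset by blast
    ultimately show ?thesis using K(2) H(2) card_subset_eq by metis
  qed
  have "(THE H. is_sylow_subgroup p G H) = H"
    unfolding is_sylow_subgroup_def a_def[symmetric]
  proof (rule the_equality)
    show "subgroup H G \<and> card H = p ^ a" using H by simp
    show "K = H" if "subgroup K G \<and> card K = p ^ a" for K using that uniq by blast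
  qed
  then have S: "S = G\<lparr>carrier := H\<rparr>" by (simp add: S_def sylow_part_def)
  show "comm_group S" unfolding S by (rule comm_group_subgroup[OF H(1)])
  show "finite (carrier S)" using H fin subgroup.subset finite_subset by (fastforce simp: S)
  show "\<one>\<^bsub>S\<^esub> = \<one>\<^bsub>G\<^esub>" by (simp add: S)
  have "T \<subseteq> H" using mem[OF H] cop unfolding T_def by blast
  then show "{x \<in> carrier S. x [^]\<^bsub>S\<^esub> p = \<one>\<^bsub>S\<^esub>} = T"
    using subgroup.subset[OF H(1)] nat_pow_consistent[of _ p H] unfolding S T_def by auto
qed

text \<open>The p-torsion of the Sylow subgroup is that of the whole group, so the rank can be read
  off without mentioning the Sylow subgroup.\<close>

lemma rk_sylow_part:
  assumes G: "comm_group G" and fin: "finite (carrier G)" and p: "Factorial_Ring.prime p"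
  shows "\<exists>r. rk p (sylow_part p G) = enat r \<and> card {x \<in> carrier G. x [^]\<^bsub>G\<^esub> p = \<one>\<^bsub>G\<^esub>} = p ^ r"
    and "carrier (sylow_part p G) = {\<one>\<^bsub>sylow_part p G\<^esub>} \<Longrightarrow> {x \<in> carrier G. x [^]\<^bsub>G\<^esub> p = \<one>\<^bsub>G\<^esub>} = {\<one>\<^bsub>G\<^esub>}"
proof -
  note S = sylow_part_comm_group[OF G fin p]
  interpret S: comm_group "sylow_part p G" by (rule S(1))
  let ?Q = "sylow_part p G Mod power_subgroup p (sylow_part p G)"
  have "finite (carrier ?Q)" using S(2) by (simp add: carrier_FactGroup)
  from rk_eq[OF S(1) p this] S.card_mod_power_subgroup[OF S(2), of p]
  show "\<exists>r. rk p (sylow_part p G) = enat r \<and> card {x \<in> carrier G. x [^]\<^bsub>G\<^esub> p = \<one>\<^bsub>G\<^esub>} = p ^ r"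
    unfolding S(3) by auto
  interpret comm_group G by (rule G)
  assume "carrier (sylow_part p G) = {\<one>\<^bsub>sylow_part p G\<^esub>}"
  then have "{x \<in> carrier G. x [^]\<^bsub>G\<^esub> p = \<one>\<^bsub>G\<^esub>} \<subseteq> {\<one>\<^bsub>G\<^esub>}" using S(3,4) by auto
  then show "{x \<in> carrier G. x [^]\<^bsub>G\<^esub> p = \<one>\<^bsub>G\<^esub>} = {\<one>\<^bsub>G\<^esub>}" by auto
qed


section \<open>Powers of the prime above p\<close>

context cyclotomic
begin

lemma one_minus_zeta_power_dvd_lam:
  assumes "\<not> p dvd k"
  shows "\<exists>y\<in>Oz. lam = (1 - \<zeta> ^ k) * y"
proof -
  obtain l where l: "k * l mod p = 1" using ex_inverse_mod[OF assms] by blast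
  have "\<zeta> = \<zeta> ^ (k * l mod p)" using l by simp
  also have "\<dots> = (\<zeta> ^ k) ^ l" by (simp only: zeta_mod power_mult)
  finally have "lam = 1 - (\<zeta> ^ k) ^ l" by (simp add: lam_def)
  also have "\<dots> = (1 - \<zeta> ^ k) * (\<Sum>i<l. (\<zeta> ^ k) ^ i)" by (rule one_diff_power_eq)
  finally show ?thesis by (intro bexI[of _ "\<Sum>i<l. (\<zeta> ^ k) ^ i"]) auto
qed

lemma max_ideal_power:
  assumes "max_ideal P" "x \<in> Oz" "x ^ n \<in> P"
  shows "x \<in> P"
  using assms(3)
proof (induction n)
  case 0
  then have "P = Oz" using int_ideal_eq_Oz assms(1) unfolding max_ideal_def by auto
  then show ?case using assms(2) by simp
next
  case (Suc n)
  then show ?case using max_ideal_prime[OF assms(1,2) Oz_power[OF assms(2), of n]] by auto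
qed

text \<open>Any maximal ideal above J contains \<open>lam\<close> and is therefore (lam). So a
  proper J is divisible by \<open>lam\<close>, and dividing it out lowers m.\<close>

lemma int_ideal_lam_power:
  assumes "int_ideal J" "lam ^ m \<in> J"
  shows "\<exists>k. J = scale (lam ^ k) Oz"
  using assms
proof (induction m arbitrary: J)
  case 0
  then have "J = Oz" by (intro int_ideal_eq_Oz) auto
  then show ?case by (intro exI[of _ 0]) simp
next
  case (Suc m)
  show ?case
  proof (cases "J = Oz")
    case True
    then show ?thesis by (intro exI[of _ 0]) simp
  next
    case False
    obtain P where P: "max_ideal P" "J \<subseteq> P" using ex_max_ideal[OF Suc.prems(1) False] by blast
    then have iP: "int_ideal P" by (simp add: max_ideal_def)
    have "lam \<in> P" using max_ideal_power[OF P(1) Oz_simps(7)] Suc.prems(2) P(2) by blast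
    then have "scale lam Oz \<subseteq> P" using frac_ideal_mult[OF int_ideal_frac_ideal[OF iP]]
      by (auto simp: scale_def mult.commute)
    then have "P = scale lam Oz" using max_ideal_cases[OF max_ideal_lam iP] P(1) by (auto simp: max_ideal_def)
    then have J: "J \<subseteq> scale lam Oz" using P(2) by simp
    define J' where "J' = scale (1 / lam) J"
    have JJ': "J = scale lam J'" by (simp add: J'_def scale_scale)
    have "frac_ideal J'" unfolding J'_def by (rule frac_ideal_scale) (auto simp: Suc.prems(1))
    moreover have "J' \<subseteq> Oz" using J unfolding J'_def scale_def by auto
    ultimately have "int_ideal J'" by (simp add: int_ideal_def del: int_ideal_frac_ideal)
    moreover have "lam ^ m \<in> J'" unfolding J'_def using Suc.prems(2) by (simp add: mem_scale_iff mult.commute)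
    ultimately obtain k where "J' = scale (lam ^ k) Oz" using Suc.IH by blast
    then show ?thesis unfolding JJ' by (intro exI[of _ "Suc k"]) (simp add: scale_scale)
  qed
qed

lemma scale_eq_imp_units_Oz:
  assumes "scale x Oz = scale y Oz" "y \<noteq> 0"
  shows "\<exists>u\<in>units_Oz. x = u * y"
proof -
  have "x \<in> scale x Oz" "y \<in> scale y Oz" by (auto simp: scale_def intro!: image_eqI[of _ _ 1])
  then have "x \<in> scale y Oz" "y \<in> scale x Oz" using assms(1) by simp_all
  then obtain u v where uv: "u \<in> Oz" "x = y * u" "v \<in> Oz" "y = x * v"
    unfolding scale_def by blast
  have "y * (u * v) = y * 1" using uv(2,4) by (metis mult.assoc mult.right_neutral)
  then have "u * v = 1" using assms(2) by (metis mult_cancel_left)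
  then have "u \<noteq> 0" "inverse u = v" using inverse_unique by auto
  then show ?thesis using uv by (intro bexI[of _ u]) (auto simp: units_Oz_def mult.commute)
qed

lemma scale_units_Oz:
  assumes "u \<in> units_Oz"
  shows "scale u Oz = Oz"
proof
  show "scale u Oz \<subseteq> Oz" using assms by (auto simp: scale_def units_Oz_def)
  show "Oz \<subseteq> scale u Oz"
  proof
    fix x assume "x \<in> Oz"
    then have "x / u \<in> Oz" using assms by (auto simp: units_Oz_def divide_inverse)
    then show "x \<in> scale u Oz" using assms by (simp add: mem_scale_iff units_Oz_def)
  qed
qed

lemma lam_power_divisor:
  assumes "x \<in> Oz" "y \<in> Oz" "x * y = lam ^ m"
  shows "\<exists>k. \<exists>u\<in>units_Oz. x = u * lam ^ k"
proof -
  have "x \<noteq> 0" using assms(3) by auto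
  then have "int_ideal (scale x Oz)" using assms(1) by (rule int_ideal_principal[rotated])
  moreover have "lam ^ m \<in> scale x Oz" unfolding scale_def using assms(2) assms(3)[symmetric] by blast
  ultimately obtain k where "scale x Oz = scale (lam ^ k) Oz" using int_ideal_lam_power by blast
  then show ?thesis using scale_eq_imp_units_Oz by (metis lam_nz power_not_zero)
qed

lemma lam_power_multiple_of_p: "\<exists>t\<in>Oz. lam ^ ((p - 1) * n) = of_nat p ^ n * t"
proof -
  obtain s where s: "s \<in> Oz" "lam ^ (p - 1) = - of_nat p * (1 + lam * s)" using lam_relation by blast
  then have "lam ^ (p - 1) = of_nat p * (- (1 + lam * s))" by (simp only: mult_minus_left mult_minus_right)
  then have "lam ^ ((p - 1) * n) = of_nat p ^ n * (- (1 + lam * s)) ^ n"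
    by (simp only: power_mult power_mult_distrib)
  moreover have "(- (1 + lam * s)) ^ n \<in> Oz" using s(1) by (intro Oz_power Oz_closed Oz_simps)
  ultimately show ?thesis by blast
qed

text \<open>This will be identified with the group of p-units; (lam) is the only prime ideal above
  p.\<close>

definition Ep :: "complex set" where "Ep = {lam powi k * u | k u. u \<in> units_Oz}"

lemma Ep_closed:
  assumes "x \<in> Ep" "y \<in> Ep"
  shows "x * y \<in> Ep" "inverse x \<in> Ep"
proof -
  obtain k u l v where *: "x = lam powi k * u" "u \<in> units_Oz" "y = lam powi l * v" "v \<in> units_Oz"
    using assms unfolding Ep_def by blast
  have "x * y = lam powi (k + l) * (u * v)" by (simp add: * power_int_add)
  moreover have "u * v \<in> units_Oz" using * units_Oz_closed(2) by blast
  ultimately show "x * y \<in> Ep" unfolding Ep_def by blast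
  have "inverse x = lam powi (- k) * inverse u" by (simp add: * power_int_minus)
  moreover have "inverse u \<in> units_Oz" using * units_Oz_closed(3) by blast
  ultimately show "inverse x \<in> Ep" unfolding Ep_def by blast
qed

lemma Ep_I: "u \<in> units_Oz \<Longrightarrow> u * lam ^ k \<in> Ep"
  unfolding Ep_def by (auto intro!: exI[of _ "int k"] exI[of _ u] simp: power_int_of_nat)

lemma Ep_Kz: "x \<in> Ep \<Longrightarrow> x \<in> Kz \<and> x \<noteq> 0"
proof -
  assume "x \<in> Ep"
  then obtain k u where x: "x = lam powi k * u" "u \<in> units_Oz" by (auto simp: Ep_def)
  have "lam ^ m \<in> Kz" for m by (intro Oz_Kz Oz_power Oz_simps)
  then have "lam powi k \<in> Kz"
    unfolding power_int_def using Kz_inverse by (metis power_inverse)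
  then show ?thesis using x units_Oz_nz units_Oz_Oz by auto
qed

text \<open>If p^m x and p^n / x are integral, then p^m x divides p^(m+n) and hence a power of
  \<open>lam\<close>, and the divisors of powers of \<open>lam\<close> are units times powers of
  \<open>lam\<close>.\<close>

lemma p_units_iff:
  "x \<in> Ep \<longleftrightarrow> x \<noteq> 0 \<and> (\<exists>m. of_nat p ^ m * x \<in> Oz) \<and> (\<exists>m. of_nat p ^ m * inverse x \<in> Oz)"
proof
  have pE: "of_nat p ^ m \<in> Ep" for m
  proof -
    obtain t where "t \<in> Oz" "lam ^ ((p - 1) * m) = of_nat p ^ m * t" using lam_power_multiple_of_p by blast
    then show ?thesis using lam_power_divisor[of "of_nat p ^ m" t] Ep_I by (metis Oz_power Oz_simps(4))
  qed
  {
    assume *: "x \<noteq> 0 \<and> (\<exists>m. of_nat p ^ m * x \<in> Oz) \<and> (\<exists>m. of_nat p ^ m * inverse x \<in> Oz)"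
    then obtain m n where mn: "of_nat p ^ m * x \<in> Oz" "of_nat p ^ n * inverse x \<in> Oz" by blast
    obtain t where t: "t \<in> Oz" "lam ^ ((p - 1) * (m + n)) = of_nat p ^ (m + n) * t"
      using lam_power_multiple_of_p by blast
    have "(of_nat p ^ m * x) * ((of_nat p ^ n * inverse x) * t) = of_nat p ^ (m + n) * t"
      using * by (simp add: power_add field_simps)
    then have "of_nat p ^ m * x \<in> Ep"
      using lam_power_divisor[OF mn(1), of "(of_nat p ^ n * inverse x) * t"] t mn Ep_I
      by (metis Oz_closed(3))
    then have "(of_nat p ^ m * x) * inverse (of_nat p ^ m) \<in> Ep" using Ep_closed pE by blast
    then show "x \<in> Ep" by (simp add: field_simps)
  }
  have A: "\<exists>m. of_nat p ^ m * x \<in> Oz" if x: "x \<in> Ep" for x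
  proof -
    obtain k u where x: "x = lam powi k * u" "u \<in> units_Oz" using x by (auto simp: Ep_def)
    obtain t where t: "t \<in> Oz" "of_nat p = lam ^ 1 * t" using lam_power_dvd_p[of 1] p_gt_2 by force
    have "of_nat p ^ nat (- k) * lam powi k \<in> Oz"
    proof (cases "k \<ge> 0")
      case True
      then show ?thesis by (auto simp: power_int_def)
    next
      case False
      then have "of_nat p ^ nat (- k) * lam powi k = t ^ nat (- k)"
        by (simp add: t(2) power_int_def power_mult_distrib field_simps)
      then show ?thesis using t(1) by auto
    qed
    then have "of_nat p ^ nat (- k) * lam powi k * u \<in> Oz" using x(2) units_Oz_Oz by blast
    then show ?thesis by (auto simp: x(1) mult.assoc)
  qed
  assume x: "x \<in> Ep"
  then show "x \<noteq> 0 \<and> (\<exists>m. of_nat p ^ m * x \<in> Oz) \<and> (\<exists>m. of_nat p ^ m * inverse x \<in> Oz)"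
    using A[OF x] A[OF Ep_closed(2)[OF x x]] Ep_Kz by blast
qed


section \<open>Ideals whose power is principal up to the prime above p\<close>

definition ipow :: "complex set \<Rightarrow> nat \<Rightarrow> complex set" where
  "ipow I n = (iprod I ^^ n) Oz"

lemma ipow_simps [simp]: "ipow I 0 = Oz" "ipow I (Suc n) = iprod I (ipow I n)"
  by (simp_all add: ipow_def)

lemma frac_ideal_Oz [simp]: "frac_ideal Oz"
  by (rule int_ideal_frac_ideal) simp

lemma frac_ideal_ipow [simp]: "frac_ideal I \<Longrightarrow> frac_ideal (ipow I n)"
  by (induction n) (simp_all add: frac_ideal_iprod)

lemma ipow_mem: "x \<in> I \<Longrightarrow> x ^ n \<in> ipow I n"
  by (induction n) (simp_all add: iprod.iprod_mult)

lemma ipow_scale: "ipow (scale z I) n = scale (z ^ n) (ipow I n)"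
proof (induction n)
  case (Suc n)
  have "iprod (scale z I) (scale (z ^ n) (ipow I n)) = scale z (iprod I (scale (z ^ n) (ipow I n)))"
    by (rule iprod_scale)
  also have "iprod I (scale (z ^ n) (ipow I n)) = iprod (scale (z ^ n) (ipow I n)) I" by (rule iprod_commute)
  also have "\<dots> = scale (z ^ n) (iprod (ipow I n) I)" by (rule iprod_scale)
  also have "iprod (ipow I n) I = iprod I (ipow I n)" by (rule iprod_commute)
  finally show ?case using Suc by (simp add: scale_scale)
qed simp

lemma iprod_scale_Oz: "iprod (scale x Oz) (scale y Oz) = scale (x * y) Oz"
proof -
  have "iprod (scale x Oz) (scale y Oz) = scale x (iprod Oz (scale y Oz))" by (rule iprod_scale)
  also have "iprod Oz (scale y Oz) = iprod (scale y Oz) Oz" by (rule iprod_commute)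
  also have "\<dots> = scale y (iprod Oz Oz)" by (rule iprod_scale)
  finally show ?thesis by (simp add: iprod_Oz scale_scale)
qed

lemma ipow_Oz [simp]: "ipow Oz n = Oz"
  by (induction n) (simp_all add: iprod_Oz)

lemma ipow_iprod:
  assumes "frac_ideal I" "frac_ideal J"
  shows "ipow (iprod I J) n = iprod (ipow I n) (ipow J n)"
proof (induction n)
  case 0
  then show ?case by (simp add: iprod_Oz)
next
  case (Suc n)
  have "iprod (iprod I J) (iprod (ipow I n) (ipow J n)) = iprod I (iprod J (iprod (ipow I n) (ipow J n)))"
    using assms by (intro iprod_assoc frac_ideal_add_subgroup frac_ideal_iprod frac_ideal_ipow)
  also have "iprod J (iprod (ipow I n) (ipow J n)) = iprod (iprod (ipow I n) (ipow J n)) J"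
    by (rule iprod_commute)
  also have "\<dots> = iprod (ipow I n) (iprod (ipow J n) J)"
    using assms by (intro iprod_assoc frac_ideal_add_subgroup frac_ideal_ipow)
  also have "iprod I (iprod (ipow I n) (iprod (ipow J n) J)) = iprod (iprod I (ipow I n)) (iprod (ipow J n) J)"
    using assms by (intro iprod_assoc[symmetric] frac_ideal_add_subgroup frac_ideal_iprod frac_ideal_ipow)
  finally show ?case using Suc by (simp add: iprod_commute[of J])
qed

text \<open>Comaximality after \<open>lam\<close> is inverted: the ideal (x, y) contains a power of
  \<open>lam\<close>.\<close>

definition comax :: "complex \<Rightarrow> complex \<Rightarrow> bool" where
  "comax x y \<longleftrightarrow> (\<exists>m. \<exists>r\<in>Oz. \<exists>s\<in>Oz. r * x + s * y = lam ^ m)"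

lemma comax_sym: "comax x y \<Longrightarrow> comax y x"
  unfolding comax_def by (metis add.commute)

lemma comax_1: "comax x 1"
  unfolding comax_def by (intro exI[of _ 0] bexI[of _ 0] bexI[of _ 1]) auto

lemma comax_mult:
  assumes "comax x y" "comax x z" "x \<in> Oz" "y \<in> Oz" "z \<in> Oz"
  shows "comax x (y * z)"
proof -
  obtain m r s m' r' s' where *: "r \<in> Oz" "s \<in> Oz" "r * x + s * y = lam ^ m"
    "r' \<in> Oz" "s' \<in> Oz" "r' * x + s' * z = lam ^ m'"
    using assms(1,2) unfolding comax_def by blast
  have "(r * r' * x + r * s' * z + s * y * r') * x + (s * s') * (y * z) = (r * x + s * y) * (r' * x + s' * z)"
    by (simp add: algebra_simps)
  also have "\<dots> = lam ^ (m + m')" by (simp add: * power_add)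
  finally have "(r * r' * x + r * s' * z + s * y * r') * x + (s * s') * (y * z) = lam ^ (m + m')" .
  moreover have "r * r' * x + r * s' * z + s * y * r' \<in> Oz" "s * s' \<in> Oz"
    using * assms by (auto intro!: Oz_closed)
  ultimately show ?thesis unfolding comax_def by blast
qed

lemma comax_prod:
  assumes "finite A" "x \<in> Oz" "\<And>j. j \<in> A \<Longrightarrow> f j \<in> Oz \<and> comax x (f j)"
  shows "comax x (\<Prod>j\<in>A. f j)"
  using assms by (induction A rule: finite_induct) (auto intro!: comax_1 comax_mult)

lemma comax_power: "comax x y \<Longrightarrow> x \<in> Oz \<Longrightarrow> y \<in> Oz \<Longrightarrow> comax x (y ^ n)"
  using comax_prod[of "{..<n}" x "\<lambda>_. y"] by simp

text \<open>From s u + t v = 1 a combination of the two factors equals \<zeta>^j - \<zeta>^i, which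
  divides \<open>lam\<close>.\<close>

lemma comax_conjugates:
  fixes u v :: int
  assumes "coprime u v" "i < p" "j < p" "i \<noteq> j"
  shows "comax (of_int u + of_int v * \<zeta> ^ i) (of_int u + of_int v * \<zeta> ^ j)"
proof -
  obtain s t where "s * u + t * v = gcd u v" using bezout_int by blast
  then have st: "s * u + t * v = 1" using assms(1) by simp
  let ?k = "i + (p - j)"
  have "\<not> p dvd ?k"
  proof
    assume "p dvd ?k"
    then obtain c where c: "?k = p * c" by blast
    have "0 < p * c" "p * c < p * 2" unfolding c[symmetric] using assms by auto
    then have "0 < c" "c < 2" by (metis mult_0_right neq0_conv, metis nat_mult_less_cancel_disj)
    then have "c = 1" by simp
    then show False using c assms by simp
  qed
  then obtain y where y: "y \<in> Oz" "lam = (1 - \<zeta> ^ ?k) * y" using one_minus_zeta_power_dvd_lam by blast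
  have z1: "\<zeta> ^ j * \<zeta> ^ (p - j) = 1" using assms(3) by (simp flip: power_add)
  have "lam = (\<zeta> ^ j - \<zeta> ^ i) * (\<zeta> ^ (p - j) * y)"
  proof -
    have "(\<zeta> ^ j - \<zeta> ^ i) * (\<zeta> ^ (p - j) * y) = (\<zeta> ^ j * \<zeta> ^ (p - j) - \<zeta> ^ ?k) * y"
      by (simp add: power_add algebra_simps)
    then show ?thesis using z1 y by metis
  qed
  moreover have "(of_int s * \<zeta> ^ j - of_int t) * (of_int u + of_int v * \<zeta> ^ i) +
      (of_int t - of_int s * \<zeta> ^ i) * (of_int u + of_int v * \<zeta> ^ j) = of_int (s * u + t * v) * (\<zeta> ^ j - \<zeta> ^ i)"
    by (simp add: algebra_simps)
  moreover have "(A * Y) * B + (C * Y) * D = (A * B + C * D) * Y" for A B C D Y :: complex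
    by (simp add: algebra_simps)
  ultimately have "((of_int s * \<zeta> ^ j - of_int t) * (\<zeta> ^ (p - j) * y)) * (of_int u + of_int v * \<zeta> ^ i) +
      ((of_int t - of_int s * \<zeta> ^ i) * (\<zeta> ^ (p - j) * y)) * (of_int u + of_int v * \<zeta> ^ j) = lam ^ 1"
    unfolding st by simp
  moreover have "(of_int s * \<zeta> ^ j - of_int t) * (\<zeta> ^ (p - j) * y) \<in> Oz"
    "(of_int t - of_int s * \<zeta> ^ i) * (\<zeta> ^ (p - j) * y) \<in> Oz"
    using y by (auto intro!: Oz_closed)
  ultimately show ?thesis unfolding comax_def by blast
qed

lemma prod_conjugates:
  fixes u v :: int
  assumes "v \<noteq> 0"
  shows "(\<Prod>j<p. of_int u + of_int v * \<zeta> ^ j) = of_int (u ^ p + v ^ p)"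
proof -
  let ?z = "- of_int u / of_int v :: complex"
  have "(\<Prod>j<p. of_int u + of_int v * \<zeta> ^ j) = (\<Prod>j<p. (- of_int v) * (?z - \<zeta> ^ j))"
    using assms by (intro prod.cong) (auto simp: field_simps)
  also have "\<dots> = (- of_int v) ^ p * (\<Prod>j<p. ?z - \<zeta> ^ j)"
    by (simp only: prod.distrib prod_constant card_lessThan)
  also have "\<dots> = (- of_int v) ^ p * (?z ^ p - 1)" using root_of_unity_factorization[OF prim] by simp
  also have "\<dots> = (- of_int v * ?z) ^ p - (- of_int v) ^ p" unfolding power_mult_distrib
    by (simp add: algebra_simps)
  also have "\<dots> = of_int (u ^ p + v ^ p)" using assms p_odd by simp
  finally show ?thesis .
qed

lemma ipow_adjoin_sub:
  assumes x: "x \<in> Oz" "x \<noteq> 0" and c: "c \<in> Oz"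
  shows "ipow (adjoin (scale x Oz) c) n \<subseteq> adjoin (scale x Oz) (c ^ n)"
proof (induction n)
  case 0
  have "r \<in> adjoin (scale x Oz) 1" if "r \<in> Oz" for r
  proof -
    have "r = x * 0 + r * 1" by simp
    then show ?thesis unfolding adjoin_def scale_def using that Oz_simps(1) by blast
  qed
  then show ?case by auto
next
  case (Suc n)
  have fx: "frac_ideal (scale x Oz)" using int_ideal_principal[OF x] by simp
  have "iprod (adjoin (scale x Oz) c) (adjoin (scale x Oz) (c ^ n)) \<subseteq> adjoin (scale x Oz) (c ^ Suc n)"
  proof (rule iprod_least)
    show "add_subgroup (adjoin (scale x Oz) (c ^ Suc n))" using add_subgroup_adjoin fx by simp
    fix y z assume "y \<in> adjoin (scale x Oz) c" "z \<in> adjoin (scale x Oz) (c ^ n)"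
    then obtain a b a' b' where *: "a \<in> Oz" "b \<in> Oz" "a' \<in> Oz" "b' \<in> Oz" "y = x * a + b * c" "z = x * a' + b' * c ^ n"
      unfolding adjoin_def scale_def by blast
    have "y * z = x * (a * z + b * c * a') + (b * b') * c ^ Suc n" by (simp add: * algebra_simps)
    moreover have "a * z + b * c * a' \<in> Oz" "b * b' \<in> Oz" using * x c by (auto intro!: Oz_closed)
    ultimately show "y * z \<in> adjoin (scale x Oz) (c ^ Suc n)" unfolding adjoin_def scale_def by blast
  qed
  moreover have "ipow (adjoin (scale x Oz) c) (Suc n) \<subseteq> iprod (adjoin (scale x Oz) c) (adjoin (scale x Oz) (c ^ n))"
    using iprod_mono[OF subset_refl Suc] by simp
  ultimately show ?case by blast
qed

text \<open>The root is explicit: I = (x, c). Its n-th power lies in (x, c^n) = (x), since c^n = x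
  y. Conversely it contains x^n and x y, and some combination of x^(n-1) and y is a power of
  \<open>lam\<close>. So I^n is x times an ideal containing a power of \<open>lam\<close>.\<close>

lemma coprime_factor_ideal_power:
  assumes x: "x \<in> Oz" and y: "y \<in> Oz" and c: "c \<in> Oz" "c \<noteq> 0" and xy: "x * y = c ^ n" and n: "n > 0"
    and cm: "comax x y"
  shows "\<exists>I k. frac_ideal I \<and> ipow I n = scale (x * lam ^ k) Oz"
proof -
  have x0: "x \<noteq> 0" using xy c by auto
  define I where "I = adjoin (scale x Oz) c"
  have ix: "int_ideal (scale x Oz)" by (rule int_ideal_principal[OF x x0])
  have I: "frac_ideal I" unfolding I_def using int_ideal_adjoin[OF ix c(1)] by simp
  have fI: "frac_ideal (ipow I n)" by (rule frac_ideal_ipow[OF I])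
  have sub: "ipow I n \<subseteq> scale x Oz"
  proof
    fix z assume "z \<in> ipow I n"
    then have "z \<in> adjoin (scale x Oz) (c ^ n)" using ipow_adjoin_sub[OF x x0 c(1)] unfolding I_def by blast
    then obtain a b where "a \<in> Oz" "b \<in> Oz" "z = x * a + b * (x * y)" unfolding adjoin_def scale_def xy
      by blast
    then have "z = x * (a + b * y)" "a + b * y \<in> Oz" using y by (auto simp: algebra_simps intro!: Oz_closed)
    then show "z \<in> scale x Oz" by (auto simp: scale_def)
  qed
  have "x \<in> scale x Oz" by (auto simp: scale_def intro!: image_eqI[of _ _ 1])
  then have xI: "x \<in> I" "c \<in> I" using adjoin_sub[of "scale x Oz" c] ix unfolding I_def by auto
  have "comax y (x ^ (n - 1))" by (rule comax_power[OF comax_sym[OF cm] y x])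
  then obtain m r s where *: "r \<in> Oz" "s \<in> Oz" "r * y + s * x ^ (n - 1) = lam ^ m" unfolding comax_def
    by blast
  have "x * lam ^ m = r * c ^ n + s * x ^ n"
    unfolding *(3)[symmetric] xy[symmetric] using n by (simp add: algebra_simps power_eq_if)
  also have "\<dots> \<in> ipow I n"
    using * ipow_mem[OF xI(1)] ipow_mem[OF xI(2)]
      by (intro add_subgroup_add frac_ideal_add_subgroup fI frac_ideal_mult[OF fI])
  finally have mem: "x * lam ^ m \<in> ipow I n" .
  define J where "J = scale (1 / x) (ipow I n)"
  have "frac_ideal J" unfolding J_def using x x0 by (intro frac_ideal_scale fI Kz_divide Oz_Kz) auto
  moreover have "J \<subseteq> Oz" unfolding J_def using scale_mono[OF sub, of "1 / x"] x0 by (simp add: scale_scale)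
  ultimately have "int_ideal J" by (simp add: int_ideal_def del: int_ideal_frac_ideal)
  moreover have "lam ^ m \<in> J" unfolding J_def using mem x0 by (simp add: mem_scale_iff mult.commute)
  ultimately obtain k where "J = scale (lam ^ k) Oz" using int_ideal_lam_power by blast
  moreover have "ipow I n = scale x J" unfolding J_def using x0 by (simp add: scale_scale)
  ultimately have "ipow I n = scale (x * lam ^ k) Oz" by (simp add: scale_scale)
  then show ?thesis using I by blast
qed

text \<open>Up to \<open>p\<close>-th powers, this group contains all generators of \<open>W\<close>, and its quotient by \<open>Ep\<close> embeds into
  the \<open>p\<close>-torsion of the class group.\<close>
definition Vp :: "complex set" where
  "Vp = {x \<in> Kz - {0}. \<exists>k :: int. \<exists>I. frac_ideal I \<and> ipow I p = scale (x * lam powi k) Oz}"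

lemma Fermat_factor_Vp:
  fixes u v w :: int
  assumes "u ^ p + v ^ p + w ^ p = 0" "coprime u v" "v \<noteq> 0" "w \<noteq> 0" "i \<in> {1..p - 1}"
  shows "of_int u + of_int v * \<zeta> ^ i \<in> Vp"
proof -
  let ?X = "\<lambda>j. of_int u + of_int v * \<zeta> ^ j"
  let ?y = "\<Prod>j\<in>{..<p} - {i}. ?X j"
  have i: "i < p" using assms(5) p_gt_2 by auto
  have X: "?X j \<in> Oz" for j by (auto intro!: Oz_closed)
  have y: "?y \<in> Oz" using X by blast
  have "?X i * ?y = (\<Prod>j<p. ?X j)" using i by (subst prod.remove[of _ i]) auto
  also have "\<dots> = of_int (- w) ^ p"
  proof -
    have "u ^ p + v ^ p = (- w) ^ p" using assms(1) p_odd by simp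
    then show ?thesis unfolding prod_conjugates[OF assms(3)] by (simp del: of_int_minus)
  qed
  finally have xy: "?X i * ?y = of_int (- w) ^ p" .
  have "comax (?X i) ?y" using i X by (intro comax_prod) (auto intro!: comax_conjugates assms)
  then obtain I k where I: "frac_ideal I" "ipow I p = scale (?X i * lam ^ k) Oz"
    using coprime_factor_ideal_power[OF X y _ _ xy] assms(4) by auto
  have "?X i \<noteq> 0" using xy assms(4) by auto
  then show ?thesis unfolding Vp_def using I X[of i] Oz_Kz
    by (auto intro!: exI[of _ "int k"] exI[of _ I] simp: power_int_of_nat)
qed

lemma Vp_closed:
  assumes "x \<in> Vp" "y \<in> Vp"
  shows "x * y \<in> Vp" "inverse x \<in> Vp"
proof -
  obtain k I l J where *: "x \<in> Kz" "x \<noteq> 0" "y \<in> Kz" "y \<noteq> 0" "frac_ideal I" "frac_ideal J"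
    "ipow I p = scale (x * lam powi k) Oz" "ipow J p = scale (y * lam powi l) Oz"
    using assms unfolding Vp_def by blast
  have "ipow (iprod I J) p = scale (x * y * lam powi (k + l)) Oz"
    unfolding ipow_iprod[OF *(5,6)] *(7,8) iprod_scale_Oz by (simp add: power_int_add mult_ac)
  moreover have "frac_ideal (iprod I J)" by (rule frac_ideal_iprod[OF *(5,6)])
  moreover have "x * y \<in> Kz - {0}" using * by auto
  ultimately show "x * y \<in> Vp" unfolding Vp_def by blast
  obtain I' where I': "frac_ideal I'" "iprod I I' = Oz" using frac_ideal_invertible[OF *(5)] .
  have "iprod (ipow I p) (ipow I' p) = Oz" using ipow_iprod[OF *(5) I'(1), of p] I'(2) by simp
  then have "scale (x * lam powi k) (ipow I' p) = Oz"
    unfolding *(7) iprod_scale using I' by (simp add: iprod_Oz)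
  then have "scale (inverse (x * lam powi k)) Oz = ipow I' p"
    using * by (metis scale_scale scale_1 left_inverse lam_nz mult_eq_0_iff power_int_eq_0_iff)
  then have "ipow I' p = scale (inverse x * lam powi (- k)) Oz" by (simp add: power_int_minus)
  moreover have "inverse x \<in> Kz - {0}" using * by auto
  ultimately show "inverse x \<in> Vp" using I' unfolding Vp_def by blast
qed

lemma Ep_Vp:
  assumes "x \<in> Ep"
  shows "x \<in> Vp"
proof -
  obtain k u where x: "x = lam powi k * u" "u \<in> units_Oz" using assms by (auto simp: Ep_def)
  have "x * lam powi (- k) = u" by (simp add: x power_int_minus)
  then have "ipow Oz p = scale (x * lam powi (- k)) Oz" using scale_units_Oz[OF x(2)] by simp
  then show ?thesis using Ep_Kz[OF assms] frac_ideal_Oz unfolding Vp_def by blast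
qed

text \<open>If the ideal roots of x and y differ by the principal factor z, then y and x z^p
  generate the same ideal up to powers of \<open>lam\<close>. This computes the kernel of the map to
  the class group.\<close>

lemma Vp_same_class:
  assumes "frac_ideal I" "z \<noteq> 0" "x \<noteq> 0" "ipow I p = scale (x * lam powi k) Oz"
    "ipow (scale z I) p = scale (y * lam powi l) Oz"
  shows "\<exists>e\<in>Ep. y = x * e * z ^ p"
proof -
  have "scale (y * lam powi l) Oz = scale (z ^ p * (x * lam powi k)) Oz"
    using assms(4,5) ipow_scale[of z I p] by (simp add: scale_scale)
  then obtain u where u: "u \<in> units_Oz" "y * lam powi l = u * (z ^ p * (x * lam powi k))"
    using scale_eq_imp_units_Oz assms(2,3) lam_nz by (metis mult_eq_0_iff power_int_eq_0_iff power_not_zero)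
  have "y = y * lam powi l * lam powi (- l)" by (simp add: power_int_minus)
  also have "\<dots> = x * (lam powi (k - l) * u) * z ^ p" unfolding u(2)
    by (simp add: power_int_diff power_int_minus field_simps)
  finally show ?thesis using u(1) unfolding Ep_def by blast
qed

text \<open>Beyond the units there is one more factor p, for the exponent of \<open>lam\<close>
  modulo p.\<close>

lemma Ep_mod_powers:
  "\<exists>B\<subseteq>Ep. finite B \<and> card B \<le> p ^ (hf + 1) \<and> (\<forall>e\<in>Ep. \<exists>b\<in>B. \<exists>v\<in>Ep. e = b * v ^ p)"
proof -
  obtain B where B: "B \<subseteq> units_Oz" "finite B" "card B \<le> p ^ hf" "\<And>u. u \<in> units_Oz \<Longrightarrow> \<exists>b\<in>B. \<exists>v\<in>units_Oz. u = b * v ^ p"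
    using units_mod_powers by blast
  let ?C = "(\<lambda>(j, b). lam powi int j * b) ` ({..<p} \<times> B)"
  have "?C \<subseteq> Ep"
  proof clarify
    fix j b assume "b \<in> B"
    then have "b \<in> units_Oz" using B(1) by blast
    then show "lam powi int j * b \<in> Ep" unfolding Ep_def by blast
  qed
  moreover have "card ?C \<le> p ^ (hf + 1)"
    using card_image_le[of "{..<p} \<times> B" "\<lambda>(j, b). lam powi int j * b"] B(2,3)
      by (simp add: card_cartesian_product le_trans)
  moreover have "\<exists>b\<in>?C. \<exists>v\<in>Ep. e = b * v ^ p" if e0: "e \<in> Ep" for e
  proof -
    obtain k u where e: "e = lam powi k * u" "u \<in> units_Oz" using e0 unfolding Ep_def by blast
    obtain b v where bv: "b \<in> B" "v \<in> units_Oz" "u = b * v ^ p" using B(4)[OF e(2)] by blast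
    define j where "j = nat (k mod int p)"
    let ?q = "k div int p"
    have j: "int j = k mod int p" "j < p" unfolding j_def by (simp_all add: nat_less_iff)
    have "lam powi k = lam powi (int j + ?q * int p)" by (simp add: j)
    also have "\<dots> = lam powi int j * lam powi (?q * int p)" by (intro power_int_add) simp
    also have "lam powi (?q * int p) = (lam powi ?q) ^ p" by (simp only: power_int_mult power_int_of_nat)
    finally have "e = (lam powi int j * b) * (lam powi ?q * v) ^ p"
      by (simp only: e bv power_mult_distrib mult_ac)
    moreover have "lam powi int j * b \<in> ?C" using bv(1) j(2) by (intro image_eqI[of _ _ "(j, b)"]) auto
    moreover have "lam powi ?q * v \<in> Ep" unfolding Ep_def using bv(2) by blast
    ultimately show ?thesis by blast
  qed
  ultimately show ?thesis using B(2) by (intro exI[of _ ?C]) auto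
qed

end


section \<open>The groups of the statement\<close>

lemma complex_ring_simps [simp]:
  "carrier complex_ring = UNIV" "x \<otimes>\<^bsub>complex_ring\<^esub> y = x * y" "x \<oplus>\<^bsub>complex_ring\<^esub> y = x + y"
  "\<one>\<^bsub>complex_ring\<^esub> = 1" "\<zero>\<^bsub>complex_ring\<^esub> = 0"
  by (simp_all add: ring_of_type_algebra_def)

lemma complex_ring_inv:
  "\<ominus>\<^bsub>complex_ring\<^esub> x = - x" "x \<noteq> 0 \<Longrightarrow> inv\<^bsub>complex_ring\<^esub> x = inverse x"
proof -
  interpret C: Ring.field complex_ring by (rule field_from_type_algebra)
  show "\<ominus>\<^bsub>complex_ring\<^esub> x = - x" by (rule C.minus_equality) simp_all
  show "x \<noteq> 0 \<Longrightarrow> inv\<^bsub>complex_ring\<^esub> x = inverse x" by (rule C.comm_inv_char) simp_all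
qed

context cyclotomic
begin

text \<open>Used to show that the generated field and the generated ring of the statement contain
  Z[\<zeta>].\<close>

lemma Oz_least:
  assumes "1 \<in> S" "\<zeta> \<in> S" "\<And>x. x \<in> S \<Longrightarrow> - x \<in> S"
    "\<And>x y. x \<in> S \<Longrightarrow> y \<in> S \<Longrightarrow> x + y \<in> S" "\<And>x y. x \<in> S \<Longrightarrow> y \<in> S \<Longrightarrow> x * y \<in> S"
  shows "Oz \<subseteq> S"
proof
  fix x assume "x \<in> Oz"
  then obtain c where x: "x = (\<Sum>j<p - 1. of_int (c j) * \<zeta> ^ j)" by (rule Oz_coords)
  have z: "0 \<in> S" using assms(1,3) assms(4)[of 1 "- 1"] by simp
  have pw: "\<zeta> ^ j \<in> S" for j by (induction j) (simp_all add: assms)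
  have nat: "of_nat n \<in> S" for n by (induction n) (simp_all add: assms z)
  have int: "of_int k \<in> S" for k
    by (cases k rule: int_cases2) (use nat assms(3) in auto)
  have "(\<Sum>j<n. of_int (c j) * \<zeta> ^ j) \<in> S" for n
    by (induction n) (simp_all add: z assms(4,5) pw int)
  then show "x \<in> S" by (simp add: x)
qed

lemma cyc_field_carrier: "generate_field complex_ring {\<zeta>} = Kz"
proof
  show "generate_field complex_ring {\<zeta>} \<subseteq> Kz"
  proof
    fix x assume "x \<in> generate_field complex_ring {\<zeta>}"
    then show "x \<in> Kz"
      by (induction rule: generate_field.induct)
        (auto simp: complex_ring_inv intro: Kz_closed Kz_inverse Kz_minus Oz_Kz)
  qed
  let ?G = "generate_field complex_ring {\<zeta>}"
  note I = generate_field.intros[where R = complex_ring and H = "{\<zeta>}"]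
  have G: "1 \<in> ?G" "\<zeta> \<in> ?G" "x \<in> ?G \<Longrightarrow> - x \<in> ?G" "x \<in> ?G \<Longrightarrow> y \<in> ?G \<Longrightarrow> x + y \<in> ?G"
    "x \<in> ?G \<Longrightarrow> y \<in> ?G \<Longrightarrow> x * y \<in> ?G" "x \<in> ?G \<Longrightarrow> x \<noteq> 0 \<Longrightarrow> inverse x \<in> ?G" for x y
    using I(1) I(2)[of \<zeta>] I(3)[of x] I(4)[of x] I(5,6)[of x y] by (simp_all add: complex_ring_inv)
  have sub: "Oz \<subseteq> ?G" using G(1-5) by (intro Oz_least)
  show "Kz \<subseteq> ?G"
  proof
    fix x assume "x \<in> Kz"
    then obtain m :: int where m: "m \<noteq> 0" "of_int m * x \<in> Oz" unfolding Kz_def by blast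
    have "inverse (of_int m) * (of_int m * x) \<in> ?G" by (rule G(5)[OF G(6)]) (use m sub in auto)
    moreover have "inverse (of_int m) * (of_int m * x) = x" using m(1) by simp
    ultimately show "x \<in> ?G" by metis
  qed
qed

lemma cyc_field_simps [simp]:
  "carrier (cyc_field \<zeta>) = Kz" "x \<otimes>\<^bsub>cyc_field \<zeta>\<^esub> y = x * y" "x \<oplus>\<^bsub>cyc_field \<zeta>\<^esub> y = x + y"
  "\<one>\<^bsub>cyc_field \<zeta>\<^esub> = 1" "\<zero>\<^bsub>cyc_field \<zeta>\<^esub> = 0"
  by (simp_all add: cyc_field_def cyc_field_carrier)

lemma cyc_integers_eq [simp]: "cyc_integers \<zeta> = Oz"
  unfolding cyc_integers_def using integrally_closed algebraic_int_Oz Oz_Kz by auto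

section \<open>The multiplicative group of K modulo p-th powers\<close>

definition KU :: "complex monoid" where "KU = units_of (cyc_field \<zeta>)"

lemma KU_simps [simp]:
  "carrier KU = Kz - {0}" "x \<otimes>\<^bsub>KU\<^esub> y = x * y" "\<one>\<^bsub>KU\<^esub> = 1"
proof -
  have "x \<in> Units (cyc_field \<zeta>)" if "x \<in> Kz" "x \<noteq> 0" for x
    unfolding Units_def using that by (auto intro!: bexI[of _ "inverse x"])
  then show "carrier KU = Kz - {0}" by (auto simp: KU_def units_of_def Units_def)
qed (simp_all add: KU_def units_of_def)

lemma KU_pow [simp]: "x [^]\<^bsub>KU\<^esub> (n :: nat) = x ^ n"
  by (induction n) (simp_all add: mult.commute)

lemma comm_group_KU: "comm_group KU"
proof (rule comm_groupI)
  show "\<exists>y\<in>carrier KU. y \<otimes>\<^bsub>KU\<^esub> x = \<one>\<^bsub>KU\<^esub>" if "x \<in> carrier KU" for x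
    using that by (intro bexI[of _ "inverse x"]) auto
qed (auto simp: mult_ac intro: Oz_Kz)

definition pKU :: "complex set" where "pKU = power_subgroup p KU"

definition RG :: "complex set monoid" where "RG = KU Mod pKU"

definition cls :: "complex \<Rightarrow> complex set" where "cls x = pKU #>\<^bsub>KU\<^esub> x"

lemma radical_eq: "radical_group p \<zeta> = RG" "radical_class p \<zeta> = cls"
  unfolding radical_group_def radical_class_def RG_def cls_def KU_def pKU_def by (simp_all add: fun_eq_iff)

lemma subgroup_pKU: "subgroup pKU KU"
  unfolding pKU_def by (rule comm_group.subgroup_power_subgroup[OF comm_group_KU])

lemma comm_group_RG: "comm_group RG"
  unfolding RG_def by (rule comm_group.abelian_FactGroup[OF comm_group_KU subgroup_pKU])

lemma cls_hom: "group_hom KU RG cls"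
proof -
  interpret comm_group KU by (rule comm_group_KU)
  interpret R: comm_group RG by (rule comm_group_RG)
  have "cls \<in> hom KU RG"
    unfolding RG_def cls_def[abs_def]
    by (rule normal.r_coset_hom_Mod[OF subgroup_imp_normal[OF subgroup_pKU]])
  then show ?thesis by (intro group_hom.intro group_hom_axioms.intro is_group R.is_group)
qed

lemma cls_mult_power:
  assumes "x \<in> Kz" "x \<noteq> 0" "z \<in> Kz" "z \<noteq> 0"
  shows "cls (x * z ^ p) = cls x"
proof -
  interpret comm_group KU by (rule comm_group_KU)
  have xz: "x * z ^ p \<in> carrier KU" "x \<in> carrier KU"
    using nat_pow_closed[of z p] m_closed[of x "z ^ p"] assms by simp_all
  have "inv\<^bsub>KU\<^esub> x = inverse x" using assms by (intro comm_inv_char) auto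
  then have "x * z ^ p \<otimes>\<^bsub>KU\<^esub> inv\<^bsub>KU\<^esub> x = z ^ p" using assms by simp
  moreover have "z ^ p \<in> pKU" using assms by (auto simp: pKU_def power_subgroup_def)
  ultimately show ?thesis
    unfolding cls_def rcoset_eq_iff[OF subgroup_pKU xz] by metis
qed

lemma RG_pow:
  assumes "u \<in> carrier RG"
  shows "u [^]\<^bsub>RG\<^esub> p = \<one>\<^bsub>RG\<^esub>"
proof -
  interpret h: group_hom KU RG cls by (rule cls_hom)
  obtain x where x: "x \<in> carrier KU" "u = cls x" using assms by (auto simp: RG_def carrier_FactGroup cls_def)
  have "u [^]\<^bsub>RG\<^esub> p = cls (x ^ p)" using h.hom_nat_pow[OF x(1), of p] x(2) by simp
  also have "\<dots> = cls 1" using cls_mult_power[of 1 x] x(1) by (auto intro: Oz_Kz)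
  also have "\<dots> = \<one>\<^bsub>RG\<^esub>" using h.hom_one by simp
  finally show ?thesis .
qed

lemma subgroup_Vp: "subgroup Vp KU"
proof -
  interpret comm_group KU by (rule comm_group_KU)
  show ?thesis
  proof (rule subgroupI)
    show "Vp \<subseteq> carrier KU" by (auto simp: Vp_def)
    show "Vp \<noteq> {}" using Ep_Vp Ep_I[OF units_Oz_closed(1), of 0] by blast
    show "inv\<^bsub>KU\<^esub> x \<in> Vp" if "x \<in> Vp" for x
    proof -
      have "x \<in> Kz" "x \<noteq> 0" using that by (auto simp: Vp_def)
      then have "inv\<^bsub>KU\<^esub> x = inverse x" by (intro comm_inv_char) auto
      then show ?thesis using Vp_closed(2)[OF that that] by simp
    qed
  qed (simp add: Vp_closed)
qed

lemma p_units_eq: "p_units p \<zeta> = Ep"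
proof -
  let ?R = "generate_ring complex_ring {\<zeta>, 1 / of_nat p}"
  have R: "?R = {x. \<exists>m. of_nat p ^ m * x \<in> Oz}"
  proof
    show "?R \<subseteq> {x. \<exists>m. of_nat p ^ m * x \<in> Oz}"
    proof
      fix x assume "x \<in> ?R"
      then have "\<exists>m. of_nat p ^ m * x \<in> Oz"
      proof (induction rule: generate_ring.induct)
        case one
        then show ?case by (intro exI[of _ 0]) simp
      next
        case (incl h)
        then have "of_nat p ^ 1 * h \<in> Oz" by auto
        then show ?case ..
      next
        case (a_inv h)
        then show ?case by (auto simp: complex_ring_inv)
      next
        case (eng_add x y)
        then obtain m n where *: "of_nat p ^ m * x \<in> Oz" "of_nat p ^ n * y \<in> Oz" by blast
        have "of_nat p ^ (m + n) * (x + y) = of_nat p ^ n * (of_nat p ^ m * x) + of_nat p ^ m * (of_nat p ^ n * y)"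
          by (simp add: power_add algebra_simps)
        moreover have "\<dots> \<in> Oz"
          by (rule Oz_closed(1)) (auto intro!: Oz_closed(3)[OF _ *(1)] Oz_closed(3)[OF _ *(2)])
        ultimately show ?case by (metis complex_ring_simps(3))
      next
        case (eng_mult x y)
        then obtain m n where *: "of_nat p ^ m * x \<in> Oz" "of_nat p ^ n * y \<in> Oz" by blast
        have "of_nat p ^ (m + n) * (x * y) = (of_nat p ^ m * x) * (of_nat p ^ n * y)"
          by (simp add: power_add algebra_simps)
        moreover have "\<dots> \<in> Oz" by (rule Oz_closed(3)[OF *])
        ultimately show ?case by (metis complex_ring_simps(2))
      qed
      then show "x \<in> {x. \<exists>m. of_nat p ^ m * x \<in> Oz}" by simp
    qed
    note I = generate_ring.intros[where R = complex_ring and H = "{\<zeta>, 1 / of_nat p}"]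
    have G: "1 \<in> ?R" "\<zeta> \<in> ?R" "1 / of_nat p \<in> ?R" "x \<in> ?R \<Longrightarrow> - x \<in> ?R" "x \<in> ?R \<Longrightarrow> y \<in> ?R \<Longrightarrow> x + y \<in> ?R"
      "x \<in> ?R \<Longrightarrow> y \<in> ?R \<Longrightarrow> x * y \<in> ?R" for x y
      using I(1) I(2)[of \<zeta>] I(2)[of "1 / of_nat p"] I(3)[of x] I(4,5)[of x y]
        by (simp_all add: complex_ring_inv)
    have sub: "Oz \<subseteq> ?R" using G(1,2,4-6) by (intro Oz_least)
    have pw: "(1 / of_nat p) ^ m \<in> ?R" for m by (induction m) (simp_all only: power_0 power_Suc G(1,3,6))
    show "{x. \<exists>m. of_nat p ^ m * x \<in> Oz} \<subseteq> ?R"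
    proof clarify
      fix x m assume "of_nat p ^ m * x \<in> Oz"
      then have "(1 / of_nat p) ^ m * (of_nat p ^ m * x) \<in> ?R" using sub by (intro G(6)[OF pw]) auto
      moreover have "(1 / of_nat p) ^ m * (of_nat p ^ m * x) = x" by (simp add: power_one_over)
      ultimately show "x \<in> ?R" by metis
    qed
  qed
  have "x \<in> p_units p \<zeta> \<longleftrightarrow> x \<in> Ep" for x
  proof -
    have "x \<in> p_units p \<zeta> \<longleftrightarrow> x \<in> ?R \<and> (\<exists>y\<in>?R. x * y = 1)"
      unfolding p_units_def Units_def by (auto simp: mult.commute)
    also have "(\<exists>y\<in>?R. x * y = 1) \<longleftrightarrow> x \<noteq> 0 \<and> inverse x \<in> ?R"
      by (metis inverse_unique mult_zero_left right_inverse zero_neq_one)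
    finally show ?thesis unfolding p_units_iff R by auto
  qed
  then show ?thesis by blast
qed

section \<open>The ideal class group\<close>

definition IG :: "complex set monoid" where "IG = ideal_group (cyc_field \<zeta>) (cyc_integers \<zeta>)"

lemma ideal_prod_eq: "ideal_prod (cyc_field \<zeta>) I J = iprod I J"
proof (intro equalityI subsetI)
  show "x \<in> iprod I J" if "x \<in> ideal_prod (cyc_field \<zeta>) I J" for x
    using that by (induction rule: ideal_prod.induct) (auto intro: iprod.intros)
  show "x \<in> ideal_prod (cyc_field \<zeta>) I J" if "x \<in> iprod I J" for x
    using that ideal_prod.intros[where R = "cyc_field \<zeta>" and I = I and J = J]
      by (induction rule: iprod.induct) auto
qed

lemma fractional_ideals_eq: "fractional_ideals (cyc_field \<zeta>) Oz = {I. frac_ideal I}"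
proof -
  interpret A: abelian_group "cyc_field \<zeta>"
  proof (rule abelian_groupI)
    show "\<exists>y\<in>carrier (cyc_field \<zeta>). y \<oplus>\<^bsub>cyc_field \<zeta>\<^esub> x = \<zero>\<^bsub>cyc_field \<zeta>\<^esub>" if "x \<in> carrier (cyc_field \<zeta>)" for x
      using that by (intro bexI[of _ "- x"]) auto
  qed (auto simp: add_ac intro: Oz_Kz)
  have minus: "inv\<^bsub>add_monoid (cyc_field \<zeta>)\<^esub> x = - x" if "x \<in> Kz" for x
    using A.minus_equality[of "- x" x] that by (auto simp: a_inv_def)
  have "subgroup I (add_monoid (cyc_field \<zeta>)) \<longleftrightarrow> I \<subseteq> Kz \<and> add_subgroup I" for I
  proof
    assume I: "subgroup I (add_monoid (cyc_field \<zeta>))"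
    then have IK: "I \<subseteq> Kz" using subgroup.subset[OF I] by simp
    moreover have "x - y \<in> I" if "x \<in> I" "y \<in> I" for x y
      using subgroup.m_closed[OF I that(1) subgroup.m_inv_closed[OF I that(2)]] minus[of y] IK that by auto
    ultimately show "I \<subseteq> Kz \<and> add_subgroup I" using subgroup.one_closed[OF I] by (auto simp: add_subgroup_def)
  next
    assume I: "I \<subseteq> Kz \<and> add_subgroup I"
    then have "- x \<in> I" "x + y \<in> I" if "x \<in> I" "y \<in> I" for x y using that add_subgroup_minus add_subgroup_add
      by blast+
    then show "subgroup I (add_monoid (cyc_field \<zeta>))" using I minus
      by (auto simp: subgroup_def add_subgroup_def subset_iff)
  qed
  then show ?thesis unfolding fractional_ideals_def using frac_ideal_sub_Kz by (auto simp: frac_ideal_def)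
qed

lemma IG_simps [simp]:
  "carrier IG = {I. frac_ideal I}" "I \<otimes>\<^bsub>IG\<^esub> J = iprod I J" "\<one>\<^bsub>IG\<^esub> = Oz"
  by (simp_all add: IG_def ideal_group_def fractional_ideals_eq ideal_prod_eq)

lemma comm_group_IG: "comm_group IG"
proof (rule comm_groupI)
  show "\<exists>J\<in>carrier IG. J \<otimes>\<^bsub>IG\<^esub> I = \<one>\<^bsub>IG\<^esub>" if "I \<in> carrier IG" for I
    using that frac_ideal_invertible[of I] iprod_commute by (metis IG_simps mem_Collect_eq)
  show "I \<otimes>\<^bsub>IG\<^esub> J = J \<otimes>\<^bsub>IG\<^esub> I" for I J by (simp add: iprod_commute)
qed (auto simp: frac_ideal_iprod iprod_assoc iprod_Oz)

lemma IG_pow: "I [^]\<^bsub>IG\<^esub> (n :: nat) = ipow I n"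
  by (induction n) (simp_all add: iprod_commute[of _ I])

definition PI :: "complex set set" where "PI = {scale x Oz | x. x \<in> Kz - {0}}"

lemma principal_ideals_eq: "principal_ideals (cyc_field \<zeta>) Oz = PI"
  unfolding principal_ideals_def PI_def scale_def by (simp add: mult.commute)

lemma subgroup_PI: "subgroup PI IG"
proof -
  interpret comm_group IG by (rule comm_group_IG)
  show ?thesis
  proof (rule subgroupI)
    show "PI \<subseteq> carrier IG" by (auto simp: PI_def frac_ideal_scale)
    show "PI \<noteq> {}" unfolding PI_def using Oz_Kz by force
  next
    fix I assume "I \<in> PI"
    then obtain x where x: "I = scale x Oz" "x \<in> Kz" "x \<noteq> 0" by (auto simp: PI_def)
    have "inv\<^bsub>IG\<^esub> I = scale (inverse x) Oz"
      using x by (intro comm_inv_char) (auto simp: iprod_scale_Oz intro!: frac_ideal_scale)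
    then show "inv\<^bsub>IG\<^esub> I \<in> PI" using x unfolding PI_def by auto
  next
    fix I J assume "I \<in> PI" "J \<in> PI"
    then obtain x y where "I = scale x Oz" "x \<in> Kz" "x \<noteq> 0" "J = scale y Oz" "y \<in> Kz" "y \<noteq> 0"
      by (auto simp: PI_def)
    then show "I \<otimes>\<^bsub>IG\<^esub> J \<in> PI" unfolding PI_def by (auto simp: iprod_scale_Oz intro!: exI[of _ "x * y"])
  qed
qed

definition CG :: "complex set set monoid" where "CG = IG Mod PI"

definition icls :: "complex set \<Rightarrow> complex set set" where "icls I = PI #>\<^bsub>IG\<^esub> I"

lemma ideal_class_group_eq: "ideal_class_group (cyc_field \<zeta>) (cyc_integers \<zeta>) = CG"
  unfolding ideal_class_group_def CG_def IG_def using principal_ideals_eq by simp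

lemma comm_group_CG: "comm_group CG"
  unfolding CG_def by (rule comm_group.abelian_FactGroup[OF comm_group_IG subgroup_PI])

lemma CG_carrier: "carrier CG = icls ` {I. frac_ideal I}"
  by (auto simp: CG_def carrier_FactGroup icls_def)

lemma icls_eq_iff:
  assumes "frac_ideal I" "frac_ideal J"
  shows "icls I = icls J \<longleftrightarrow> (\<exists>z\<in>Kz - {0}. I = scale z J)"
proof -
  interpret comm_group IG by (rule comm_group_IG)
  have IJ: "I \<in> carrier IG" "J \<in> carrier IG" using assms by simp_all
  have "icls I = icls J \<longleftrightarrow> I \<otimes>\<^bsub>IG\<^esub> inv\<^bsub>IG\<^esub> J \<in> PI"
    unfolding icls_def by (rule rcoset_eq_iff[OF subgroup_PI IJ])
  also have "\<dots> \<longleftrightarrow> (\<exists>z\<in>Kz - {0}. I \<otimes>\<^bsub>IG\<^esub> inv\<^bsub>IG\<^esub> J = scale z Oz)" unfolding PI_def by blast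
  also have "\<dots> \<longleftrightarrow> (\<exists>z\<in>Kz - {0}. I = scale z J)"
  proof (rule bex_cong[OF refl])
    fix z assume z: "z \<in> Kz - {0}"
    have "I \<otimes>\<^bsub>IG\<^esub> inv\<^bsub>IG\<^esub> J = scale z Oz \<longleftrightarrow> I = scale z Oz \<otimes>\<^bsub>IG\<^esub> J"
      using IJ z inv_solve_right[of "scale z Oz" I J] frac_ideal_scale[OF frac_ideal_Oz, of z] by auto
    then show "I \<otimes>\<^bsub>IG\<^esub> inv\<^bsub>IG\<^esub> J = scale z Oz \<longleftrightarrow> I = scale z J" using assms(2)
      by (simp add: iprod_scale iprod_Oz)
  qed
  finally show ?thesis .
qed

lemma icls_pow:
  assumes "frac_ideal I"
  shows "icls I [^]\<^bsub>CG\<^esub> (n :: nat) = icls (ipow I n)"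
proof -
  interpret comm_group IG by (rule comm_group_IG)
  show ?thesis
    using normal.FactGroup_pow[OF subgroup_imp_normal[OF subgroup_PI], of I n] assms
    unfolding CG_def icls_def by (simp add: IG_pow)
qed

lemma CG_one: "\<one>\<^bsub>CG\<^esub> = icls Oz"
proof -
  interpret comm_group IG by (rule comm_group_IG)
  show ?thesis using coset_mult_one[OF subgroup.subset[OF subgroup_PI]] by (simp add: CG_def icls_def)
qed

lemma card_CG: "finite (carrier CG)" "card (carrier CG) < p ^ (hf + 1)"
proof -
  have sub: "carrier CG \<subseteq> icls ` ideals_upto Mb"
  proof
    fix c assume "c \<in> carrier CG"
    then obtain I where I: "frac_ideal I" "c = icls I" by (auto simp: CG_carrier)
    obtain J x where J: "int_ideal J" "real (index Oz J) \<le> Mb" "x \<in> Kz" "x \<noteq> 0" "I = scale x J"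
      using small_class_representative[OF I(1)] by blast
    then have "c = icls J" unfolding I(2) using icls_eq_iff[OF I(1)] by auto
    then show "c \<in> icls ` ideals_upto Mb" using J unfolding ideals_upto_def by blast
  qed
  have fin: "finite (ideals_upto Mb)" using card_ideals_upto_Mb by blast
  then show "finite (carrier CG)" using sub finite_surj by blast
  have "card (carrier CG) \<le> card (ideals_upto Mb)" by (rule surj_card_le[OF fin sub])
  moreover have "real (card (ideals_upto Mb)) < real (p ^ (hf + 1))" using card_ideals_upto_Mb by simp
  then have "card (ideals_upto Mb) < p ^ (hf + 1)" by (simp only: of_nat_less_iff)
  ultimately show "card (carrier CG) < p ^ (hf + 1)" by simp
qed

section \<open>From \<open>Vp\<close> to the p-torsion of the class group\<close>

definition CGp :: "complex set set set" where "CGp = {c \<in> carrier CG. c [^]\<^bsub>CG\<^esub> p = \<one>\<^bsub>CG\<^esub>}"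

text \<open>A relation, as k and I are not determined by x: k may grow by p while I is multiplied by
  \<open>lam\<close>.\<close>

definition root_class :: "complex \<Rightarrow> complex set set \<Rightarrow> bool" where
  "root_class x c \<longleftrightarrow> (\<exists>k :: int. \<exists>I. frac_ideal I \<and> ipow I p = scale (x * lam powi k) Oz \<and> c = icls I)"

lemma ex_root_class:
  assumes "x \<in> Vp"
  shows "\<exists>c\<in>CGp. root_class x c"
proof -
  obtain k I where I: "frac_ideal I" "ipow I p = scale (x * lam powi k) Oz" "x \<in> Kz" "x \<noteq> 0"
    using assms unfolding Vp_def by blast
  have "lam powi k * 1 \<in> Ep" unfolding Ep_def using units_Oz_closed(1) by blast
  then have "lam powi k \<in> Kz" using Ep_Kz by simp
  then have "icls (ipow I p) = icls Oz" using I icls_eq_iff[OF frac_ideal_ipow[OF I(1), of p] frac_ideal_Oz]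
    by auto
  then have "icls I \<in> CGp" using I(1) by (auto simp: CGp_def CG_carrier icls_pow CG_one)
  then show ?thesis unfolding root_class_def using I by blast
qed

lemma root_class_unique:
  assumes "x \<in> Vp" "y \<in> Vp" "root_class x c" "root_class y c"
  shows "\<exists>e\<in>Ep. \<exists>z\<in>Kz - {0}. y = x * e * z ^ p"
proof -
  obtain k I where I: "frac_ideal I" "ipow I p = scale (x * lam powi k) Oz" "c = icls I"
    using assms(3) unfolding root_class_def by blast
  obtain l J where J: "frac_ideal J" "ipow J p = scale (y * lam powi l) Oz" "c = icls J"
    using assms(4) unfolding root_class_def by blast
  obtain z where z: "z \<in> Kz - {0}" "J = scale z I" using icls_eq_iff[OF J(1) I(1)] I(3) J(3) by auto
  have "x \<noteq> 0" "z \<noteq> 0" using assms(1) z(1) by (auto simp: Vp_def)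
  then show ?thesis using Vp_same_class[OF I(1) _ _ I(2) J(2)[unfolded z(2)]] z(1) by blast
qed

text \<open>For every class a representative \<open>f c\<close> in \<open>Vp\<close> is fixed. Any x
  with that class is \<open>f c\<close> times a p-unit times a p-th power, so its image is
  determined by c and one of the representatives of p-units modulo p-th powers.\<close>

lemma card_cls_Vp: "finite (cls ` Vp)" "card (cls ` Vp) \<le> card CGp * p ^ (hf + 1)"
proof -
  obtain B where B: "B \<subseteq> Ep" "finite B" "card B \<le> p ^ (hf + 1)" "\<And>e. e \<in> Ep \<Longrightarrow> \<exists>b\<in>B. \<exists>v\<in>Ep. e = b * v ^ p"
    using Ep_mod_powers by blast
  define f where "f c = (SOME x. x \<in> Vp \<and> root_class x c)" for c
  have fin: "finite (CGp \<times> B)" using card_CG(1) B(2) by (simp add: CGp_def)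
  have sub: "cls ` Vp \<subseteq> (\<lambda>(c, b). cls (f c * b)) ` (CGp \<times> B)"
  proof clarify
    fix x assume x: "x \<in> Vp"
    then obtain c where c: "c \<in> CGp" "root_class x c" using ex_root_class by blast
    have f: "f c \<in> Vp" "root_class (f c) c"
      unfolding f_def using someI_ex[of "\<lambda>x. x \<in> Vp \<and> root_class x c"] x c(2) by blast+
    obtain e z where e: "e \<in> Ep" "z \<in> Kz - {0}" "x = f c * e * z ^ p"
      using root_class_unique[OF f(1) x f(2) c(2)] by blast
    obtain b v where b: "b \<in> B" "v \<in> Ep" "e = b * v ^ p" using B(4)[OF e(1)] by blast
    have "x = (f c * b) * (v * z) ^ p" by (simp add: e b power_mult_distrib)
    moreover have "f c \<in> Kz - {0}" using f(1) by (auto simp: Vp_def)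
    ultimately have "cls x = cls (f c * b)"
      using b B(1) e(2) Ep_Kz[of b] Ep_Kz[of v] cls_mult_power[of "f c * b" "v * z"] by auto
    then show "cls x \<in> (\<lambda>(c, b). cls (f c * b)) ` (CGp \<times> B)" using c(1) b(1) by auto
  qed
  then show "finite (cls ` Vp)" using fin finite_surj by blast
  have "card (cls ` Vp) \<le> card (CGp \<times> B)" by (rule surj_card_le[OF fin sub])
  also have "\<dots> \<le> card CGp * p ^ (hf + 1)" using B(3) by (simp add: card_cartesian_product)
  finally show "card (cls ` Vp) \<le> card CGp * p ^ (hf + 1)" .
qed

text \<open>If the p-torsion is trivial, x has the same class as 1, hence differs from 1 by a p-unit
  and a p-th power.\<close>

lemma cls_Vp_regular:
  assumes "CGp = {\<one>\<^bsub>CG\<^esub>}" "x \<in> Vp"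
  shows "cls x \<in> cls ` Ep"
proof -
  have one: "1 \<in> Ep" using Ep_I[OF units_Oz_closed(1), of 0] by simp
  have "root_class 1 (icls Oz)" unfolding root_class_def by (intro exI[of _ 0] exI[of _ Oz]) simp
  moreover have "root_class x (icls Oz)" using ex_root_class[OF assms(2)] assms(1) CG_one by simp
  ultimately obtain e z where e: "e \<in> Ep" "z \<in> Kz - {0}" "x = 1 * e * z ^ p"
    using root_class_unique[OF Ep_Vp[OF one] assms(2)] by blast
  then have "cls x = cls e" using cls_mult_power[of e z] Ep_Kz by simp
  then show ?thesis using e(1) by blast
qed

lemma rank_bounds:
  fixes a b c :: int
  assumes nz: "a \<noteq> 0" "b \<noteq> 0" "c \<noteq> 0" and cop: "coprime a b" "coprime b c" "coprime c a"
    and eq: "a ^ p + b ^ p + c ^ p = 0"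
  shows "rk p (W_group p \<zeta> a b c) \<le> enat ((p + 1) div 2) + rk p (p_class_group p \<zeta>) \<and>
    enat ((p + 1) div 2) + rk p (p_class_group p \<zeta>) \<le> enat p \<and>
    (carrier (p_class_group p \<zeta>) = {\<one>\<^bsub>p_class_group p \<zeta>\<^esub>} \<longrightarrow>
      carrier (W_group p \<zeta> a b c) = radical_class p \<zeta> ` p_units p \<zeta>)"
proof -
  define S where "S = Ep \<union> {of_int a + of_int b * \<zeta> ^ i | i. i \<in> {1..p - 1}}
            \<union> {of_int b + of_int c * \<zeta> ^ j | j. j \<in> {1..p - 1}}
            \<union> {of_int c + of_int a * \<zeta> ^ k | k. k \<in> {1..p - 1}}"
  define W where "W = generate RG (cls ` S)"
  have WG: "W_group p \<zeta> a b c = RG\<lparr>carrier := W\<rparr>"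
    unfolding W_group_def W_def S_def radical_eq p_units_eq by simp
  interpret RG: comm_group RG by (rule comm_group_RG)
  interpret h: group_hom KU RG cls by (rule cls_hom)
  have SV: "S \<subseteq> Vp"
    unfolding S_def using Fermat_factor_Vp[of a b c] Fermat_factor_Vp[of b c a] Fermat_factor_Vp[of c a b] nz cop eq Ep_Vp
    by (auto simp: add_ac)
  have Vsub: "subgroup (cls ` Vp) RG" by (rule h.subgroup_img_is_subgroup[OF subgroup_Vp])
  have WV: "W \<subseteq> cls ` Vp" unfolding W_def using SV by (intro RG.generate_subgroup_incl[OF _ Vsub]) blast
  have SR: "cls ` S \<subseteq> carrier RG" using SV subgroup.subset[OF Vsub] by blast
  have Wsub: "subgroup W RG" unfolding W_def by (rule RG.generate_is_subgroup[OF SR])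
  have Wfin: "finite W" using WV card_cls_Vp(1) finite_subset by blast
  have "\<exists>r. rk p (RG\<lparr>carrier := W\<rparr>) = enat r \<and> card (carrier (RG\<lparr>carrier := W\<rparr>)) = p ^ r"
  proof (rule rk_exponent[OF RG.comm_group_subgroup[OF Wsub] prime_p])
    show "finite (carrier (RG\<lparr>carrier := W\<rparr>))" using Wfin by simp
    fix x assume "x \<in> carrier (RG\<lparr>carrier := W\<rparr>)"
    then have "x \<in> carrier RG" using subgroup.subset[OF Wsub] by auto
    then show "x [^]\<^bsub>RG\<lparr>carrier := W\<rparr>\<^esub> p = \<one>\<^bsub>RG\<lparr>carrier := W\<rparr>\<^esub>"
      using RG_pow RG.nat_pow_consistent[of x p W] by simp
  qed
  then obtain rw where rw: "rk p (W_group p \<zeta> a b c) = enat rw" "card W = p ^ rw" by (auto simp: WG)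
  have pcg: "p_class_group p \<zeta> = sylow_part p CG" unfolding p_class_group_def ideal_class_group_eq ..
  obtain rc where rc: "rk p (p_class_group p \<zeta>) = enat rc" "card CGp = p ^ rc"
    using rk_sylow_part(1)[OF comm_group_CG card_CG(1) prime_p] unfolding pcg CGp_def by blast
  have "p ^ rw \<le> card (cls ` Vp)" using card_mono[OF card_cls_Vp(1) WV] rw(2) by simp
  also have "\<dots> \<le> p ^ (rc + (hf + 1))" using card_cls_Vp(2) rc(2) by (simp only: power_add)
  finally have 1: "rw \<le> rc + (hf + 1)" using prime_gt_1_nat[OF prime_p] by (rule power_le_imp_le_exp[rotated])
  have "p ^ rc \<le> card (carrier CG)" using card_mono[OF card_CG(1), of CGp] rc(2) by (auto simp: CGp_def)
  also have "\<dots> < p ^ (hf + 1)" by (rule card_CG(2))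
  \<comment> \<open>Strictness in \<open>card_CG\<close> matters: it gives a rank of at most
    \<open>hf\<close>, and (hf + 1) + hf = p.\<close>
  finally have 2: "rc < hf + 1" using prime_gt_1_nat[OF prime_p] by (rule power_less_imp_less_exp[rotated])
  have 3: "carrier (W_group p \<zeta> a b c) = radical_class p \<zeta> ` p_units p \<zeta>"
    if "carrier (p_class_group p \<zeta>) = {\<one>\<^bsub>p_class_group p \<zeta>\<^esub>}"
  proof -
    have "CGp = {\<one>\<^bsub>CG\<^esub>}"
      using rk_sylow_part(2)[OF comm_group_CG card_CG(1) prime_p] that unfolding pcg CGp_def by blast
    then have "W \<subseteq> cls ` Ep" using WV cls_Vp_regular by blast
    moreover have "cls ` Ep \<subseteq> W" unfolding W_def S_def by (auto intro!: generate.incl)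
    ultimately show ?thesis unfolding WG radical_eq p_units_eq by simp
  qed
  have "(p + 1) div 2 = hf + 1" "p = 2 * hf + 1" using hf(3) by simp_all
  then show ?thesis using 1 2 3 unfolding rw(1) rc(1) by simp
qed

end

theorem theorem2p6:
  fixes p :: nat and \<zeta> :: complex and a b c :: int
  assumes "Factorial_Ring.prime p" and "p > 2"
    and "is_primitive_root p \<zeta>"
    and "a \<noteq> 0" and "b \<noteq> 0" and "c \<noteq> 0"
    and "coprime a b" and "coprime b c" and "coprime c a"
    and "a ^ p + b ^ p + c ^ p = 0"
    and "int p dvd a * b * c \<longrightarrow> int p dvd c"
  shows "rk p (W_group p \<zeta> a b c) \<le> enat ((p + 1) div 2) + rk p (p_class_group p \<zeta>) \<and>
    enat ((p + 1) div 2) + rk p (p_class_group p \<zeta>) \<le> enat p \<and>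
    (carrier (p_class_group p \<zeta>) = {\<one>\<^bsub>p_class_group p \<zeta>\<^esub>} \<longrightarrow>
      carrier (W_group p \<zeta> a b c) = radical_class p \<zeta> ` p_units p \<zeta>)"
proof -
  interpret cyclotomic p \<zeta> by (rule cyclotomic.intro) (fact assms)+
  show ?thesis by (rule rank_bounds) (fact assms)+
qed

end
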